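(* Let $E:[0,\infty)\times\mathbb R^2\to\mathbb R^2$ be a given electric field. For all $\varepsilon>0$, $\Delta t>0$ and initial data $(x_\varepsilon^0,v_\varepsilon^0)\in\mathbb R^2\times\mathbb R^2$, consider the first-order scheme, for $n\ge 0$ and $t_n=n\Delta t$, $$\frac{x_\varepsilon^{n+1}-x_\varepsilon^n}{\Delta t}=\frac{v_\varepsilon^{n+1}}{\varepsilon},\qquad \varepsilon\,\frac{v_\varepsilon^{n+1}-v_\varepsilon^n}{\Delta t}=E(t_n,x_\varepsilon^n)-\frac{(v_\varepsilon^{n+1})^\perp}{\varepsilon}.$$ This scheme possesses a unique solution $(x_\varepsilon^n,v_\varepsilon^n)_{n\ge0}$. Moreover, let $(x_\varepsilon(t),v_\varepsilon(t))$ be the exact solution of the characteristic system (see context) with the same initial data at $t=0$, and set $y_\varepsilon(t)=x_\varepsilon(t)-\varepsilon v_\varepsilon^\perp(t)$, $y_\varepsilon^n=x_\varepsilon^n-\varepsilon(v_\varepsilon^n)^\perp$. Then: (i) when $E\in W^{1,\infty}$, there is a constant $C$ depending only on $E$ such that for all $n\ge0$, $\Delta t>0$, $\varepsilon>0$ and all initial data, $$\|x_\varepsilon^n-x_\varepsilon(t_n)\|\le C\,(1+t_n^2)\,e^{2K_xt_n}\,(1+\|v_\varepsilon^0\|+\varepsilon)\,\min\left(\frac{\Delta t}{\varepsilon^3}(1+\varepsilon^2),\ \Delta t+\varepsilon\right);$$ (ii) when $E\in W^{2,\infty}$, there is a constant $C$ depending only on $E$ such that for all $n\ge0$, $\Delta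 t>0$, $\varepsilon>0$ and all initial data, $$\|y_\varepsilon^n-y_\varepsilon(t_n)\|\le C\,(1+t_n^4)\,e^{2K_xt_n}\,(1+\|v_\varepsilon^0\|^2+\varepsilon^2)\,\min\left(\frac{\Delta t}{\varepsilon^3}(1+\varepsilon),\ \Delta t+\varepsilon^2\right).$$
   Context: For $a=(a_1,a_2)\in\mathbb R^2$, $a^\perp:=(-a_2,a_1)$. $\|\cdot\|$ is the Euclidean norm on vectors and the corresponding operator norm on linear maps. $E\in W^{k,\infty}$ means that $E$ and its derivatives in $(t,x)\in[0,\infty)\times\mathbb R^2$ up to order $k$ are globally bounded. $K_x:=\|\mathrm d_xE\|_{L^\infty}$, where $\mathrm d_x$ is the differential in $x$. The characteristic system is, for $t\ge0$, $$\varepsilon x_\varepsilon'(t)=v_\varepsilon(t),\qquad \varepsilon v_\varepsilon'(t)=E(t,x_\varepsilon(t))-\frac{v_\varepsilon^\perp(t)}{\varepsilon},\qquad x_\varepsilon(0)=x_\varepsilon^0,\ v_\varepsilon(0)=v_\varepsilon^0.$$ *)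

theory Defs
  imports "HOL-Analysis.Analysis" "HOL-Probability.Essential_Supremum"
begin

section \<open>Weak derivatives and the spaces \<open>W(k, \<infinity>)\<close>\<close>

primrec Ck :: "nat \<Rightarrow> ('a::euclidean_space \<Rightarrow> 'b::real_normed_vector) \<Rightarrow> bool" where
  "Ck 0 f \<longleftrightarrow> continuous_on UNIV f"
| "Ck (Suc k) f \<longleftrightarrow> (\<forall>z. f differentiable (at z)) \<and>
     (\<forall>b\<in>Basis. Ck k (\<lambda>z. frechet_derivative f (at z) b))"

definition test_function :: "'a::euclidean_space set \<Rightarrow> ('a \<Rightarrow> real) \<Rightarrow> bool" where
  "test_function \<Omega> \<phi> \<longleftrightarrow> (\<forall>k. Ck k \<phi>) \<and>
     compact (closure {z. \<phi> z \<noteq> 0}) \<and> closure {z. \<phi> z \<noteq> 0} \<subseteq> \<Omega>"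

definition locally_integrable ::
    "'a::euclidean_space set \<Rightarrow> ('a \<Rightarrow> 'b::euclidean_space) \<Rightarrow> bool" where
  "locally_integrable \<Omega> F \<longleftrightarrow> (\<forall>K. compact K \<and> K \<subseteq> \<Omega> \<longrightarrow> set_integrable lebesgue K F)"

definition has_weak_partial ::
    "'a::euclidean_space set \<Rightarrow> ('a \<Rightarrow> 'b::euclidean_space) \<Rightarrow> 'a \<Rightarrow> ('a \<Rightarrow> 'b) \<Rightarrow> bool" where
  "has_weak_partial \<Omega> F b g \<longleftrightarrow> locally_integrable \<Omega> F \<and> locally_integrable \<Omega> g \<and>
     (\<forall>\<phi>. test_function \<Omega> \<phi> \<longrightarrow>
        (\<integral>z. frechet_derivative \<phi> (at z) b *\<^sub>R F z \<partial>lebesgue_on \<Omega>) =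
        - (\<integral>z. \<phi> z *\<^sub>R g z \<partial>lebesgue_on \<Omega>))"

definition Linf :: "'a::euclidean_space set \<Rightarrow> ('a \<Rightarrow> 'b::euclidean_space) \<Rightarrow> bool" where
  "Linf \<Omega> F \<longleftrightarrow> F \<in> borel_measurable (lebesgue_on \<Omega>) \<and>
     (\<exists>M. AE z in lebesgue_on \<Omega>. norm (F z) \<le> M)"

primrec Winf :: "nat \<Rightarrow> 'a::euclidean_space set \<Rightarrow> ('a \<Rightarrow> 'b::euclidean_space) \<Rightarrow> bool" where
  "Winf 0 \<Omega> F \<longleftrightarrow> Linf \<Omega> F"
| "Winf (Suc k) \<Omega> F \<longleftrightarrow> Linf \<Omega> F \<and>
     (\<forall>b\<in>Basis. \<exists>g. has_weak_partial \<Omega> F b g \<and> Winf k \<Omega> g)"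

definition has_weak_derivative ::
    "'a::euclidean_space set \<Rightarrow> ('a \<Rightarrow> 'b::euclidean_space) \<Rightarrow> ('a \<Rightarrow> 'a \<Rightarrow> 'b) \<Rightarrow> bool" where
  "has_weak_derivative \<Omega> F D \<longleftrightarrow> (\<forall>z. bounded_linear (D z)) \<and>
     (\<forall>b\<in>Basis. has_weak_partial \<Omega> F b (\<lambda>z. D z b))"

text \<open>The choice is immaterial: weak derivatives are unique up to null sets.\<close>

definition weak_derivative ::
    "'a::euclidean_space set \<Rightarrow> ('a \<Rightarrow> 'b::euclidean_space) \<Rightarrow> 'a \<Rightarrow> 'a \<Rightarrow> 'b" where
  "weak_derivative \<Omega> F = (SOME D. has_weak_derivative \<Omega> F D)"

section \<open>Electric fields\<close>

text \<open>A field is a function of \<open>(t, x)\<close>; its values for \<open>t < 0\<close> are never used.\<close>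

type_synonym efield = "real \<times> (real^2) \<Rightarrow> real^2"

definition phase :: "(real \<times> (real^2)) set" where
  "phase = {0<..} \<times> UNIV"

text \<open>An element of \<open>W(k, \<infinity>)\<close> with \<open>k \<ge> 1\<close> is evaluated pointwise through its
  continuous representative, which extends continuously to \<open>t = 0\<close>.\<close>

definition Winf_field :: "nat \<Rightarrow> efield \<Rightarrow> bool" where
  "Winf_field k E \<longleftrightarrow> continuous_on ({0..} \<times> UNIV) E \<and> Winf k phase E"

definition K_x :: "efield \<Rightarrow> real" where
  "K_x E = real_of_ereal (esssup (lebesgue_on phase)
     (\<lambda>z. ereal (onorm (\<lambda>h. weak_derivative phase E z (0, h)))))"

section \<open>The characteristic system and the scheme\<close>

definition perp :: "real^2 \<Rightarrow> real^2" where
  "perp a = vector [- (a $ 2), a $ 1]"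

definition exact_solution ::
    "efield \<Rightarrow> real \<Rightarrow> real^2 \<Rightarrow> real^2 \<Rightarrow> (real \<Rightarrow> real^2) \<Rightarrow> (real \<Rightarrow> real^2) \<Rightarrow> bool" where
  "exact_solution E \<epsilon> x0 v0 x v \<longleftrightarrow> x 0 = x0 \<and> v 0 = v0 \<and>
     (\<forall>t\<ge>0. \<exists>x' v'. (x has_vector_derivative x') (at t within {0..}) \<and>
        (v has_vector_derivative v') (at t within {0..}) \<and>
        \<epsilon> *\<^sub>R x' = v t \<and> \<epsilon> *\<^sub>R v' = E (t, x t) - perp (v t) /\<^sub>R \<epsilon>)"

definition scheme_solution ::
    "efield \<Rightarrow> real \<Rightarrow> real \<Rightarrow> real^2 \<Rightarrow> real^2 \<Rightarrow> (nat \<Rightarrow> real^2) \<Rightarrow> (nat \<Rightarrow> real^2) \<Rightarrow> bool" where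
  "scheme_solution E \<epsilon> \<Delta>t x0 v0 xs vs \<longleftrightarrow> xs 0 = x0 \<and> vs 0 = v0 \<and>
     (\<forall>n. (xs (Suc n) - xs n) /\<^sub>R \<Delta>t = vs (Suc n) /\<^sub>R \<epsilon> \<and>
        \<epsilon> *\<^sub>R ((vs (Suc n) - vs n) /\<^sub>R \<Delta>t) =
          E (real n * \<Delta>t, xs n) - perp (vs (Suc n)) /\<^sub>R \<epsilon>)"

definition guiding_center :: "real \<Rightarrow> real^2 \<Rightarrow> real^2 \<Rightarrow> real^2" where
  "guiding_center \<epsilon> x v = x - \<epsilon> *\<^sub>R perp v"

end

theory Submission
  imports Defs
begin

text \<open>
Multiplying the second equation of the characteristic system by \<open>\<epsilon>\<close> and rotating it shows that the
guiding centre \<open>y = x - \<epsilon> perp v\<close> solves \<open>y' = - perp (E (t, x))\<close>, without any negative power of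
\<open>\<epsilon>\<close>. The scheme is implicit only in the rotation, and for it the same computation gives exactly
\<open>y_(n+1) = y_n - \<Delta>t perp (E (t_n, x_n))\<close>: on the slow variable it is the explicit Euler method. All
estimates compare these two relations; stiffness enters only through \<open>x - y = \<epsilon> perp v\<close>.

\<^item> Velocity (\<open>perturbed_velocity_bound\<close>). The shifted velocity \<open>w = v + \<epsilon> perp E\<close> is rotated by the
dynamics and forced only by the increments of \<open>E\<close> along the trajectory, so Gronwall gives
\<open>norm v \<le> C (1 + t) exp (K_x t) (norm v0 + \<epsilon>)\<close> uniformly in \<open>\<epsilon>\<close>. Sampled on a grid of step \<open>h\<close>, an
exact trajectory satisfies the relations of the scheme up to \<open>O (h^2)\<close>, so a single discrete lemma
serves both the scheme and, as \<open>h\<close> tends to 0, the exact flow.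

\<^item> Bounds in \<open>\<Delta>t / \<epsilon>^3\<close> (\<open>stiff_error_bound\<close>). The quantity
\<open>norm (error of y) + \<epsilon> norm (error of v)\<close> grows by the factor \<open>1 + 2 K_x \<Delta>t\<close> per step. The local
errors grow like \<open>exp (K_x t)\<close>, hence no faster than this factor, and the total remains
\<open>exp (2 K_x t)\<close>; bounding the velocity and the stability factor separately would give
\<open>exp (3 K_x t)\<close>.

\<^item> Bound in \<open>\<Delta>t + \<epsilon>\<close> (\<open>drift_error_bound\<close>). Euler's method for \<open>y\<close> has no stiff local error if
\<open>x\<close> is replaced by \<open>y\<close> at the price of \<open>\<epsilon> norm v\<close>.

\<^item> Bound in \<open>\<Delta>t + \<epsilon>^2\<close> (\<open>guiding_center_error_bound\<close>). To first order the price just mentioned is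
\<open>\<epsilon> A (t, y) (perp v)\<close>, \<open>A\<close> being the differential of \<open>E\<close> in \<open>x\<close>. The equation of \<open>v\<close> reads
\<open>perp v = \<epsilon> E - \<epsilon>^2 v'\<close>, so summation by parts gains a further factor \<open>\<epsilon>\<close>
(\<open>oscillating_sum_bound\<close>), provided that \<open>A\<close> is Lipschitz.

The hypotheses on \<open>E\<close> are about weak derivatives, and they must yield pointwise Lipschitz bounds with the
sharp constant \<open>K_x\<close>, since it appears in the exponential. Smooth functions approximating the indicators of boxes
serve as test functions. Translating one of them along \<open>h\<close> and differentiating shows that averages of
\<open>E\<close> over congruent cubes differ by at most the essential bound of the weak derivative in
direction \<open>h\<close> (\<open>weak_derivative_box_integral_bound\<close>); Lebesgue's differentiation theorem turns this into a
statement about values (\<open>weak_derivative_increment_bound\<close>), off a null set, which continuity removes.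
\<close>

section \<open>Smooth bump functions on boxes\<close>

text \<open>The mean value inequality, by which all local errors of trajectories are bounded.\<close>

lemma vector_derivative_norm_bound:
  fixes f :: "real \<Rightarrow> 'b::real_normed_vector"
  assumes "convex S" "\<And>s. s \<in> S \<Longrightarrow> (f has_vector_derivative f' s) (at s within S)"
    and "\<And>s. s \<in> S \<Longrightarrow> norm (f' s) \<le> B" "s \<in> S" "r \<in> S"
  shows "norm (f s - f r) \<le> B * norm (s - r)"
proof (rule differentiable_bound[OF assms(1)])
  show "(f has_derivative (\<lambda>h. h *\<^sub>R f' u)) (at u within S)" if "u \<in> S" for u
    using assms(2)[OF that] by (simp add: has_vector_derivative_def)
  show "onorm (\<lambda>h. h *\<^sub>R f' u) \<le> B" if "u \<in> S" for u
    using assms(3)[OF that] norm_ge_zero[of "f' u"]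
    by (intro onorm_bound) (auto simp: mult.commute[of B] intro!: mult_left_mono simp del: norm_ge_zero)
qed (use assms in auto)

lemma Ck_SucI:
  assumes "\<And>z. (f has_derivative f' z) (at z)" "\<And>b. b \<in> Basis \<Longrightarrow> Ck k (\<lambda>z. f' z b)"
  shows "Ck (Suc k) f"
proof -
  have eq: "frechet_derivative f (at z) = f' z" for z
    using frechet_derivative_at[OF assms(1)] by simp
  show ?thesis
    using assms by (auto simp: eq differentiable_def)
qed

lemma Ck_has_derivative:
  "Ck (Suc k) f \<Longrightarrow> (f has_derivative frechet_derivative f (at z)) (at z)"
  using frechet_derivative_works by auto

lemma Ck_decrease: "Ck (Suc k) f \<Longrightarrow> Ck k f"
proof (induction k arbitrary: f)
  case 0
  then show ?case
    by (auto intro!: differentiable_imp_continuous_on simp: differentiable_on_def differentiable_at_withinI)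
next
  case (Suc k)
  have "\<forall>z. f differentiable at z" "\<forall>b\<in>Basis. Ck (Suc k) (\<lambda>z. frechet_derivative f (at z) b)"
    using Suc.prems unfolding Ck.simps(2)[of "Suc k"] by auto
  then show ?case
    using Suc.IH by (simp only: Ck.simps(2)) blast
qed

lemma Ck_const: "Ck k (\<lambda>z. c)"
proof (induction k arbitrary: c)
  case (Suc k)
  show ?case
    by (rule Ck_SucI[where f' = "\<lambda>z h. 0"]) (use Suc in auto)
qed simp

lemma Ck_add: "Ck k f \<Longrightarrow> Ck k g \<Longrightarrow> Ck k (\<lambda>z. f z + g z)"
proof (induction k arbitrary: f g)
  case (Suc k)
  show ?case
    by (rule Ck_SucI[where f' = "\<lambda>z h. frechet_derivative f (at z) h + frechet_derivative g (at z) h"])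
       (use Suc in \<open>auto intro!: has_derivative_add simp: frechet_derivative_works[symmetric]\<close>)
qed (auto intro: continuous_intros)

lemma Ck_mult:
  fixes f g :: "'a::euclidean_space \<Rightarrow> real"
  shows "Ck k f \<Longrightarrow> Ck k g \<Longrightarrow> Ck k (\<lambda>z. f z * g z)"
proof (induction k arbitrary: f g)
  case (Suc k)
  show ?case
  proof (rule Ck_SucI[where f' = "\<lambda>z h. f z * frechet_derivative g (at z) h + frechet_derivative f (at z) h * g z"])
    show "((\<lambda>z. f z * g z) has_derivative (\<lambda>h. f z * frechet_derivative g (at z) h + frechet_derivative f (at z) h * g z)) (at z)" for z
      using Suc.prems by (intro has_derivative_mult Ck_has_derivative)
    show "Ck k (\<lambda>z. f z * frechet_derivative g (at z) b + frechet_derivative f (at z) b * g z)" if "b \<in> Basis" for b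
      using Suc.prems that by (intro Ck_add Suc.IH Ck_decrease[OF Suc.prems(1)] Ck_decrease[OF Suc.prems(2)]) auto
  qed
qed (auto intro: continuous_intros)

lemma Ck_prod:
  fixes f :: "'i \<Rightarrow> 'a::euclidean_space \<Rightarrow> real"
  assumes "\<And>i. i \<in> I \<Longrightarrow> Ck k (f i)"
  shows "Ck k (\<lambda>z. \<Prod>i\<in>I. f i z)"
  using assms by (induction I rule: infinite_finite_induct) (auto intro: Ck_const Ck_mult)

text \<open>Test functions will be products of functions of one coordinate each.\<close>

lemma Ck_compose_affine:
  fixes f :: "real \<Rightarrow> real" and e :: "'a::euclidean_space"
  shows "Ck k f \<Longrightarrow> Ck k (\<lambda>z. f (z \<bullet> e + c))"
proof (induction k arbitrary: f)
  case 0
  have "continuous_on UNIV (\<lambda>z. f (z \<bullet> e + c))"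
    by (rule continuous_on_compose2[of UNIV f]) (use 0 in \<open>auto intro!: continuous_intros\<close>)
  then show ?case by simp
next
  case (Suc k)
  let ?f' = "\<lambda>x. frechet_derivative f (at x) 1"
  have lin: "frechet_derivative f (at x) h = h * ?f' x" for x h
    using linear_scale[OF linear_frechet_derivative[of f "at x"], of h 1] Suc.prems by simp
  show ?case
  proof (rule Ck_SucI[where f' = "\<lambda>z h. ?f' (z \<bullet> e + c) * (h \<bullet> e)"])
    show "((\<lambda>z. f (z \<bullet> e + c)) has_derivative (\<lambda>h. ?f' (z \<bullet> e + c) * (h \<bullet> e))) (at z)" for z
    proof -
      have "((\<lambda>z. f (z \<bullet> e + c)) has_derivative (\<lambda>h. frechet_derivative f (at (z \<bullet> e + c)) (h \<bullet> e))) (at z)"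
        by (rule has_derivative_compose[where f = "\<lambda>z. z \<bullet> e + c" and s = UNIV])
           (auto intro!: derivative_eq_intros Ck_has_derivative[OF Suc.prems])
      then show ?thesis by (subst (asm) lin) (simp add: mult.commute)
    qed
    show "Ck k (\<lambda>z. ?f' (z \<bullet> e + c) * (b \<bullet> e))" if "b \<in> Basis" for b
      using Suc.prems by (intro Ck_mult Ck_const Suc.IH) auto
  qed
qed

text \<open>The function \<open>exp (- 1 / x)\<close>, flat at 0, is the case \<open>n = 0\<close>. The factor \<open>(1 / x) ^ n\<close> makes the family
closed under differentiation up to linear combinations, which is what the induction for smoothness
needs.\<close>

definition flat :: "nat \<Rightarrow> real \<Rightarrow> real" where
  "flat n x = (if x > 0 then (1 / x) ^ n * exp (- 1 / x) else 0)"

lemma flat_tendsto_0: "(flat n \<longlongrightarrow> 0) (at 0)"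
proof -
  have "((\<lambda>x::real. x ^ n / exp x) \<longlongrightarrow> 0) at_top"
    by (rule tendsto_power_div_exp_0)
  then have "((\<lambda>x. inverse x ^ n / exp (inverse x)) \<longlongrightarrow> 0) (at_right (0::real))"
    by (rule filterlim_compose[OF _ filterlim_inverse_at_top_right])
  then have R: "(flat n \<longlongrightarrow> 0) (at_right 0)"
    by (rule Lim_transform_eventually)
       (auto simp: flat_def eventually_at_right_less exp_minus field_simps intro!: eventually_mono[OF eventually_at_right_less])
  have L: "(flat n \<longlongrightarrow> 0) (at_left 0)"
    by (rule Lim_transform_eventually[of "\<lambda>x. 0"])
       (auto simp: flat_def eventually_at_filter)
  from L R show ?thesis by (simp add: filterlim_at_split)
qed

lemma flat_has_derivative:
  "(flat n has_real_derivative flat (n + 2) x - real n * flat (n + 1) x) (at x)"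
proof (cases x "0::real" rule: linorder_cases)
  case less
  have "(flat n has_real_derivative 0) (at x)"
    by (rule has_field_derivative_transform_within_open[of "\<lambda>x. 0" _ _ "{..<0}"])
       (use less in \<open>auto simp: flat_def\<close>)
  then show ?thesis using less by (simp add: flat_def)
next
  case equal
  have "((\<lambda>h. flat n h / h) \<longlongrightarrow> 0) (at 0)"
    by (rule Lim_transform_eventually[OF flat_tendsto_0[of "Suc n"]])
       (auto simp: flat_def eventually_at field_simps intro!: exI[of _ 1])
  then have "(flat n has_real_derivative 0) (at 0)"
    by (simp add: DERIV_def flat_def[of n 0])
  then show ?thesis using equal by (simp add: flat_def)
next
  case greater
  define y where "y = 1 / x"
  have d: "((\<lambda>x. 1 / x) has_real_derivative - (y^2)) (at x)"
    using greater unfolding y_def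
    by (auto intro!: derivative_eq_intros simp: power2_eq_square)
  have "((\<lambda>x. (1 / x) ^ n * exp (- (1 / x))) has_real_derivative
      real n * (- (y^2) * y ^ (n - Suc 0)) * exp (- y) + exp (- y) * - (- (y^2)) * y ^ n) (at x)"
    using DERIV_mult[OF DERIV_power[OF d, of n] DERIV_fun_exp[OF DERIV_minus[OF d]]] by (simp add: y_def)
  moreover have "real n * (- (y^2) * y ^ (n - Suc 0)) * exp (- y) + exp (- y) * - (- (y^2)) * y ^ n
      = flat (n + 2) x - real n * flat (n + 1) x"
    using greater by (cases n) (simp_all add: flat_def y_def[symmetric] power2_eq_square algebra_simps)
  ultimately have "((\<lambda>x. (1 / x) ^ n * exp (- 1 / x)) has_real_derivative flat (n + 2) x - real n * flat (n + 1) x) (at x)"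
    by simp
  then show ?thesis
    by (rule has_field_derivative_transform_within_open[of _ _ _ "{0<..}"])
       (use greater in \<open>auto simp: flat_def\<close>)
qed

lemma Ck_flat: "Ck k (flat n)"
proof (induction k arbitrary: n)
  case 0
  then show ?case
    by (auto intro!: DERIV_continuous_on[OF has_field_derivative_at_within] flat_has_derivative)
next
  case (Suc k)
  show ?case
  proof (rule Ck_SucI)
    show "(flat n has_derivative (\<lambda>h. (flat (n + 2) z - real n * flat (n + 1) z) * h)) (at z)" for z
      using flat_has_derivative[of n z] by (simp add: has_field_derivative_def)
    show "Ck k (\<lambda>z. (flat (n + 2) z - real n * flat (n + 1) z) * b)" if "b \<in> Basis" for b
      using Ck_add[OF Suc Ck_mult[OF Ck_const Suc], of "n+2" "- real n" "n+1"] that by simp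
  qed
qed

text \<open>Each factor \<open>flat 0 (Suc m * s)\<close> with \<open>s > 0\<close> tends to 1 as \<open>m\<close> grows, so the bumps increase to the
indicator of the open box.\<close>

definition bump :: "nat \<Rightarrow> 'a::euclidean_space \<Rightarrow> 'a \<Rightarrow> 'a \<Rightarrow> real" where
  "bump m a b z = (\<Prod>i\<in>Basis. flat 0 (Suc m * ((z - a) \<bullet> i)) * flat 0 (Suc m * ((b - z) \<bullet> i)))"

lemma flat_0_bounds: "0 \<le> flat 0 x" "flat 0 x \<le> 1" "flat 0 x \<noteq> 0 \<longleftrightarrow> x > 0"
  by (auto simp: flat_def)

lemma bump_nonneg: "0 \<le> bump m a b z"
  by (auto simp: bump_def intro!: prod_nonneg mult_nonneg_nonneg flat_0_bounds)

lemma bump_le_1: "bump m a b z \<le> 1"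
  by (auto simp: bump_def intro!: prod_le_1 mult_le_one mult_nonneg_nonneg flat_0_bounds)

lemma bump_nonzero_iff: "bump m a b z \<noteq> 0 \<longleftrightarrow> z \<in> box a b"
  by (auto simp: bump_def box_def flat_0_bounds zero_less_mult_iff inner_diff_left)

text \<open>Moving a test function along a vector stays within the family of bumps.\<close>

lemma bump_translate: "bump m (a + h) (b + h) z = bump m a b (z - h)"
  by (simp add: bump_def algebra_simps)

lemma Ck_bump: "Ck k (bump m a b)"
proof -
  have 1: "Ck k (\<lambda>z. flat 0 (Suc m * ((z - a) \<bullet> i)))" for i :: 'a
    using Ck_compose_affine[OF Ck_flat, of k 0 "Suc m *\<^sub>R i" "- real (Suc m) * (a \<bullet> i)"]
    by (simp add: inner_diff_left algebra_simps)
  have 2: "Ck k (\<lambda>z. flat 0 (Suc m * ((b - z) \<bullet> i)))" for i :: 'a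
    using Ck_compose_affine[OF Ck_flat, of k 0 "- (Suc m *\<^sub>R i)" "real (Suc m) * (b \<bullet> i)"]
    by (simp add: inner_diff_left algebra_simps)
  show ?thesis
    unfolding bump_def by (intro Ck_prod Ck_mult 1 2)
qed

lemma closure_bump_support: "closure {z. bump m a b z \<noteq> 0} \<subseteq> cbox a b"
  by (rule closure_minimal) (use box_subset_cbox[of a b] in \<open>auto simp: bump_nonzero_iff\<close>)

lemma test_function_bump:
  assumes "cbox a b \<subseteq> \<Omega>"
  shows "test_function \<Omega> (bump m a b)"
proof -
  have "compact (closure {z. bump m a b z \<noteq> 0})"
    unfolding compact_eq_bounded_closed
    by (intro conjI closed_closure bounded_subset[OF bounded_cbox closure_bump_support])
  then show ?thesis
    using closure_bump_support[of m a b] assms Ck_bump by (auto simp: test_function_def)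
qed

lemma bump_tendsto_indicator: "(\<lambda>m. bump m a b z) \<longlonglongrightarrow> indicator (box a b) z"
proof (cases "z \<in> box a b")
  case True
  have "(\<lambda>m. flat 0 (Suc m * x)) \<longlonglongrightarrow> 1" if "x > 0" for x :: real
  proof -
    have "(\<lambda>m. exp (- (1 / x) * (1 / Suc m))) \<longlonglongrightarrow> exp (- (1 / x) * 0)"
      using LIMSEQ_Suc[OF lim_1_over_n] by (intro tendsto_intros) simp
    then show ?thesis using that by (simp add: flat_def mult.commute zero_less_mult_iff)
  qed
  then have "(\<lambda>m. bump m a b z) \<longlonglongrightarrow> (\<Prod>i\<in>(Basis::'a set). 1 * 1)"
    unfolding bump_def using True by (intro tendsto_prod tendsto_mult) (auto simp: box_def inner_diff_left)
  then show ?thesis using True by simp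
next
  case False
  then have "bump m a b z = 0" for m
    using bump_nonzero_iff by blast
  then show ?thesis using False by simp
qed

section \<open>Weak derivatives control increments\<close>

lemma integral_lebesgue_on_supported:
  fixes f :: "'a::euclidean_space \<Rightarrow> 'b::euclidean_space"
  assumes "S \<subseteq> \<Omega>" "S \<in> sets lebesgue" "\<Omega> \<in> sets lebesgue" "\<And>z. z \<in> \<Omega> - S \<Longrightarrow> f z = 0"
  shows "(\<integral>z. f z \<partial>lebesgue_on \<Omega>) = (\<integral>z. f z \<partial>lebesgue_on S)"
  using assms by (subst (1 2) integral_restrict_space)
    (auto intro!: Bochner_Integration.integral_cong split: split_indicator)

lemma locally_integrable_integrable_on:
  assumes "locally_integrable \<Omega> F" "compact K" "K \<subseteq> \<Omega>"
  shows "integrable (lebesgue_on K) F"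
proof -
  have "K \<in> sets lebesgue"
    using assms by (simp add: lmeasurable_compact fmeasurableD)
  then show ?thesis
    using assms by (simp add: integrable_restrict_space locally_integrable_def set_integrable_def)
qed

lemma frechet_derivative_bump_outside:
  assumes "z \<notin> cbox a b"
  shows "frechet_derivative (bump m a b) (at z) = (\<lambda>h. 0)"
proof -
  have "(bump m a b has_derivative (\<lambda>h. 0)) (at z)"
  proof (rule has_derivative_transform_within_open[of "\<lambda>z. 0"])
    show "0 = bump m a b x" if "x \<in> - cbox a b" for x
      using that bump_nonzero_iff[of m a b x] box_subset_cbox[of a b] by auto
  qed (use assms in auto)
  then show ?thesis by (rule frechet_derivative_at[symmetric])
qed

lemma has_derivative_bump:
  "(bump m a b has_derivative frechet_derivative (bump m a b) (at z)) (at z)"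
  by (rule Ck_has_derivative[OF Ck_bump])

lemma frechet_derivative_bump_eq:
  "frechet_derivative (bump m a b) (at z) h = (\<Sum>i\<in>Basis. (h \<bullet> i) * frechet_derivative (bump m a b) (at z) i)"
proof -
  have l: "linear (frechet_derivative (bump m a b) (at z))"
    using has_derivative_bump has_derivative_linear by blast
  have "frechet_derivative (bump m a b) (at z) h
      = frechet_derivative (bump m a b) (at z) (\<Sum>i\<in>Basis. (h \<bullet> i) *\<^sub>R i)"
    by (simp add: euclidean_representation)
  also have "\<dots> = (\<Sum>i\<in>Basis. (h \<bullet> i) * frechet_derivative (bump m a b) (at z) i)"
    by (simp add: linear_sum[OF l] linear_scale[OF l])
  finally show ?thesis .
qed

lemma continuous_frechet_derivative_bump:
  "continuous_on UNIV (\<lambda>z. frechet_derivative (bump m a b) (at z) h)"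
proof -
  have "continuous_on UNIV (\<lambda>z. frechet_derivative (bump m a b) (at z) i)" if "i \<in> Basis" for i
    using Ck_bump[of "Suc 0" m a b] that by simp
  then show ?thesis
    by (subst frechet_derivative_bump_eq) (intro continuous_intros, auto)
qed

lemma bounded_frechet_derivative_bump:
  "\<exists>C\<ge>0. \<forall>z. \<bar>frechet_derivative (bump m a b) (at z) h\<bar> \<le> C"
proof -
  have "compact ((\<lambda>z. frechet_derivative (bump m a b) (at z) h) ` cbox a b)"
    by (rule compact_continuous_image)
      (auto intro: continuous_on_subset[OF continuous_frechet_derivative_bump])
  then obtain C where C: "\<forall>z\<in>cbox a b. \<bar>frechet_derivative (bump m a b) (at z) h\<bar> \<le> C"
    by (auto dest!: compact_imp_bounded simp: bounded_iff)
  then have "\<bar>frechet_derivative (bump m a b) (at z) h\<bar> \<le> max 0 C" for z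
    by (cases "z \<in> cbox a b") (auto simp: frechet_derivative_bump_outside)
  then show ?thesis by (intro exI[of _ "max 0 C"]) auto
qed

lemma frechet_derivative_bump_translate:
  "frechet_derivative (bump m (a + k) (b + k)) (at z) = frechet_derivative (bump m a b) (at (z - k))"
proof (rule frechet_derivative_at[symmetric])
  have "((\<lambda>z. bump m a b (z - k)) has_derivative frechet_derivative (bump m a b) (at (z - k))) (at z)"
    by (rule has_derivative_compose[of "\<lambda>z. z - k" "\<lambda>h. h" z UNIV "bump m a b"])
       (auto intro!: derivative_eq_intros has_derivative_bump)
  then show "(bump m (a + k) (b + k) has_derivative frechet_derivative (bump m a b) (at (z - k))) (at z)"
    by (simp add: bump_translate[abs_def])
qed

lemma integrable_scaleR_bounded:
  fixes F :: "'a::euclidean_space \<Rightarrow> 'b::euclidean_space"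
  assumes "integrable (lebesgue_on S) F" "continuous_on UNIV \<psi>" "\<And>z. \<bar>\<psi> z\<bar> \<le> C" "S \<in> sets lebesgue"
  shows "integrable (lebesgue_on S) (\<lambda>z. \<psi> z *\<^sub>R F z)"
proof (rule Bochner_Integration.integrable_bound)
  show "integrable (lebesgue_on S) (\<lambda>z. C * norm (F z))"
    using assms by auto
  have "\<psi> \<in> borel_measurable (lebesgue_on S)"
    using assms continuous_imp_measurable_on_sets_lebesgue continuous_on_subset by blast
  then show "(\<lambda>z. \<psi> z *\<^sub>R F z) \<in> borel_measurable (lebesgue_on S)"
    using assms(1) by measurable
  show "AE z in lebesgue_on S. norm (\<psi> z *\<^sub>R F z) \<le> norm (C * norm (F z))"
    using assms(3) by (auto intro!: AE_I2 mult_right_mono order_trans[OF assms(3)] simp: abs_mult)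
qed

lemma continuous_bump: "continuous_on UNIV (bump m a b)"
  using Ck_bump[of 0] by simp

lemma abs_bump_le_1: "\<bar>bump m a b z\<bar> \<le> 1"
  using bump_nonneg[of m a b z] bump_le_1[of m a b z] by simp

lemma bounded_linear_coordinates:
  fixes D :: "'a::euclidean_space \<Rightarrow> 'b::real_normed_vector"
  assumes "bounded_linear D"
  shows "D h = (\<Sum>b\<in>Basis. (h \<bullet> b) *\<^sub>R D b)"
proof -
  have l: "linear D" using assms by (simp add: bounded_linear.linear)
  have "D h = D (\<Sum>i\<in>Basis. (h \<bullet> i) *\<^sub>R i)" by (simp add: euclidean_representation)
  then show ?thesis by (simp add: linear_sum[OF l] linear_scale[OF l])
qed

lemma has_weak_derivative_locally_integrable:
  fixes F :: "'a::euclidean_space \<Rightarrow> 'b::euclidean_space"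
  assumes "has_weak_derivative \<Omega> F D"
  shows "locally_integrable \<Omega> F"
proof -
  obtain i :: 'a where "i \<in> Basis" using nonempty_Basis by blast
  then show ?thesis
    using assms by (auto simp: has_weak_derivative_def has_weak_partial_def)
qed

lemma has_weak_derivative_coordinates:
  assumes "has_weak_derivative \<Omega> F D"
  shows "D z h = (\<Sum>b\<in>Basis. (h \<bullet> b) *\<^sub>R D z b)"
  by (rule bounded_linear_coordinates) (use assms in \<open>unfold has_weak_derivative_def, blast\<close>)

lemma weak_derivative_integrable_on:
  assumes D: "has_weak_derivative \<Omega> F D" and K: "compact K" "K \<subseteq> \<Omega>"
  shows "integrable (lebesgue_on K) (\<lambda>z. D z h)"
proof -
  note has_weak_derivative_coordinates[OF D, of _ h]
  moreover have "integrable (lebesgue_on K) (\<lambda>z. D z i)" if "i \<in> Basis" for i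
    using D that K by (auto intro!: locally_integrable_integrable_on simp: has_weak_derivative_def has_weak_partial_def)
  ultimately show ?thesis
    by (auto intro!: Bochner_Integration.integrable_sum)
qed

lemma has_weak_partial_bump:
  fixes F :: "'a::euclidean_space \<Rightarrow> 'b::euclidean_space"
  assumes "has_weak_partial \<Omega> F i g" "open \<Omega>" "cbox p q \<subseteq> \<Omega>" "cbox a b \<subseteq> cbox p q"
  shows "(\<integral>z. frechet_derivative (bump m a b) (at z) i *\<^sub>R F z \<partial>lebesgue_on (cbox p q)) =
    - (\<integral>z. bump m a b z *\<^sub>R g z \<partial>lebesgue_on (cbox p q))"
proof -
  have O: "\<Omega> \<in> sets lebesgue" using assms by auto
  have 1: "(\<integral>z. frechet_derivative (bump m a b) (at z) i *\<^sub>R F z \<partial>lebesgue_on \<Omega>)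
      = (\<integral>z. frechet_derivative (bump m a b) (at z) i *\<^sub>R F z \<partial>lebesgue_on (cbox p q))"
    using assms frechet_derivative_bump_outside[of _ a b m]
    by (intro integral_lebesgue_on_supported O) (auto simp: subset_iff fun_eq_iff)
  have 2: "(\<integral>z. bump m a b z *\<^sub>R g z \<partial>lebesgue_on \<Omega>) = (\<integral>z. bump m a b z *\<^sub>R g z \<partial>lebesgue_on (cbox p q))"
    using assms box_subset_cbox[of a b] bump_nonzero_iff[of m a b]
    by (intro integral_lebesgue_on_supported O) (auto simp: subset_iff)
  have "test_function \<Omega> (bump m a b)"
    using assms by (intro test_function_bump) auto
  then show ?thesis
    using assms(1) by (simp add: has_weak_partial_def flip: 1 2)
qed

text \<open>Weak partial derivatives combine linearly to a weak derivative in an arbitrary direction. All integrals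
live on one compact box, where \<open>F\<close> and \<open>D\<close> are integrable.\<close>

lemma has_weak_derivative_bump:
  fixes F :: "'a::euclidean_space \<Rightarrow> 'b::euclidean_space"
  assumes D: "has_weak_derivative \<Omega> F D" and "open \<Omega>" "cbox p q \<subseteq> \<Omega>" "cbox a b \<subseteq> cbox p q"
  shows "(\<integral>z. frechet_derivative (bump m a b) (at z) h *\<^sub>R F z \<partial>lebesgue_on (cbox p q)) =
    - (\<integral>z. bump m a b z *\<^sub>R D z h \<partial>lebesgue_on (cbox p q))"
proof -
  let ?M = "lebesgue_on (cbox p q)"
  let ?d = "\<lambda>i z. frechet_derivative (bump m a b) (at z) i"
  have intF: "integrable ?M F"
    using assms by (auto intro!: locally_integrable_integrable_on has_weak_derivative_locally_integrable)
  note Deq = has_weak_derivative_coordinates[OF D]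
  have i1: "integrable ?M (\<lambda>z. ?d i z *\<^sub>R F z)" for i
  proof -
    obtain C where "\<And>z. \<bar>?d i z\<bar> \<le> C" using bounded_frechet_derivative_bump[of m a b i] by blast
    then show ?thesis by (intro integrable_scaleR_bounded[OF intF continuous_frechet_derivative_bump]) auto
  qed
  have i2: "integrable ?M (\<lambda>z. bump m a b z *\<^sub>R D z i)" for i
    using assms by (intro integrable_scaleR_bounded[OF weak_derivative_integrable_on[OF D] continuous_bump abs_bump_le_1]) auto
  have "(\<integral>z. ?d h z *\<^sub>R F z \<partial>?M) = (\<integral>z. (\<Sum>i\<in>Basis. (h \<bullet> i) *\<^sub>R (?d i z *\<^sub>R F z)) \<partial>?M)"
    by (subst frechet_derivative_bump_eq) (simp add: scaleR_sum_left)
  also have "\<dots> = (\<Sum>i\<in>Basis. (h \<bullet> i) *\<^sub>R (\<integral>z. ?d i z *\<^sub>R F z \<partial>?M))"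
    using i1 by (subst Bochner_Integration.integral_sum) (auto simp del: scaleR_scaleR)
  also have "\<dots> = (\<Sum>i\<in>Basis. (h \<bullet> i) *\<^sub>R - (\<integral>z. bump m a b z *\<^sub>R D z i \<partial>?M))"
    using D assms by (intro sum.cong refl arg_cong2[where f = scaleR] has_weak_partial_bump)
      (auto simp: has_weak_derivative_def)
  also have "\<dots> = - (\<integral>z. (\<Sum>i\<in>Basis. (h \<bullet> i) *\<^sub>R (bump m a b z *\<^sub>R D z i)) \<partial>?M)"
    using i2 by (subst Bochner_Integration.integral_sum) (auto simp: sum_negf simp del: scaleR_scaleR)
  also have "\<dots> = - (\<integral>z. bump m a b z *\<^sub>R D z h \<partial>?M)"
    by (subst Deq) (simp add: scaleR_sum_right mult.commute)
  finally show ?thesis .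
qed

lemma integral_bump_tendsto:
  fixes F :: "'a::euclidean_space \<Rightarrow> 'b::euclidean_space"
  assumes "integrable (lebesgue_on S) F" "S \<in> sets lebesgue" "cbox a b \<subseteq> S"
  shows "(\<lambda>m. \<integral>z. bump m a b z *\<^sub>R F z \<partial>lebesgue_on S) \<longlonglongrightarrow> integral (cbox a b) F"
proof -
  have box: "box a b \<inter> S = box a b" using assms box_subset_cbox by blast
  have boxS: "x \<in> S" if "x \<in> box a b" for x
    using that box assms by blast
  have ind: "(\<lambda>z. indicator (box a b) z *\<^sub>R F z) \<in> borel_measurable (lebesgue_on S)"
    using assms by (auto intro!: borel_measurable_scaleR borel_measurable_indicator boxS simp: sets_restrict_space_iff)
  have "(\<lambda>m. \<integral>z. bump m a b z *\<^sub>R F z \<partial>lebesgue_on S) \<longlonglongrightarrow> (\<integral>z. indicator (box a b) z *\<^sub>R F z \<partial>lebesgue_on S)"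
  proof (rule integral_dominated_convergence[where w = "\<lambda>z. norm (F z)"])
    show "(\<lambda>z. bump m a b z *\<^sub>R F z) \<in> borel_measurable (lebesgue_on S)" for m
      using integrable_scaleR_bounded[OF assms(1) continuous_bump abs_bump_le_1 assms(2)] by auto
    show "AE z in lebesgue_on S. (\<lambda>m. bump m a b z *\<^sub>R F z) \<longlonglongrightarrow> indicator (box a b) z *\<^sub>R F z"
      by (auto intro!: AE_I2 tendsto_intros bump_tendsto_indicator)
    show "AE z in lebesgue_on S. norm (bump m a b z *\<^sub>R F z) \<le> norm (F z)" for m
      using abs_bump_le_1 by (auto intro!: AE_I2 mult_left_le_one_le)
  qed (use assms ind in auto)
  also have "(\<integral>z. indicator (box a b) z *\<^sub>R F z \<partial>lebesgue_on S) = (\<integral>z. F z \<partial>lebesgue_on (box a b))"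
    using assms(2) by (subst (1 2) integral_restrict_space)
      (auto intro!: Bochner_Integration.integral_cong dest: boxS split: split_indicator)
  also have "\<dots> = integral (box a b) F"
  proof (rule lebesgue_integral_eq_integral)
    have "set_integrable lebesgue S F"
      using assms by (simp add: integrable_restrict_space set_integrable_def)
    then have "set_integrable lebesgue (box a b) F"
      by (rule set_integrable_subset) (use assms box_subset_cbox[of a b] in auto)
    then show "integrable (lebesgue_on (box a b)) F"
      by (simp add: integrable_restrict_space set_integrable_def)
  qed auto
  also have "\<dots> = integral (cbox a b) F"
    by (rule integral_open_interval)
  finally show ?thesis .
qed

lemma bump_shift_has_derivative:
  "((\<lambda>r. bump m (a + r *\<^sub>R h) (b + r *\<^sub>R h) z) has_real_derivative
     - frechet_derivative (bump m (a + s *\<^sub>R h) (b + s *\<^sub>R h)) (at z) h) (at s)"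
proof -
  have l: "linear (frechet_derivative (bump m a b) (at y))" for y
    using has_derivative_bump has_derivative_linear by blast
  have "((\<lambda>r. bump m a b (z - r *\<^sub>R h)) has_derivative
      (\<lambda>k. frechet_derivative (bump m a b) (at (z - s *\<^sub>R h)) (- (k *\<^sub>R h)))) (at s)"
    by (rule has_derivative_compose[of "\<lambda>r. z - r *\<^sub>R h" _ s UNIV "bump m a b"])
       (auto intro!: derivative_eq_intros has_derivative_bump)
  moreover have "(\<lambda>k. frechet_derivative (bump m a b) (at (z - s *\<^sub>R h)) (- (k *\<^sub>R h)))
      = (*) (- frechet_derivative (bump m a b) (at (z - s *\<^sub>R h)) h)"
    by (auto simp: linear_neg[OF l] linear_scale[OF l])
  ultimately show ?thesis
    by (simp add: bump_translate frechet_derivative_bump_translate has_field_derivative_def)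
qed

text \<open>Differentiation under the integral sign, by dominated convergence of difference quotients: those of the
bump are bounded, so \<open>F\<close> only has to be integrable.\<close>

lemma bump_integral_has_vector_derivative:
  fixes F :: "'a::euclidean_space \<Rightarrow> 'b::euclidean_space"
  assumes F: "integrable (lebesgue_on S) F" "S \<in> sets lebesgue"
  shows "((\<lambda>s. \<integral>z. bump m (a + s *\<^sub>R h) (b + s *\<^sub>R h) z *\<^sub>R F z \<partial>lebesgue_on S) has_vector_derivative
    - (\<integral>z. frechet_derivative (bump m (a + s *\<^sub>R h) (b + s *\<^sub>R h)) (at z) h *\<^sub>R F z \<partial>lebesgue_on S)) (at s)"
proof -
  let ?M = "lebesgue_on S"
  let ?\<psi> = "\<lambda>s. bump m (a + s *\<^sub>R h) (b + s *\<^sub>R h)"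
  let ?d = "\<lambda>s z. frechet_derivative (?\<psi> s) (at z) h"
  obtain C where C: "\<And>z. \<bar>frechet_derivative (bump m a b) (at z) h\<bar> \<le> C"
    using bounded_frechet_derivative_bump[of m a b h] by blast
  have dC: "\<bar>?d r z\<bar> \<le> C" for r z
    using C by (simp add: frechet_derivative_bump_translate)
  have lip: "\<bar>?\<psi> r z - ?\<psi> s z\<bar> \<le> C * \<bar>r - s\<bar>" for r z
  proof -
    have "norm (?\<psi> r z - ?\<psi> s z) \<le> C * norm (r - s)"
      by (rule field_differentiable_bound[of UNIV _ "\<lambda>r. - ?d r z"])
         (use dC in \<open>auto intro: bump_shift_has_derivative\<close>)
    then show ?thesis by simp
  qed
  have i1: "integrable ?M (\<lambda>z. ?\<psi> r z *\<^sub>R F z)" for r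
    by (rule integrable_scaleR_bounded[OF F(1) continuous_bump abs_bump_le_1 F(2)])
  have i2: "integrable ?M (\<lambda>z. ?d r z *\<^sub>R F z)" for r
    by (rule integrable_scaleR_bounded[OF F(1) continuous_frechet_derivative_bump dC F(2)])
  have "((\<lambda>r. norm ((\<integral>z. ?\<psi> r z *\<^sub>R F z \<partial>?M) - (\<integral>z. ?\<psi> s z *\<^sub>R F z \<partial>?M)
       - (r - s) *\<^sub>R - (\<integral>z. ?d s z *\<^sub>R F z \<partial>?M)) / norm (r - s)) \<longlongrightarrow> 0) (at s)"
    unfolding tendsto_at_iff_sequentially
  proof (intro allI impI)
    fix X :: "nat \<Rightarrow> real"
    assume X: "\<forall>i. X i \<in> UNIV - {s}" and lim: "X \<longlonglongrightarrow> s"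
    let ?u = "\<lambda>n z. ((?\<psi> (X n) z - ?\<psi> s z) / (X n - s) + ?d s z) *\<^sub>R F z"
    have ueq: "?u n z = (1 / (X n - s)) *\<^sub>R (?\<psi> (X n) z *\<^sub>R F z - ?\<psi> s z *\<^sub>R F z) + ?d s z *\<^sub>R F z" for n z
      by (simp add: algebra_simps diff_divide_distrib)
    have "(\<lambda>n. \<integral>z. ?u n z \<partial>?M) \<longlonglongrightarrow> (\<integral>z. 0 \<partial>?M)"
    proof (rule integral_dominated_convergence[where w = "\<lambda>z. 2 * C * norm (F z)"])
      show "?u n \<in> borel_measurable ?M" for n
        unfolding ueq using i1 i2 by (intro borel_measurable_integrable) auto
      show "integrable ?M (\<lambda>z. 2 * C * norm (F z))" using F by auto
      have "(\<lambda>n. ?u n z) \<longlonglongrightarrow> (- ?d s z + ?d s z) *\<^sub>R F z" for z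
      proof -
        have "((\<lambda>r. (?\<psi> r z - ?\<psi> s z) / (r - s)) \<longlongrightarrow> - ?d s z) (at s)"
          using bump_shift_has_derivative unfolding has_field_derivative_iff .
        then have "(\<lambda>n. (?\<psi> (X n) z - ?\<psi> s z) / (X n - s)) \<longlonglongrightarrow> - ?d s z"
          using X lim unfolding tendsto_at_iff_sequentially by (auto simp: o_def)
        then show ?thesis by (intro tendsto_intros)
      qed
      then show "AE z in ?M. (\<lambda>n. ?u n z) \<longlonglongrightarrow> 0" by simp
      show "AE z in ?M. norm (?u n z) \<le> 2 * C * norm (F z)" for n
      proof (rule AE_I2)
        fix z
        have "\<bar>(?\<psi> (X n) z - ?\<psi> s z) / (X n - s)\<bar> \<le> C"
          using lip[of "X n" z] X by (simp add: abs_divide divide_le_eq)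
        then have "\<bar>(?\<psi> (X n) z - ?\<psi> s z) / (X n - s) + ?d s z\<bar> \<le> 2 * C"
          using dC[of s z] by linarith
        then show "norm (?u n z) \<le> 2 * C * norm (F z)"
          by (simp add: mult_right_mono)
      qed
    qed simp
    then have lim0: "(\<lambda>n. norm (\<integral>z. ?u n z \<partial>?M)) \<longlonglongrightarrow> 0"
      by (simp add: tendsto_norm_zero)
    have "norm (\<integral>z. ?u n z \<partial>?M) = norm ((\<integral>z. ?\<psi> (X n) z *\<^sub>R F z \<partial>?M) - (\<integral>z. ?\<psi> s z *\<^sub>R F z \<partial>?M)
       - (X n - s) *\<^sub>R - (\<integral>z. ?d s z *\<^sub>R F z \<partial>?M)) / norm (X n - s)" (is "_ = norm (?A - (X n - s) *\<^sub>R - ?B) / _") for n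
    proof -
      have ne: "X n - s \<noteq> 0" using X by auto
      have "(\<integral>z. ?u n z \<partial>?M) = (1 / (X n - s)) *\<^sub>R ?A + ?B"
        unfolding ueq using i1 i2 by simp
      also have "\<dots> = (1 / (X n - s)) *\<^sub>R (?A - (X n - s) *\<^sub>R - ?B)"
        using ne by (simp add: scaleR_right_distrib)
      finally show ?thesis using ne by (simp add: divide_inverse mult.commute)
    qed
    with lim0 show "((\<lambda>r. norm ((\<integral>z. ?\<psi> r z *\<^sub>R F z \<partial>?M) - (\<integral>z. ?\<psi> s z *\<^sub>R F z \<partial>?M)
       - (r - s) *\<^sub>R - (\<integral>z. ?d s z *\<^sub>R F z \<partial>?M)) / norm (r - s)) \<circ> X) \<longlonglongrightarrow> 0"
      by (simp only: o_def)
  qed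
  then show ?thesis
    unfolding has_vector_derivative_def has_derivative_iff_norm
    by (intro conjI bounded_linear_scaleR_left)
qed

lemma integral_bump_translate:
  assumes "cbox (a + k) (b + k) \<subseteq> S" "S \<in> sets lebesgue"
  shows "(\<integral>z. bump m (a + k) (b + k) z \<partial>lebesgue_on S) = (\<integral>z. bump m a b z \<partial>lborel)"
proof -
  have b: "bump m c d \<in> borel_measurable lborel" for c d :: 'a
    using borel_measurable_continuous_onI[OF continuous_bump] by simp
  have "(\<integral>z. bump m (a + k) (b + k) z \<partial>lebesgue_on S) = (\<integral>z. bump m (a + k) (b + k) z \<partial>lebesgue_on UNIV)"
    using assms box_subset_cbox[of "a + k" "b + k"] bump_nonzero_iff[of m "a + k" "b + k"]
    by (intro integral_lebesgue_on_supported[symmetric]) auto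
  also have "\<dots> = (\<integral>z. bump m (a + k) (b + k) z \<partial>lborel)"
    using integral_completion[OF b] by (simp add: lebesgue_on_UNIV_eq)
  also have "\<dots> = (\<integral>z. bump m (a + k) (b + k) z \<partial>distr lborel borel ((+) k))"
    by (simp only: lborel_distr_plus)
  also have "\<dots> = (\<integral>z. bump m (a + k) (b + k) (k + z) \<partial>lborel)"
    using b[of "a + k" "b + k"] by (intro integral_distr) auto
  also have "\<dots> = (\<integral>z. bump m a b z \<partial>lborel)"
    by (simp add: bump_translate)
  finally show ?thesis .
qed

text \<open>Moving the box along \<open>s h\<close>, \<open>0 \<le> s \<le> 1\<close>, differentiates the smoothed integral of \<open>F\<close> to a smoothed integral
of \<open>D z h\<close>; the mean value inequality bounds the total change before the smoothing is removed. The
comparison vector \<open>w\<close> makes the same lemma usable for Lipschitz bounds (\<open>w = 0\<close>) and for first-order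
Taylor estimates (\<open>w\<close> the derivative at one point).\<close>

lemma weak_derivative_box_integral_bound:
  fixes F :: "'a::euclidean_space \<Rightarrow> 'b::euclidean_space"
  assumes D: "has_weak_derivative \<Omega> F D" and \<Omega>: "open \<Omega>" "cbox p q \<subseteq> \<Omega>"
    and ab: "a \<in> cbox p q" "b \<in> cbox p q" "a + h \<in> cbox p q" "b + h \<in> cbox p q"
    and L: "AE z in lebesgue_on (cbox p q). norm (D z h - w) \<le> L"
  shows "norm (integral (cbox (a + h) (b + h)) F - integral (cbox a b) F - measure lborel (cbox a b) *\<^sub>R w)
    \<le> L * measure lborel (cbox a b)"
proof -
  let ?M = "lebesgue_on (cbox p q)"
  let ?\<psi> = "\<lambda>m s. bump m (a + s *\<^sub>R h) (b + s *\<^sub>R h)"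
  have sub: "cbox (a + s *\<^sub>R h) (b + s *\<^sub>R h) \<subseteq> cbox p q" if "s \<in> {0..1}" for s
  proof -
    have "(1 - s) *\<^sub>R x + s *\<^sub>R (x + h) \<in> cbox p q" if "x \<in> cbox p q" "x + h \<in> cbox p q" for x
      using \<open>s \<in> {0..1}\<close> that by (intro convexD[OF convex_box(1)]) auto
    moreover have "(1 - s) *\<^sub>R x + s *\<^sub>R (x + h) = x + s *\<^sub>R h" for x :: 'a
      by (simp add: algebra_simps)
    ultimately have "a + s *\<^sub>R h \<in> cbox p q" "b + s *\<^sub>R h \<in> cbox p q"
      using ab by metis+
    then show ?thesis unfolding subset_box by (auto simp: mem_box)
  qed
  have intF: "integrable ?M F"
    using D \<Omega> by (auto intro!: locally_integrable_integrable_on has_weak_derivative_locally_integrable)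
  have intD: "integrable ?M (\<lambda>z. D z h)"
    using \<Omega> by (intro weak_derivative_integrable_on[OF D]) auto
  have int1: "integrable ?M (\<lambda>z. 1 :: real)"
    using emeasure_lborel_cbox_finite[of p q] by (intro finite_measure.integrable_const)
      (auto intro!: finite_measureI simp: emeasure_restrict_space)
  define c where "c m = (\<integral>z. bump m a b z \<partial>lborel)" for m
  have ceq: "(\<integral>z. ?\<psi> m s z \<partial>?M) = c m" if "s \<in> {0..1}" for m s
    unfolding c_def using sub[OF that] by (intro integral_bump_translate) auto
  define f where "f m s = (\<integral>z. ?\<psi> m s z *\<^sub>R F z \<partial>?M)" for m s
  have fbound: "norm (f m 1 - f m 0 - c m *\<^sub>R w) \<le> L * c m" for m
  proof -
    have der: "(f m has_vector_derivative (\<integral>z. ?\<psi> m s z *\<^sub>R D z h \<partial>?M)) (at s)" if "s \<in> {0..1}" for s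
      using bump_integral_has_vector_derivative[OF intF, of m a h b s]
        has_weak_derivative_bump[OF D \<Omega> sub[OF that], of m h]
      unfolding f_def by simp
    have b: "norm ((\<integral>z. ?\<psi> m s z *\<^sub>R D z h \<partial>?M) - c m *\<^sub>R w) \<le> L * c m" if "s \<in> {0..1}" for s
    proof -
      have i1: "integrable ?M (?\<psi> m s)"
        using integrable_scaleR_bounded[OF int1 continuous_bump abs_bump_le_1] by simp
      have i2: "integrable ?M (\<lambda>z. ?\<psi> m s z *\<^sub>R D z h)"
        using integrable_scaleR_bounded[OF intD continuous_bump abs_bump_le_1] by simp
      have "(\<integral>z. ?\<psi> m s z *\<^sub>R D z h \<partial>?M) - c m *\<^sub>R w = (\<integral>z. ?\<psi> m s z *\<^sub>R (D z h - w) \<partial>?M)"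
        using i1 i2 ceq[OF that, of m] by (simp add: scaleR_diff_right)
      also have "norm \<dots> \<le> (\<integral>z. norm (?\<psi> m s z *\<^sub>R (D z h - w)) \<partial>?M)"
        by (rule integral_norm_bound)
      also have "\<dots> \<le> (\<integral>z. L * ?\<psi> m s z \<partial>?M)"
      proof (rule integral_mono_AE)
        show "integrable ?M (\<lambda>z. norm (?\<psi> m s z *\<^sub>R (D z h - w)))"
          using i1 i2 by (intro integrable_norm) (simp add: scaleR_diff_right)
        show "AE z in ?M. norm (?\<psi> m s z *\<^sub>R (D z h - w)) \<le> L * ?\<psi> m s z"
          using L by eventually_elim (simp add: bump_nonneg mult.commute mult_right_mono)
      qed (use i1 in auto)
      also have "\<dots> = L * c m" using ceq[OF that, of m] by simp
      finally show ?thesis .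
    qed
    have "norm ((f m 1 - 1 *\<^sub>R (c m *\<^sub>R w)) - (f m 0 - 0 *\<^sub>R (c m *\<^sub>R w))) \<le> L * c m * norm (1 - 0 :: real)"
    proof (rule vector_derivative_norm_bound[where S = "{0..1}"])
      show "((\<lambda>s. f m s - s *\<^sub>R (c m *\<^sub>R w)) has_vector_derivative (\<integral>z. ?\<psi> m s z *\<^sub>R D z h \<partial>?M) - c m *\<^sub>R w) (at s within {0..1})"
        if "s \<in> {0..1}" for s
        using has_vector_derivative_at_within[OF der[OF that]]
        by (auto intro!: derivative_eq_intros)
    qed (use b in auto)
    then show ?thesis by (simp add: algebra_simps)
  qed
  have lim: "(\<lambda>m. \<integral>z. ?\<psi> m s z *\<^sub>R G z \<partial>?M) \<longlonglongrightarrow> integral (cbox (a + s *\<^sub>R h) (b + s *\<^sub>R h)) G"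
    if "integrable ?M G" "s \<in> {0..1}" for s and G :: "'a \<Rightarrow> 'c::euclidean_space"
    using sub[OF that(2)] by (intro integral_bump_tendsto that) auto
  have "c \<longlonglongrightarrow> measure lborel (cbox a b)"
    using lim[OF int1, of 0] ceq[of 0] by simp
  moreover have "(\<lambda>m. f m 1) \<longlonglongrightarrow> integral (cbox (a + h) (b + h)) F" "(\<lambda>m. f m 0) \<longlonglongrightarrow> integral (cbox a b) F"
    using lim[OF intF, of 1] lim[OF intF, of 0] by (simp_all add: f_def)
  ultimately have "(\<lambda>m. norm (f m 1 - f m 0 - c m *\<^sub>R w)) \<longlonglongrightarrow>
      norm (integral (cbox (a + h) (b + h)) F - integral (cbox a b) F - measure lborel (cbox a b) *\<^sub>R w)"
    "(\<lambda>m. L * c m) \<longlonglongrightarrow> L * measure lborel (cbox a b)"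
    by (auto intro!: tendsto_intros)
  then show ?thesis
    by (rule LIMSEQ_le) (use fbound in auto)
qed

text \<open>The point \<open>x\<close> is a corner of the cube, not its centre; such cubes also shrink to \<open>x\<close> regularly enough for
Lebesgue's theorem.\<close>

abbreviation cube_avg :: "('a::euclidean_space \<Rightarrow> 'b::euclidean_space) \<Rightarrow> 'a \<Rightarrow> real \<Rightarrow> 'b" where
  "cube_avg F x r \<equiv> integral (cbox x (x + r *\<^sub>R One)) F /\<^sub>R r ^ DIM('a)"

lemma eventually_small_cube_subset:
  fixes x :: "'a::euclidean_space"
  assumes "x \<in> box a b"
  shows "eventually (\<lambda>r. x + r *\<^sub>R One \<in> box a b \<and> cbox x (x + r *\<^sub>R One) \<subseteq> cbox a b) (at_right 0)"
proof -
  have "((\<lambda>r. x + r *\<^sub>R One) \<longlongrightarrow> x + 0 *\<^sub>R One) (at_right (0::real))"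
    by (intro tendsto_intros)
  then have "eventually (\<lambda>r. x + r *\<^sub>R One \<in> box a b) (at_right (0::real))"
    using assms by (intro topological_tendstoD) auto
  then show ?thesis
  proof eventually_elim
    case (elim r)
    have "cbox x (x + r *\<^sub>R One) \<subseteq> cbox a b"
      using elim assms box_subset_cbox[of a b] unfolding subset_box by (auto simp: mem_box less_imp_le)
    with elim show ?case by blast
  qed
qed

text \<open>Lebesgue's differentiation theorem on an open set, from the version for functions integrable on every box:
an open set is a countable union of compact boxes, and the boundaries of the boxes are negligible.\<close>

lemma ae_cube_averages_tendsto:
  fixes F :: "'a::euclidean_space \<Rightarrow> 'b::euclidean_space"
  assumes "open \<Omega>" "locally_integrable \<Omega> F"
  obtains N where "negligible N"
    "\<And>x. x \<in> \<Omega> - N \<Longrightarrow> (cube_avg F x \<longlongrightarrow> F x) (at_right 0)"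
proof -
  obtain \<D> where \<D>: "countable \<D>" "\<D> \<subseteq> Pow \<Omega>" "\<And>X. X \<in> \<D> \<Longrightarrow> \<exists>a b. X = cbox a b" "\<Union>\<D> = \<Omega>"
    using open_countable_Union_open_cbox[OF assms(1)] by metis
  have ex: "\<exists>N. negligible N \<and> (\<forall>x\<in>X - N.
      (cube_avg F x \<longlongrightarrow> F x) (at_right 0))" if "X \<in> \<D>" for X
  proof -
    obtain a b where X: "X = cbox a b" using \<D>(3)[OF \<open>X \<in> \<D>\<close>] by blast
    define f where "f z = (if z \<in> X then F z else 0)" for z
    have "integrable (lebesgue_on X) F"
      using that \<D> X assms by (intro locally_integrable_integrable_on) auto
    then have "F integrable_on X"
      using X by (auto intro: integrable_on_lebesgue_on)
    then have "f integrable_on UNIV"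
      unfolding f_def by (simp add: Henstock_Kurzweil_Integration.integrable_restrict_UNIV)
    then have "f integrable_on cbox c d" for c d
      by (rule integrable_on_subcbox) simp
    then obtain N where N: "negligible N"
      "\<And>x e. x \<notin> N \<Longrightarrow> 0 < e \<Longrightarrow> \<exists>d>0. \<forall>h. 0 < h \<and> h < d \<longrightarrow>
          norm (integral (cbox x (x + h *\<^sub>R One)) f /\<^sub>R h ^ DIM('a) - f x) < e"
      using integrable_ccontinuous_explicit[of f] by metis
    show ?thesis
    proof (intro exI conjI ballI)
      show "negligible (N \<union> (cbox a b - box a b))"
        using N(1) negligible_frontier_interval[of a b] by (rule negligible_Un)
      fix x assume x: "x \<in> X - (N \<union> (cbox a b - box a b))"
      then have xb: "x \<in> box a b" "x \<notin> N" using X by auto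
      have "(cube_avg f x \<longlongrightarrow> f x) (at_right 0)"
      proof (rule tendstoI)
        fix e :: real assume "e > 0"
        from N(2)[OF xb(2) this] obtain d where d: "d > 0" "\<And>r. 0 < r \<Longrightarrow> r < d \<Longrightarrow>
            norm (cube_avg f x r - f x) < e"
          by blast
        then show "eventually (\<lambda>r. dist (cube_avg f x r) (f x) < e) (at_right 0)"
          unfolding eventually_at_right_field dist_norm by (intro exI[of _ d]) blast
      qed
      moreover have "eventually (\<lambda>r. cube_avg f x r
          = cube_avg F x r) (at_right 0)"
        using eventually_small_cube_subset[OF xb(1)]
      proof eventually_elim
        case (elim r)
        have "integral (cbox x (x + r *\<^sub>R One)) f = integral (cbox x (x + r *\<^sub>R One)) F"
          by (rule Henstock_Kurzweil_Integration.integral_cong) (use elim X in \<open>auto simp: f_def\<close>)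
        then show ?case by simp
      qed
      ultimately have "(cube_avg F x \<longlongrightarrow> f x) (at_right 0)"
        by (rule Lim_transform_eventually)
      then show "(cube_avg F x \<longlongrightarrow> F x) (at_right 0)"
        using x by (simp add: f_def)
    qed
  qed
  have "\<exists>N. \<forall>X\<in>\<D>. negligible (N X) \<and> (\<forall>x\<in>X - N X.
      (cube_avg F x \<longlongrightarrow> F x) (at_right 0))"
    by (intro bchoice ballI ex)
  then obtain N where N: "\<forall>X\<in>\<D>. negligible (N X) \<and> (\<forall>x\<in>X - N X.
      (cube_avg F x \<longlongrightarrow> F x) (at_right 0))" ..
  show thesis
  proof (rule that)
    show "negligible (\<Union>(N ` \<D>))"
      using \<D>(1) N by (intro negligible_countable_Union) auto
    show "(cube_avg F x \<longlongrightarrow> F x) (at_right 0)"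
      if x: "x \<in> \<Omega> - \<Union>(N ` \<D>)" for x
    proof -
      obtain X where "X \<in> \<D>" "x \<in> X - N X" using x unfolding \<D>(4)[symmetric] by blast
      with N show ?thesis by blast
    qed
  qed
qed

lemma open_eventually_cube_subset:
  fixes x :: "'a::euclidean_space"
  assumes "open \<Omega>" "x \<in> \<Omega>"
  shows "eventually (\<lambda>r. cbox x (x + r *\<^sub>R One) \<subseteq> \<Omega>) (at_right 0)"
proof -
  obtain a b where ab: "x \<in> box a b" "cbox a b \<subseteq> \<Omega>"
    using open_contains_cbox[OF assms] by metis
  show ?thesis
    using eventually_small_cube_subset[OF ab(1)] by (rule eventually_mono) (use ab(2) in blast)
qed

text \<open>Approximating box indicators by test functions shows that two weak partials have the same integral over each
box, hence the same averages over small cubes.\<close>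

lemma weak_partial_unique:
  fixes F :: "'a::euclidean_space \<Rightarrow> 'b::euclidean_space"
  assumes "open \<Omega>" "has_weak_partial \<Omega> F i g" "has_weak_partial \<Omega> F i g'"
  shows "\<exists>N. negligible N \<and> (\<forall>z\<in>\<Omega> - N. g z = g' z)"
proof -
  have li: "locally_integrable \<Omega> g" "locally_integrable \<Omega> g'"
    using assms by (auto simp: has_weak_partial_def)
  obtain N where N: "negligible N"
    "\<And>x. x \<in> \<Omega> - N \<Longrightarrow> (cube_avg g x \<longlongrightarrow> g x) (at_right 0)"
    using ae_cube_averages_tendsto[OF assms(1) li(1)] by blast
  obtain N' where N': "negligible N'"
    "\<And>x. x \<in> \<Omega> - N' \<Longrightarrow> (cube_avg g' x \<longlongrightarrow> g' x) (at_right 0)"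
    using ae_cube_averages_tendsto[OF assms(1) li(2)] by blast
  have eq: "integral (cbox p q) g = integral (cbox p q) g'" if "cbox p q \<subseteq> \<Omega>" for p q
  proof -
    have "(\<lambda>m. \<integral>z. bump m p q z *\<^sub>R g z \<partial>lebesgue_on (cbox p q)) \<longlonglongrightarrow> integral (cbox p q) g"
      "(\<lambda>m. \<integral>z. bump m p q z *\<^sub>R g' z \<partial>lebesgue_on (cbox p q)) \<longlonglongrightarrow> integral (cbox p q) g'"
      using that li by (auto intro!: integral_bump_tendsto locally_integrable_integrable_on)
    moreover have "(\<integral>z. bump m p q z *\<^sub>R g z \<partial>lebesgue_on (cbox p q))
        = (\<integral>z. bump m p q z *\<^sub>R g' z \<partial>lebesgue_on (cbox p q))" for m
      using has_weak_partial_bump[OF assms(2,1) that subset_refl, of m]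
        has_weak_partial_bump[OF assms(3,1) that subset_refl, of m] by simp
    ultimately show ?thesis by (simp add: LIMSEQ_unique)
  qed
  show ?thesis
  proof (intro exI conjI ballI)
    show "negligible (N \<union> N')" using N N' by simp
    fix x assume x: "x \<in> \<Omega> - (N \<union> N')"
    have "(cube_avg g' x \<longlongrightarrow> g x) (at_right 0)"
    proof (rule Lim_transform_eventually)
      show "(cube_avg g x \<longlongrightarrow> g x) (at_right 0)"
        using N x by blast
      show "eventually (\<lambda>r. cube_avg g x r
          = cube_avg g' x r) (at_right 0)"
        using open_eventually_cube_subset[OF assms(1), of x] x by (auto elim!: eventually_mono simp: eq)
    qed
    then show "g x = g' x"
      using N'(2)[of x] x by (intro tendsto_unique[where F = "at_right (0::real)"]) auto
  qed
qed

text \<open>The exceptional set consists of the points at which averages do not converge. It depends on \<open>F\<close> only, not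
on the increment; this is what makes Lipschitz bounds on a set of full measure follow at once.\<close>

lemma weak_derivative_increment_bound:
  fixes F :: "'a::euclidean_space \<Rightarrow> 'b::euclidean_space"
  assumes "open \<Omega>" and D: "has_weak_derivative \<Omega> F D"
  obtains N where "negligible N"
    "\<forall>c h p q w L. c \<notin> N \<longrightarrow> c + h \<notin> N \<longrightarrow> c \<in> box p q \<longrightarrow> c + h \<in> box p q \<longrightarrow> cbox p q \<subseteq> \<Omega> \<longrightarrow>
      (AE z in lebesgue_on (cbox p q). norm (D z h - w) \<le> L) \<longrightarrow> norm (F (c + h) - F c - w) \<le> L"
proof -
  have "locally_integrable \<Omega> F"
    using D by (rule has_weak_derivative_locally_integrable)
  then obtain N where N: "negligible N"
    "\<And>x. x \<in> \<Omega> - N \<Longrightarrow> (cube_avg F x \<longlongrightarrow> F x) (at_right 0)"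
    using ae_cube_averages_tendsto[OF assms(1)] by blast
  show thesis
  proof (rule that[OF N(1)], intro allI impI)
    fix c h p q w and L :: real
    assume c: "c \<notin> N" "c + h \<notin> N" "c \<in> box p q" "c + h \<in> box p q" and sub: "cbox p q \<subseteq> \<Omega>"
      and L: "AE z in lebesgue_on (cbox p q). norm (D z h - w) \<le> L"
    let ?a = "\<lambda>c r. cube_avg F c r"
    have in\<Omega>: "c \<in> \<Omega>" "c + h \<in> \<Omega>" using c sub box_subset_cbox[of p q] by blast+
    have lim: "((\<lambda>r. norm (?a (c + h) r - ?a c r - w)) \<longlongrightarrow> norm (F (c + h) - F c - w)) (at_right 0)"
      using c in\<Omega> by (intro tendsto_intros N(2)) auto
    have ev: "eventually (\<lambda>r. norm (?a (c + h) r - ?a c r - w) \<le> L) (at_right 0)"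
      using eventually_small_cube_subset[OF c(3)] eventually_small_cube_subset[OF c(4)]
        eventually_at_right_less[of 0]
    proof eventually_elim
      case (elim r)
      have "c + r *\<^sub>R One + h \<in> box p q" using elim(2) by (simp add: ac_simps)
      then have "norm (integral (cbox (c + h) (c + r *\<^sub>R One + h)) F - integral (cbox c (c + r *\<^sub>R One)) F
          - measure lborel (cbox c (c + r *\<^sub>R One)) *\<^sub>R w) \<le> L * measure lborel (cbox c (c + r *\<^sub>R One))"
        using elim c box_subset_cbox[of p q] by (intro weak_derivative_box_integral_bound[OF D assms(1) sub _ _ _ _ L]) auto
      moreover have "measure lborel (cbox c (c + r *\<^sub>R One)) = r ^ DIM('a)"
        using elim(3) by (subst content_cbox) (auto simp: inner_add_left)
      moreover have "c + r *\<^sub>R One + h = c + h + r *\<^sub>R One" by simp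
      ultimately have b: "norm (integral (cbox (c + h) (c + h + r *\<^sub>R One)) F - integral (cbox c (c + r *\<^sub>R One)) F
          - r ^ DIM('a) *\<^sub>R w) \<le> L * r ^ DIM('a)" (is "norm (?I1 - ?I2 - _) \<le> _")
        by (simp only:)
      have "?a (c + h) r - ?a c r - w = inverse (r ^ DIM('a)) *\<^sub>R (?I1 - ?I2 - r ^ DIM('a) *\<^sub>R w)"
        using elim(3) by (simp add: scaleR_diff_right)
      also have "norm \<dots> = norm (?I1 - ?I2 - r ^ DIM('a) *\<^sub>R w) / r ^ DIM('a)"
        using elim(3) by (simp add: divide_inverse mult.commute)
      also have "\<dots> \<le> L" using b elim(3) by (simp add: divide_le_eq)
      finally show ?case .
    qed
    show "norm (F (c + h) - F c - w) \<le> L"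
      using tendsto_upperbound[OF lim ev] by simp
  qed
qed

section \<open>Pointwise regularity of bounded Sobolev fields\<close>

text \<open>Negligible exceptional sets are easier to combine than almost-everywhere quantifiers.\<close>

lemma lebesgue_on_AE_iff:
  assumes "S \<in> sets lebesgue"
  shows "(AE z in lebesgue_on S. P z) \<longleftrightarrow> (\<exists>N. negligible N \<and> (\<forall>z\<in>S - N. P z))"
proof -
  have "(AE z in lebesgue_on S. P z) \<longleftrightarrow> (AE z in lebesgue. z \<in> S \<longrightarrow> P z)"
    using assms by (simp add: AE_restrict_space_iff)
  also have "\<dots> \<longleftrightarrow> (\<exists>N. negligible N \<and> (\<forall>z\<in>S - N. P z))"
  proof
    assume "AE z in lebesgue. z \<in> S \<longrightarrow> P z"
    then obtain N where "N \<in> null_sets lebesgue" "{z \<in> space lebesgue. \<not> (z \<in> S \<longrightarrow> P z)} \<subseteq> N"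
      unfolding eventually_ae_filter by blast
    then show "\<exists>N. negligible N \<and> (\<forall>z\<in>S - N. P z)"
      by (intro exI[of _ N]) (auto simp: negligible_iff_null_sets)
  next
    assume "\<exists>N. negligible N \<and> (\<forall>z\<in>S - N. P z)"
    then obtain N where "N \<in> null_sets lebesgue" "\<forall>z\<in>S - N. P z"
      by (auto simp: negligible_iff_null_sets)
    then show "AE z in lebesgue. z \<in> S \<longrightarrow> P z"
      by (auto intro: AE_I'[of N])
  qed
  finally show ?thesis .
qed

lemma Winf_imp_Linf: "Winf k \<Omega> F \<Longrightarrow> Linf \<Omega> F"
  by (cases k) auto

lemma Winf_Suc_weak_derivative:
  fixes F :: "'a::euclidean_space \<Rightarrow> 'b::euclidean_space"
  assumes "Winf (Suc k) \<Omega> F"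
  obtains g where "\<forall>b\<in>Basis. has_weak_partial \<Omega> F b (g b)" "\<forall>b\<in>Basis. Winf k \<Omega> (g b)"
    "has_weak_derivative \<Omega> F (\<lambda>z h. \<Sum>b\<in>Basis. (h \<bullet> b) *\<^sub>R g b z)"
proof -
  obtain g where g: "\<And>b. b \<in> Basis \<Longrightarrow> has_weak_partial \<Omega> F b (g b) \<and> Winf k \<Omega> (g b)"
    using assms by (auto simp: Bex_def) metis
  have "(\<Sum>c\<in>Basis. (b \<bullet> c) *\<^sub>R g c z) = g b z" if "b \<in> Basis" for b z
    using that by (simp add: inner_Basis if_distrib[of "\<lambda>r. r *\<^sub>R _"] cong: if_cong)
  then have "has_weak_derivative \<Omega> F (\<lambda>z h. \<Sum>b\<in>Basis. (h \<bullet> b) *\<^sub>R g b z)"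
    using g by (auto simp: has_weak_derivative_def intro!: bounded_linear_sum bounded_linear_scaleR_const bounded_linear_inner_left)
  with g that show thesis by blast
qed

lemma Linf_family_bound:
  assumes "\<Omega> \<in> sets lebesgue" "finite B" "\<And>b. b \<in> B \<Longrightarrow> Linf \<Omega> (g b)"
  obtains N M where "negligible N" "M \<ge> 0" "\<forall>z\<in>\<Omega> - N. \<forall>b\<in>B. norm (g b z) \<le> M"
proof -
  have ex: "\<exists>T. negligible (fst T) \<and> (\<forall>z\<in>\<Omega> - fst T. norm (g b z) \<le> snd T)" if "b \<in> B" for b
    using assms(3)[OF that] assms(1) by (auto simp: Linf_def lebesgue_on_AE_iff)
  have "\<exists>T. \<forall>b\<in>B. negligible (fst (T b)) \<and> (\<forall>z\<in>\<Omega> - fst (T b). norm (g b z) \<le> snd (T b))"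
    by (intro bchoice ballI ex)
  then obtain T where T: "\<forall>b\<in>B. negligible (fst (T b)) \<and> (\<forall>z\<in>\<Omega> - fst (T b). norm (g b z) \<le> snd (T b))" ..
  define N M where "N b = fst (T b)" and "M b = snd (T b)" for b
  have NM: "negligible (N b)" "z \<in> \<Omega> - N b \<Longrightarrow> norm (g b z) \<le> M b" if "b \<in> B" for b z
    using bspec[OF T that] by (auto simp: N_def M_def)
  show thesis
  proof (rule that)
    show "negligible (\<Union>(N ` B))"
      using NM(1) assms(2) by (intro negligible_Union) auto
    show "0 \<le> (\<Sum>b\<in>B. \<bar>M b\<bar>)" by (simp add: sum_nonneg)
    show "\<forall>z\<in>\<Omega> - \<Union>(N ` B). \<forall>b\<in>B. norm (g b z) \<le> (\<Sum>b\<in>B. \<bar>M b\<bar>)"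
    proof (intro ballI)
      fix z b assume z: "z \<in> \<Omega> - \<Union>(N ` B)" "b \<in> B"
      have "norm (g b z) \<le> M b" using NM(2)[of b z] z by blast
      also have "\<dots> \<le> \<bar>M b\<bar>" by simp
      also have "\<dots> \<le> (\<Sum>b\<in>B. \<bar>M b\<bar>)" using z assms(2) by (intro member_le_sum) auto
      finally show "norm (g b z) \<le> (\<Sum>b\<in>B. \<bar>M b\<bar>)" .
    qed
  qed
qed

lemma norm_sum_coordinates_le:
  fixes h :: "'a::euclidean_space" and g :: "'a \<Rightarrow> 'b::real_normed_vector"
  assumes "\<And>b. b \<in> Basis \<Longrightarrow> norm (g b) \<le> M"
  shows "norm (\<Sum>b\<in>Basis. (h \<bullet> b) *\<^sub>R g b) \<le> (real DIM('a) * M) * norm h"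
proof -
  have "norm (\<Sum>b\<in>Basis. (h \<bullet> b) *\<^sub>R g b) \<le> (\<Sum>b\<in>(Basis::'a set). norm h * M)"
    using assms by (intro sum_norm_le) (auto intro!: mult_mono Basis_le_norm)
  then show ?thesis by (simp add: ac_simps)
qed

lemma open_phase: "open phase"
  unfolding phase_def by (intro open_Times) auto

lemma phase_lebesgue: "phase \<in> sets lebesgue"
  using open_phase by auto

text \<open>A null set does not obstruct density; in particular bounds extend to the initial time \<open>t = 0\<close>, which
lies outside the open phase space.\<close>

lemma closure_phase_diff_negligible:
  assumes "negligible N"
  shows "closure (phase - N) = {0..} \<times> UNIV"
proof -
  have "phase \<subseteq> closure (phase - N)"
  proof
    fix z assume "z \<in> phase"
    show "z \<in> closure (phase - N)"
    proof (rule mem_closed_if_AE_lebesgue_open[OF open_phase closed_closure _ \<open>z \<in> phase\<close>])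
      have "AE x in lebesgue_on phase. x \<in> closure (phase - N)"
        unfolding lebesgue_on_AE_iff[OF phase_lebesgue]
        using assms closure_subset[of "phase - N"] by (intro exI[of _ N]) auto
      then show "AE x in lebesgue. x \<in> phase \<longrightarrow> x \<in> closure (phase - N)"
        using phase_lebesgue by (simp add: AE_restrict_space_iff)
    qed
  qed
  then have "closure (phase - N) = closure phase"
    by (metis Diff_subset closure_closure closure_mono subset_antisym)
  then show ?thesis
    by (simp add: phase_def closure_Times)
qed

lemma mem_box_phase:
  fixes x y z :: "real^2" and t a b :: real
  shows "(t, x) \<in> box (a, y) (b, z) \<longleftrightarrow> a < t \<and> t < b \<and> (\<forall>i. y $ i < x $ i \<and> x $ i < z $ i)"
    "(t, x) \<in> cbox (a, y) (b, z) \<longleftrightarrow> a \<le> t \<and> t \<le> b \<and> (\<forall>i. y $ i \<le> x $ i \<and> x $ i \<le> z $ i)"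
  by (auto simp: mem_box Basis_prod_def Ball_image_comp ball_Un Basis_vec_def inner_axis)

text \<open>The half space contains, with any two points, a box around both; so local increment bounds are global.\<close>

lemma phase_pair_in_box:
  assumes "c \<in> phase" "d \<in> phase"
  obtains p q where "c \<in> box p q" "d \<in> box p q" "cbox p q \<subseteq> phase"
proof -
  obtain t x where c: "c = (t, x)" by (cases c)
  obtain s y where d: "d = (s, y)" by (cases d)
  have ts: "t > 0" "s > 0" using assms by (auto simp: phase_def c d)
  show thesis
  proof (rule that)
    let ?p = "(min t s / 2, \<chi> i. min (x $ i) (y $ i) - 1)"
    let ?q = "(max t s + 1, \<chi> i. max (x $ i) (y $ i) + 1)"
    show "c \<in> box ?p ?q" "d \<in> box ?p ?q"
      using ts unfolding c d mem_box_phase by auto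
    show "cbox ?p ?q \<subseteq> phase"
    proof
      fix z assume z: "z \<in> cbox ?p ?q"
      obtain r u where zr: "z = (r, u)" by (cases z)
      have "min t s / 2 \<le> r" using z unfolding zr mem_box_phase by simp
      then have "0 < r" using ts by (auto simp: min_def split: if_splits)
      then show "z \<in> phase" by (simp add: phase_def zr)
    qed
  qed
qed

lemma weak_derivative_bound_imp_increment_bound:
  fixes F :: "real \<times> (real^2) \<Rightarrow> 'b::euclidean_space"
  assumes D: "has_weak_derivative phase F D"
  obtains N where "negligible N"
    "\<forall>c h L. c \<in> phase - N \<longrightarrow> c + h \<in> phase - N \<longrightarrow> (AE z in lebesgue_on phase. norm (D z h) \<le> L) \<longrightarrow>
      norm (F (c + h) - F c) \<le> L"
proof -
  obtain N where N: "negligible N"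
    "\<forall>c h p q w L. c \<notin> N \<longrightarrow> c + h \<notin> N \<longrightarrow> c \<in> box p q \<longrightarrow> c + h \<in> box p q \<longrightarrow> cbox p q \<subseteq> phase \<longrightarrow>
      (AE z in lebesgue_on (cbox p q). norm (D z h - w) \<le> L) \<longrightarrow> norm (F (c + h) - F c - w) \<le> L"
    by (rule weak_derivative_increment_bound[OF open_phase D])
  show thesis
  proof (rule that[OF N(1)], intro allI impI)
    fix c h and L :: real
    assume c: "c \<in> phase - N" "c + h \<in> phase - N" and L: "AE z in lebesgue_on phase. norm (D z h) \<le> L"
    obtain p q where pq: "c \<in> box p q" "c + h \<in> box p q" "cbox p q \<subseteq> phase"
      using phase_pair_in_box[of c "c + h"] c by blast
    have "AE z in lebesgue_on (cbox p q). norm (D z h - 0) \<le> L"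
      using L pq(3) unfolding lebesgue_on_AE_iff[OF phase_lebesgue] by (subst lebesgue_on_AE_iff) auto
    then show "norm (F (c + h) - F c) \<le> L"
      using N(2)[rule_format, of c h p q 0 L] c pq by simp
  qed
qed

lemma Winf_1_lipschitz_ae:
  fixes F :: "real \<times> (real^2) \<Rightarrow> 'b::euclidean_space"
  assumes "Winf 1 phase F"
  obtains N M where "negligible N" "M-lipschitz_on (phase - N) F"
proof -
  have "Winf (Suc 0) phase F" using assms by simp
  then obtain g where g: "\<forall>b\<in>Basis. has_weak_partial phase F b (g b)" "\<forall>b\<in>Basis. Winf 0 phase (g b)"
    "has_weak_derivative phase F (\<lambda>z h. \<Sum>b\<in>Basis. (h \<bullet> b) *\<^sub>R g b z)"
    by (rule Winf_Suc_weak_derivative)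
  have linf: "Linf phase (g b)" if "b \<in> Basis" for b
    using g(2) that by simp
  obtain N M where NM: "negligible N" "M \<ge> 0" "\<forall>z\<in>phase - N. \<forall>b\<in>Basis. norm (g b z) \<le> M"
    by (rule Linf_family_bound[OF phase_lebesgue finite_Basis linf])
  obtain N' where N': "negligible N'" "\<forall>c h L. c \<in> phase - N' \<longrightarrow> c + h \<in> phase - N' \<longrightarrow>
      (AE z in lebesgue_on phase. norm (\<Sum>b\<in>Basis. (h \<bullet> b) *\<^sub>R g b z) \<le> L) \<longrightarrow> norm (F (c + h) - F c) \<le> L"
    by (rule weak_derivative_bound_imp_increment_bound[OF g(3)])
  define M' where "M' = real DIM(real \<times> (real^2)) * M"
  show thesis
  proof (rule that[OF N'(1)])
    show "M'-lipschitz_on (phase - N') F"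
    proof (rule lipschitz_onI)
      fix c d assume cd: "c \<in> phase - N'" "d \<in> phase - N'"
      have "AE z in lebesgue_on phase. norm (\<Sum>b\<in>Basis. ((c - d) \<bullet> b) *\<^sub>R g b z) \<le> M' * norm (c - d)"
        unfolding lebesgue_on_AE_iff[OF phase_lebesgue] M'_def
        using NM by (intro exI[of _ N] conjI ballI norm_sum_coordinates_le) auto
      then show "dist (F c) (F d) \<le> M' * dist c d"
        using N'(2)[rule_format, of d "c - d" "M' * norm (c - d)"] cd by (simp add: dist_norm)
    qed (simp add: M'_def NM)
  qed
qed

lemma Winf_field_bounded:
  assumes "Winf_field k E"
  obtains M where "M \<ge> 0" "\<And>t x. t \<ge> 0 \<Longrightarrow> norm (E (t, x)) \<le> M"
proof -
  have cont: "continuous_on ({0..} \<times> UNIV) E" and "Linf phase E"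
    using assms Winf_imp_Linf by (auto simp: Winf_field_def)
  then have linf: "Linf phase E" by simp
  obtain N M where NM: "negligible N" "M \<ge> 0" "\<forall>z\<in>phase - N. \<forall>b\<in>{()}. norm (E z) \<le> M"
    by (rule Linf_family_bound[OF phase_lebesgue, of "{()}" "\<lambda>_. E"]) (use linf in auto)
  show thesis
  proof (rule that[OF NM(2)])
    fix t :: real and x :: "real^2" assume "t \<ge> 0"
    then show "norm (E (t, x)) \<le> M"
      using NM(3) cont
      by (intro continuous_on_closure_norm_le[of "phase - N"])
         (auto simp: closure_phase_diff_negligible[OF NM(1)])
  qed
qed

lemma onorm_le_iff_dense:
  fixes f :: "'a::real_normed_vector \<Rightarrow> 'b::real_normed_vector"
  assumes f: "bounded_linear f" and "a \<ge> 0" and Q: "\<And>U. open U \<Longrightarrow> U \<noteq> {} \<Longrightarrow> \<exists>q\<in>Q. q \<in> U"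
  shows "onorm f \<le> a \<longleftrightarrow> (\<forall>q\<in>Q. norm (f q) \<le> a * norm q)"
proof
  show "\<forall>q\<in>Q. norm (f q) \<le> a * norm q" if "onorm f \<le> a"
    using onorm[OF f] that by (meson mult_right_mono norm_ge_zero order_trans)
next
  assume *: "\<forall>q\<in>Q. norm (f q) \<le> a * norm q"
  have "open {h. a * norm h < norm (f h)}"
    using f by (intro open_Collect_less continuous_intros bounded_linear.continuous_on[OF f])
  then have empty: "{h. a * norm h < norm (f h)} = {}"
    using Q[of "{h. a * norm h < norm (f h)}"] * by fastforce
  show "onorm f \<le> a"
    by (rule onorm_bound) (use empty \<open>a \<ge> 0\<close> in \<open>auto simp: not_less\<close>)
qed

text \<open>The operator norm is determined by countably many directions. Measurability matters because the essential
supremum of a non-measurable function is infinite by convention, and \<open>K_x\<close> would then be 0.\<close>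

lemma borel_measurable_onorm:
  fixes D :: "'z \<Rightarrow> 'a::euclidean_space \<Rightarrow> 'b::euclidean_space"
  assumes lin: "\<And>z. bounded_linear (D z)" and meas: "\<And>h. (\<lambda>z. D z h) \<in> borel_measurable M"
  shows "(\<lambda>z. onorm (D z)) \<in> borel_measurable M"
  unfolding borel_measurable_iff_le
proof
  fix a :: real
  obtain Q :: "'a set" where Q: "countable Q" "\<And>U. open U \<Longrightarrow> U \<noteq> {} \<Longrightarrow> \<exists>q\<in>Q. q \<in> U"
    using countable_dense_setE by blast
  show "{z \<in> space M. onorm (D z) \<le> a} \<in> sets M"
  proof (cases "a \<ge> 0")
    case True
    have "{z \<in> space M. norm (D z q) \<le> a * norm q} \<in> sets M" for q
      using meas[of q] by measurable
    then have "{z \<in> space M. \<forall>q\<in>Q. norm (D z q) \<le> a * norm q} \<in> sets M"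
      by (rule sets.sets_Collect_countable_All'[OF _ Q(1)])
    then show ?thesis
      using onorm_le_iff_dense[OF lin True Q(2)] by simp
  next
    case False
    then have "\<not> onorm (D z) \<le> a" for z
      using onorm_pos_le[OF lin[of z]] by linarith
    then show ?thesis by simp
  qed
qed

lemma borel_measurable_lebesgue_on_cong_AE:
  fixes f g :: "'a::euclidean_space \<Rightarrow> 'b::euclidean_space"
  assumes S: "S \<in> sets lebesgue" and f: "f \<in> borel_measurable (lebesgue_on S)"
    and N: "negligible N" "\<And>z. z \<in> S - N \<Longrightarrow> f z = g z"
  shows "g \<in> borel_measurable (lebesgue_on S)"
proof -
  have "(\<lambda>z. indicator S z *\<^sub>R f z) \<in> borel_measurable lebesgue"
    using f S by (simp add: borel_measurable_restrict_space_iff)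
  moreover have "AE z in lebesgue. indicator S z *\<^sub>R f z = indicator S z *\<^sub>R g z"
    using N by (auto intro!: AE_I'[of N] simp: negligible_iff_null_sets split: split_indicator)
  ultimately have "(\<lambda>z. indicator S z *\<^sub>R g z) \<in> borel_measurable lebesgue"
    by (rule borel_measurable_AE)
  then show ?thesis
    using S by (simp add: borel_measurable_restrict_space_iff)
qed

text \<open>The weak derivative in \<open>K_x\<close> is an arbitrary choice. By uniqueness it agrees almost everywhere with the
bounded partials supplied by \<open>Winf\<close>, so the essential supremum is a real number and bounds it almost
everywhere.\<close>

lemma norm_weak_derivative_le_K_x:
  assumes "Winf (Suc k) phase E"
  shows "K_x E \<ge> 0" "AE z in lebesgue_on phase. norm (weak_derivative phase E z (0, h)) \<le> K_x E * norm h"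
    and "has_weak_derivative phase E (weak_derivative phase E)"
proof -
  let ?M = "lebesgue_on phase"
  define D where "D = weak_derivative phase E"
  obtain g where g0: "\<forall>b\<in>Basis. has_weak_partial phase E b (g b)" "\<forall>b\<in>Basis. Winf k phase (g b)"
    "has_weak_derivative phase E (\<lambda>z h. \<Sum>b\<in>Basis. (h \<bullet> b) *\<^sub>R g b z)"
    using assms by (rule Winf_Suc_weak_derivative)
  note g = bspec[OF g0(1)] bspec[OF g0(2)] g0(3)
  have D: "has_weak_derivative phase E D"
    unfolding D_def weak_derivative_def by (rule someI[where P = "has_weak_derivative phase E", OF g(3)])
  then have lin: "bounded_linear (D z)" for z unfolding has_weak_derivative_def by blast
  have ex: "\<exists>N. negligible N \<and> (\<forall>z\<in>phase - N. g b z = D z b)" if "b \<in> Basis" for b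
  proof -
    have "has_weak_partial phase E b (\<lambda>z. D z b)"
      using D that by (simp add: has_weak_derivative_def)
    with g(1)[OF that] show ?thesis by (rule weak_partial_unique[OF open_phase])
  qed
  have "\<exists>N. \<forall>b\<in>Basis. negligible (N b) \<and> (\<forall>z\<in>phase - N b. g b z = D z b)"
    by (intro bchoice ballI ex)
  then obtain N where N0: "\<forall>b\<in>Basis. negligible (N b) \<and> (\<forall>z\<in>phase - N b. g b z = D z b)" ..
  have N: "negligible (N b)" "z \<in> phase - N b \<Longrightarrow> g b z = D z b" if "b \<in> Basis" for b z
    using N0 that by blast+
  have linf: "Linf phase (g b)" if "b \<in> Basis" for b
    using g(2)[OF that] by (rule Winf_imp_Linf)
  have measb: "(\<lambda>z. D z b) \<in> borel_measurable ?M" if "b \<in> Basis" for b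
    by (rule borel_measurable_lebesgue_on_cong_AE[OF phase_lebesgue, of "g b" "N b"])
       (use linf[OF that] N[OF that] in \<open>auto simp: Linf_def\<close>)
  have meas: "(\<lambda>z. D z h) \<in> borel_measurable ?M" for h
    by (subst bounded_linear_coordinates[OF lin]) (intro borel_measurable_sum borel_measurable_scaleR borel_measurable_const measb)
  have linx: "bounded_linear (\<lambda>h. D z (0, h))" for z
    by (intro bounded_linear_compose[OF lin] bounded_linear_Pair bounded_linear_zero bounded_linear_ident)
  have measn: "(\<lambda>z. ereal (onorm (\<lambda>h. D z (0, h)))) \<in> borel_measurable ?M"
    using borel_measurable_onorm[OF linx meas] by (rule borel_measurable_ereal)
  obtain N' M where N': "negligible N'" "M \<ge> 0" "\<forall>z\<in>phase - N'. \<forall>b\<in>Basis. norm (g b z) \<le> M"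
    by (rule Linf_family_bound[OF phase_lebesgue finite_Basis linf])
  define C where "C = real DIM(real \<times> (real^2)) * M"
  have bound: "onorm (\<lambda>h. D z (0, h)) \<le> C" if "z \<in> phase - (N' \<union> \<Union>(N ` Basis))" for z
  proof (rule onorm_le)
    fix h :: "real^2"
    have "norm (D z b) \<le> M" if "b \<in> Basis" for b
      using N'(3)[rule_format, of z b] N(2)[of b z] that \<open>z \<in> phase - (N' \<union> \<Union>(N ` Basis))\<close> by auto
    then have "norm (D z (0, h)) \<le> C * norm (0 :: real, h)"
      unfolding C_def by (subst bounded_linear_coordinates[OF lin]) (rule norm_sum_coordinates_le)
    then show "norm (D z (0, h)) \<le> C * norm h" by simp
  qed
  have "negligible (N' \<union> \<Union>(N ` Basis))"
    using N'(1) N(1) by (intro negligible_Un negligible_Union) auto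
  then have le: "AE z in ?M. ereal (onorm (\<lambda>h. D z (0, h))) \<le> ereal C"
    using bound unfolding lebesgue_on_AE_iff[OF phase_lebesgue] ereal_less_eq by blast
  let ?s = "esssup ?M (\<lambda>z. ereal (onorm (\<lambda>h. D z (0, h))))"
  have upper: "?s \<le> ereal C" using measn le by (rule esssup_I)
  have AE: "AE z in ?M. ereal (onorm (\<lambda>h. D z (0, h))) \<le> ?s" by (rule esssup_AE)
  have "0 \<le> ?s"
  proof -
    obtain N'' where N'': "negligible N''" "\<forall>z\<in>phase - N''. ereal (onorm (\<lambda>h. D z (0, h))) \<le> ?s"
      using AE unfolding lebesgue_on_AE_iff[OF phase_lebesgue] by blast
    have "closure (phase - N'') \<noteq> {}"
      using closure_phase_diff_negligible[OF N''(1)] by auto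
    then obtain z where "z \<in> phase - N''" by fastforce
    from bspec[OF N''(2) this] show ?thesis
      using onorm_pos_le[OF linx[of z]] by (meson ereal_less_eq(5) order_trans)
  qed
  with upper obtain K where K: "?s = ereal K" "K \<ge> 0" by (cases ?s) auto
  have KK: "K_x E = K" unfolding K_x_def D_def[symmetric] K by simp
  show "K_x E \<ge> 0" using KK K by simp
  show "has_weak_derivative phase E (weak_derivative phase E)" using D by (simp add: D_def)
  show "AE z in ?M. norm (weak_derivative phase E z (0, h)) \<le> K_x E * norm h"
    using AE unfolding D_def[symmetric] KK K
  proof eventually_elim
    case (elim z)
    have "norm (D z (0, h)) \<le> onorm (\<lambda>h. D z (0, h)) * norm h" by (rule onorm[OF linx])
    also have "\<dots> \<le> K * norm h" using elim by (intro mult_right_mono) auto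
    finally show ?case .
  qed
qed

lemma continuous_extension_bound:
  fixes G :: "real \<times> (real^2) \<Rightarrow> 'b::real_normed_vector"
  assumes "continuous_on ({0..} \<times> UNIV) G" "negligible N" "\<And>z. z \<in> phase - N \<Longrightarrow> norm (G z) \<le> L"
    and "z \<in> {0..} \<times> UNIV"
  shows "norm (G z) \<le> L"
  using assms
  by (intro continuous_on_closure_norm_le[of "phase - N"]) (auto simp: closure_phase_diff_negligible)

lemma negligible_union_shift:
  assumes "negligible N"
  shows "negligible (N \<union> (\<lambda>z. - h + z) ` N)"
  using assms by (intro negligible_Un negligible_translation)

lemma phase_shift:
  assumes "c \<in> phase - (N \<union> (\<lambda>z. - (0, h) + z) ` N)"
  shows "c \<in> phase - N" "c + (0, h) \<in> phase - N"
proof -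
  show "c \<in> phase - N" using assms by blast
  have "c + (0, h) \<notin> N"
  proof
    assume "c + (0, h) \<in> N"
    then have "c \<in> (\<lambda>z. - (0, h) + z) ` N"
      by (intro image_eqI[where x = "c + (0, h)"]) (simp_all add: zero_prod_def)
    then show False using assms by blast
  qed
  then show "c + (0, h) \<in> phase - N" using assms by (cases c) (auto simp: phase_def)
qed

lemma Winf_field_lipschitz_x:
  assumes "Winf_field (Suc k) E" "t \<ge> 0"
  shows "norm (E (t, x) - E (t, y)) \<le> K_x E * norm (x - y)"
proof -
  have cont: "continuous_on ({0..} \<times> UNIV) E" and W: "Winf (Suc k) phase E"
    using assms by (auto simp: Winf_field_def)
  note K = norm_weak_derivative_le_K_x[OF W]
  obtain N where N: "negligible N"
    "\<forall>c h L. c \<in> phase - N \<longrightarrow> c + h \<in> phase - N \<longrightarrow>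
      (AE z in lebesgue_on phase. norm (weak_derivative phase E z h) \<le> L) \<longrightarrow> norm (E (c + h) - E c) \<le> L"
    by (rule weak_derivative_bound_imp_increment_bound[OF K(3)])
  define h where "h = x - y"
  have "norm (E ((t, y) + (0, h)) - E (t, y)) \<le> K_x E * norm h"
  proof (rule continuous_extension_bound[where G = "\<lambda>c. E (c + (0, h)) - E c", OF _ negligible_union_shift[OF N(1), of "(0, h)"]])
    show "continuous_on ({0..} \<times> UNIV) (\<lambda>c. E (c + (0, h)) - E c)"
      by (intro continuous_intros continuous_on_compose2[OF cont] cont) auto
    fix c assume c: "c \<in> phase - (N \<union> (\<lambda>z. - (0, h) + z) ` N)"
    show "norm (E (c + (0, h)) - E c) \<le> K_x E * norm h"
      using phase_shift[OF c] K(2) by (intro N(2)[rule_format]) auto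
  qed (use assms in auto)
  then show ?thesis by (simp add: h_def)
qed

lemma Winf_field_lipschitz:
  assumes "Winf_field (Suc k) E"
  obtains M where "M-lipschitz_on ({0..} \<times> UNIV) E"
proof -
  have cont: "continuous_on ({0..} \<times> UNIV) E" and W: "Winf (Suc k) phase E"
    using assms by (auto simp: Winf_field_def)
  have "\<forall>b\<in>Basis. \<exists>g. has_weak_partial phase E b g \<and> Linf phase g"
    using W Winf_imp_Linf[of k phase] unfolding Winf.simps by blast
  then have "Winf 1 phase E"
    using W by simp
  then obtain N M where NM: "negligible N" "M-lipschitz_on (phase - N) E"
    by (rule Winf_1_lipschitz_ae)
  show thesis
  proof (rule that)
    show "M-lipschitz_on ({0..} \<times> UNIV) E"
      using lipschitz_on_closure[OF NM(2)] cont by (simp add: closure_phase_diff_negligible[OF NM(1)])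
  qed
qed

text \<open>The weak partials of \<open>E\<close> belong to \<open>Winf 1\<close>, hence agree off a null set with Lipschitz functions \<open>G b\<close> on the
closed half space. The matrix \<open>A\<close> assembled from them is the differential of \<open>E\<close> in \<open>x\<close>: on a box of
size comparable to \<open>norm h\<close> it varies by \<open>O (norm h)\<close>, and the increment bound with \<open>w = A c h\<close> becomes the
quadratic Taylor estimate.\<close>

lemma Winf_field_2_taylor:
  assumes "Winf_field 2 E"
  obtains A M where "M \<ge> 0" "\<And>t x h. t \<ge> 0 \<Longrightarrow> norm (A (t, x) h) \<le> M * norm h"
    "\<And>z. linear (A z)"
    "\<And>t x s y h. t \<ge> 0 \<Longrightarrow> s \<ge> 0 \<Longrightarrow> norm (A (t, x) h - A (s, y) h) \<le> M * (\<bar>t - s\<bar> + norm (x - y)) * norm h"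
    "\<And>t x h. t \<ge> 0 \<Longrightarrow> norm (E (t, x + h) - E (t, x) - A (t, x) h) \<le> M * (norm h)^2"
proof -
  let ?P = "{0..} \<times> UNIV :: (real \<times> (real^2)) set"
  have cont: "continuous_on ?P E" and W: "Winf (Suc 1) phase E"
    using assms by (auto simp: Winf_field_def numeral_2_eq_2)
  obtain g where g0: "\<forall>b\<in>Basis. has_weak_partial phase E b (g b)" "\<forall>b\<in>Basis. Winf 1 phase (g b)"
    "has_weak_derivative phase E (\<lambda>z h. \<Sum>b\<in>Basis. (h \<bullet> b) *\<^sub>R g b z)"
    using W by (rule Winf_Suc_weak_derivative)
  note g = bspec[OF g0(1)] bspec[OF g0(2)] g0(3)
  have "\<exists>G N L. negligible N \<and> L-lipschitz_on ?P G \<and> (\<forall>z\<in>phase - N. g b z = G z)" if b: "b \<in> Basis" for b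
  proof -
    obtain N L where N: "negligible N" "L-lipschitz_on (phase - N) (g b)"
      using g(2)[OF b] by (rule Winf_1_lipschitz_ae)
    \<comment> \<open>a Lipschitz function on a dense set extends to the closure\<close>
    then obtain G where "L-lipschitz_on (closure (phase - N)) G" "\<forall>z\<in>phase - N. G z = g b z"
      using lipschitz_extend_closure by blast
    then show ?thesis
      using N(1) by (intro exI[of _ G] exI[of _ N] exI[of _ L]) (auto simp: closure_phase_diff_negligible)
  qed
  then have "\<forall>b\<in>Basis. \<exists>G. (\<exists>L. L-lipschitz_on ?P G) \<and> (\<exists>N. negligible N \<and> (\<forall>z\<in>phase - N. g b z = G z))"
    by blast
  from bchoice[OF this] obtain G where G0: "\<forall>b\<in>Basis. (\<exists>L. L-lipschitz_on ?P (G b)) \<and>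
      (\<exists>N. negligible N \<and> (\<forall>z\<in>phase - N. g b z = G b z))" ..
  then have "\<forall>b\<in>Basis. \<exists>L. L-lipschitz_on ?P (G b)" by blast
  from bchoice[OF this] obtain L where L: "\<forall>b\<in>Basis. (L b)-lipschitz_on ?P (G b)" ..
  have "\<forall>b\<in>Basis. \<exists>N. negligible N \<and> (\<forall>z\<in>phase - N. g b z = G b z)" using G0 by blast
  from bchoice[OF this] obtain N where N: "\<forall>b\<in>Basis. negligible (N b) \<and> (\<forall>z\<in>phase - N b. g b z = G b z)" ..
  have G: "negligible (N b)" "(L b)-lipschitz_on ?P (G b)" "z \<in> phase - N b \<Longrightarrow> g b z = G b z"
    if "b \<in> Basis" for b z
    using L N that by blast+
  have linf: "Linf phase (g b)" if "b \<in> Basis" for b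
    using g(2)[OF that] by (rule Winf_imp_Linf)
  obtain N' B where N': "negligible N'" "B \<ge> 0" "\<forall>z\<in>phase - N'. \<forall>b\<in>Basis. norm (g b z) \<le> B"
    by (rule Linf_family_bound[OF phase_lebesgue finite_Basis linf])
  have GB: "norm (G b z) \<le> B" if "b \<in> Basis" "z \<in> ?P" for b z
  proof (rule continuous_extension_bound)
    show "continuous_on ?P (G b)" using G(2)[OF that(1)] by (rule lipschitz_on_continuous_on)
    show "negligible (N' \<union> N b)" using N'(1) G(1)[OF that(1)] by (rule negligible_Un)
    show "norm (G b z) \<le> B" if "z \<in> phase - (N' \<union> N b)" for z
      using N'(3)[rule_format, of z b] G(3)[of b z] that \<open>b \<in> Basis\<close> by auto
  qed (use that in auto)
  define L' where "L' = (\<Sum>b\<in>Basis. L b)"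
  have L0: "L b \<ge> 0" if "b \<in> Basis" for b using G(2)[OF that] by (rule lipschitz_on_nonneg)
  have LL: "L b \<le> L'" if "b \<in> Basis" for b
    unfolding L'_def using that L0 by (intro member_le_sum) auto
  have GL: "norm (G b z - G b w) \<le> L' * norm (z - w)" if "b \<in> Basis" "z \<in> ?P" "w \<in> ?P" for b z w
    using lipschitz_onD[OF G(2)[OF that(1)] that(2,3)] LL[OF that(1)]
    by (simp add: dist_norm) (meson mult_right_mono norm_ge_zero order_trans)
  define d where "d = real DIM(real \<times> (real^2))"
  define A where "A z h = (\<Sum>b\<in>Basis. ((0, h) \<bullet> b) *\<^sub>R G b z)" for z and h :: "real^2"
  have Abound: "norm (A z h) \<le> d * B * norm h" if "z \<in> ?P" for z h
    using norm_sum_coordinates_le[of "\<lambda>b. G b z" B "(0 :: real, h)"] GB that by (simp add: A_def d_def)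
  have Alip: "norm (A z h - A w h) \<le> d * (L' * norm (z - w)) * norm h" if "z \<in> ?P" "w \<in> ?P" for z w h
    using norm_sum_coordinates_le[of "\<lambda>b. G b z - G b w" "L' * norm (z - w)" "(0 :: real, h)"] GL that
    by (simp add: A_def d_def sum_subtractf[symmetric] scaleR_diff_right)
  have Alin: "linear (A z)" for z
  proof -
    have "linear (\<lambda>h. \<Sum>b\<in>Basis. (((0::real), h) \<bullet> b) *\<^sub>R G b z)"
      by (intro bounded_linear.linear bounded_linear_sum bounded_linear_scaleR_const
          bounded_linear_compose[OF bounded_linear_inner_left] bounded_linear_Pair bounded_linear_zero bounded_linear_ident)
    then show ?thesis by (simp add: A_def[abs_def])
  qed
  obtain N0 where N0: "negligible N0"
    "\<forall>c h p q w L. c \<notin> N0 \<longrightarrow> c + h \<notin> N0 \<longrightarrow> c \<in> box p q \<longrightarrow> c + h \<in> box p q \<longrightarrow> cbox p q \<subseteq> phase \<longrightarrow>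
      (AE z in lebesgue_on (cbox p q). norm ((\<Sum>b\<in>Basis. (h \<bullet> b) *\<^sub>R g b z) - w) \<le> L) \<longrightarrow> norm (E (c + h) - E c - w) \<le> L"
    by (rule weak_derivative_increment_bound[OF open_phase g(3)])
  \<comment> \<open>5 bounds the distance from \<open>c\<close>, in units of \<open>norm h\<close>, of the points of the box chosen in the proof\<close>
  have taylor0: "norm (E (c + (0, h)) - E c - A c h) \<le> d * (L' * (5 * norm h)) * norm h"
    if c: "c \<in> phase - N0" "c + (0, h) \<in> phase - N0" for c h
  proof (cases "h = 0")
    case True
    then show ?thesis using Alin by (simp add: linear_0 zero_prod_def[symmetric])
  next
    case False
    obtain t x where tx: "c = (t, x)" by (cases c)
    have t: "t > 0" using c by (simp add: tx phase_def)
    define \<rho> where "\<rho> = norm h"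
    have \<rho>: "\<rho> > 0" using False by (simp add: \<rho>_def)
    \<comment> \<open>the box has to be flat in time near \<open>t = 0\<close> in order to stay inside the phase space\<close>
    define \<tau> where "\<tau> = min (t / 2) \<rho>"
    have \<tau>: "\<tau> > 0" "\<tau> \<le> \<rho>" "\<tau> < t" using t \<rho> by (auto simp: \<tau>_def)
    define p q where "p = (t - \<tau>, \<chi> i. x $ i - 2 * \<rho>)" and "q = (t + \<tau>, \<chi> i. x $ i + 2 * \<rho>)"
    have h: "\<bar>h $ i\<bar> \<le> \<rho>" for i unfolding \<rho>_def by (rule component_le_norm_cart)
    have in1: "c \<in> box p q" unfolding tx p_def q_def mem_box_phase using \<tau> \<rho> by auto
    have in2: "c + (0, h) \<in> box p q"
    proof -
      have "- 2 * \<rho> < h $ i" "h $ i < 2 * \<rho>" for i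
        using h[of i] \<rho> by (auto simp: abs_le_iff)
      then show ?thesis unfolding tx p_def q_def using \<tau> by (simp add: mem_box_phase)
    qed
    have near: "norm (z - c) \<le> 5 * \<rho>" "z \<in> phase" if "z \<in> cbox p q" for z
    proof -
      obtain s y where z: "z = (s, y)" by (cases z)
      have zz: "t - \<tau> \<le> s" "s \<le> t + \<tau>" "\<And>i. x $ i - 2 * \<rho> \<le> y $ i" "\<And>i. y $ i \<le> x $ i + 2 * \<rho>"
        using that unfolding z p_def q_def mem_box_phase by auto
      have "norm (y - x) \<le> (\<Sum>i\<in>UNIV. \<bar>(y - x) $ i\<bar>)" by (rule norm_le_l1_cart)
      also have "\<dots> \<le> (\<Sum>i\<in>(UNIV :: 2 set). 2 * \<rho>)"
        using zz(3,4) by (intro sum_mono) (auto simp: abs_le_iff algebra_simps)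
      finally have "norm (y - x) \<le> 4 * \<rho>" by simp
      moreover have "\<bar>s - t\<bar> \<le> \<rho>" using zz(1,2) \<tau> by linarith
      moreover have "norm (z - c) \<le> norm (s - t) + norm (y - x)"
        using norm_Pair_le[of "s - t" "y - x"] by (simp add: z tx)
      ultimately show "norm (z - c) \<le> 5 * \<rho>" by simp
      show "z \<in> phase" using zz(1) \<tau> by (simp add: z phase_def)
    qed
    have "AE z in lebesgue_on (cbox p q). norm ((\<Sum>b\<in>Basis. ((0, h) \<bullet> b) *\<^sub>R g b z) - A c h) \<le> d * (L' * (5 * norm h)) * norm h"
    proof (subst lebesgue_on_AE_iff, simp, intro exI conjI ballI)
      show "negligible (\<Union>(N ` Basis))"
        using G(1) by (intro negligible_Union) auto
      fix z assume z: "z \<in> cbox p q - \<Union>(N ` Basis)"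
      have "(\<Sum>b\<in>Basis. ((0, h) \<bullet> b) *\<^sub>R g b z) = A z h"
        unfolding A_def using G(3) z near(2)[of z] by (intro sum.cong) auto
      moreover have "norm (A z h - A c h) \<le> d * (L' * norm (z - c)) * norm h"
        using Alip[of z c h] near(2)[of z] z c by (auto simp: phase_def)
      moreover have "\<dots> \<le> d * (L' * (5 * norm h)) * norm h"
        using near(1)[of z] z LL L0 sum_nonneg[of Basis L]
        by (intro mult_right_mono mult_left_mono) (auto simp: \<rho>_def d_def L'_def)
      ultimately show "norm ((\<Sum>b\<in>Basis. ((0, h) \<bullet> b) *\<^sub>R g b z) - A c h) \<le> d * (L' * (5 * norm h)) * norm h"
        by simp
    qed
    then show ?thesis
      using c in1 in2 near(2) by (intro N0(2)[rule_format, where p = p and q = q]) auto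
  qed
  have L'0: "L' \<ge> 0" unfolding L'_def using L0 by (rule sum_nonneg)
  have contA: "continuous_on ?P (\<lambda>c. A c h)" for h
    unfolding A_def by (intro continuous_intros lipschitz_on_continuous_on[OF G(2)])
  have taylor: "norm (E (c + (0, h)) - E c - A c h) \<le> d * (L' * (5 * norm h)) * norm h" if "c \<in> ?P" for c h
  proof (rule continuous_extension_bound[where G = "\<lambda>c. E (c + (0, h)) - E c - A c h", OF _ negligible_union_shift[OF N0(1), of "(0, h)"]])
    show "continuous_on ?P (\<lambda>c. E (c + (0, h)) - E c - A c h)"
      by (intro continuous_intros contA continuous_on_compose2[OF cont] cont) auto
    show "norm (E (c + (0, h)) - E c - A c h) \<le> d * (L' * (5 * norm h)) * norm h"
      if "c \<in> phase - (N0 \<union> (\<lambda>z. - (0, h) + z) ` N0)" for c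
      using phase_shift[OF that] by (rule taylor0)
  qed (use that in auto)
  \<comment> \<open>one constant for the size, the Lipschitz constant and the second-order remainder of \<open>A\<close>\<close>
  define M where "M = d * B + 5 * d * L'"
  have d0: "d \<ge> 0" by (simp add: d_def)
  have M1: "d * B \<le> M" "d * L' \<le> M" "5 * d * L' \<le> M" "0 \<le> M"
    using d0 L'0 N'(2) by (auto simp: M_def)
  show thesis
  proof (rule that[OF M1(4) _ Alin])
    show "norm (A (t, x) h) \<le> M * norm h" if "t \<ge> 0" for t x h
      using Abound[of "(t, x)" h] that mult_right_mono[OF M1(1) norm_ge_zero[of h]] by simp
    show "norm (A (t, x) h - A (s, y) h) \<le> M * (\<bar>t - s\<bar> + norm (x - y)) * norm h" if "t \<ge> 0" "s \<ge> 0" for t x s y h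
    proof -
      have "norm (A (t, x) h - A (s, y) h) \<le> d * L' * norm ((t, x) - (s, y)) * norm h"
        using Alip[of "(t, x)" "(s, y)" h] that by (simp add: mult.assoc)
      also have "\<dots> \<le> M * (\<bar>t - s\<bar> + norm (x - y)) * norm h"
        using norm_Pair_le[of "t - s" "x - y"] M1 d0 L'0 by (intro mult_right_mono mult_mono) auto
      finally show ?thesis .
    qed
    show "norm (E (t, x + h) - E (t, x) - A (t, x) h) \<le> M * (norm h)^2" if "t \<ge> 0" for t x h
    proof -
      have "norm (E (t, x + h) - E (t, x) - A (t, x) h) \<le> 5 * d * L' * (norm h)^2"
        using taylor[of "(t, x)" h] that by (simp add: power2_eq_square ac_simps)
      also have "\<dots> \<le> M * (norm h)^2" using M1 by (intro mult_right_mono) auto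
      finally show ?thesis .
    qed
  qed
qed

section \<open>Solvability of the scheme and discrete inequalities\<close>

lemma norm_vec2: "norm (a :: real^2) = sqrt ((a $ 1)^2 + (a $ 2)^2)"
  by (simp add: norm_vec_def L2_set_def sum_2)

lemma perp_nth [simp]: "perp a $ 1 = - (a $ 2)" "perp a $ 2 = a $ 1"
  by (simp_all add: perp_def)

lemma linear_perp: "linear perp"
  by (rule linearI) (simp_all add: vec_eq_iff forall_2)

lemmas perp_simps = linear_add[OF linear_perp] linear_diff[OF linear_perp] linear_scale[OF linear_perp]
  linear_neg[OF linear_perp] linear_0[OF linear_perp]

lemma perp_perp [simp]: "perp (perp a) = - a"
  by (simp add: vec_eq_iff forall_2)

lemma norm_perp [simp]: "norm (perp a) = norm a"
  by (simp add: norm_vec2 add.commute)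

lemma bounded_linear_perp: "bounded_linear perp"
  using linear_perp by (simp add: linear_conv_bounded_linear)

text \<open>The implicit rotation step is a contraction for every step size; this is the stability of the scheme.\<close>

lemma norm_le_norm_add_perp: "norm a \<le> norm (a + c *\<^sub>R perp a)"
proof -
  have sq: "(norm b)^2 = (b $ 1)^2 + (b $ 2)^2" for b :: "real^2"
    by (simp add: norm_vec2)
  have "(norm (a + c *\<^sub>R perp a))^2 = (norm a)^2 + c^2 * (norm a)^2"
    unfolding sq by (simp add: power2_eq_square algebra_simps)
  then have "(norm a)^2 \<le> (norm (a + c *\<^sub>R perp a))^2"
    by simp
  then show ?thesis by (rule power2_le_imp_le) simp
qed

text \<open>Each step solves \<open>(I + c perp) w = a\<close>, and \<open>(I + c perp) (I - c perp) = (1 + c^2) I\<close>.\<close>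

lemma resolvent_unique:
  "w + c *\<^sub>R perp w = a \<longleftrightarrow> w = (1 / (1 + c^2)) *\<^sub>R (a - c *\<^sub>R perp a)"
proof -
  have "1 + c^2 > 0" by (intro add_pos_nonneg) auto
  then have c: "1 + c^2 \<noteq> 0" by simp
  show ?thesis
  proof
    assume "w + c *\<^sub>R perp w = a"
    then have "a - c *\<^sub>R perp a = (1 + c^2) *\<^sub>R w"
      by (auto simp: perp_simps algebra_simps power2_eq_square)
    then show "w = (1 / (1 + c^2)) *\<^sub>R (a - c *\<^sub>R perp a)"
      using c by simp
  next
    assume w: "w = (1 / (1 + c^2)) *\<^sub>R (a - c *\<^sub>R perp a)"
    have "w + c *\<^sub>R perp w = (1 / (1 + c^2)) *\<^sub>R ((1 + c^2) *\<^sub>R a)"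
      unfolding w by (simp add: perp_simps algebra_simps power2_eq_square)
    then show "w + c *\<^sub>R perp w = a" using c by simp
  qed
qed

lemma scheme_step_iff:
  fixes x x' v v' F :: "real^2"
  assumes "e > 0" "dt > 0"
  shows "(x' - x) /\<^sub>R dt = v' /\<^sub>R e \<longleftrightarrow> x' = x + (dt / e) *\<^sub>R v'"
    and "e *\<^sub>R ((v' - v) /\<^sub>R dt) = F - perp v' /\<^sub>R e \<longleftrightarrow>
      v' + (dt / e^2) *\<^sub>R perp v' = v + (dt / e) *\<^sub>R F"
proof -
  have "(x' - x) /\<^sub>R dt = v' /\<^sub>R e \<longleftrightarrow> dt *\<^sub>R ((x' - x) /\<^sub>R dt) = dt *\<^sub>R (v' /\<^sub>R e)"
    using assms by (simp only: scaleR_cancel_left) auto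
  also have "\<dots> \<longleftrightarrow> x' - x = (dt / e) *\<^sub>R v'"
    using assms by (simp add: divide_inverse)
  finally show "(x' - x) /\<^sub>R dt = v' /\<^sub>R e \<longleftrightarrow> x' = x + (dt / e) *\<^sub>R v'"
    by (simp add: algebra_simps)
  have "e *\<^sub>R ((v' - v) /\<^sub>R dt) = F - perp v' /\<^sub>R e \<longleftrightarrow>
      (dt / e) *\<^sub>R (e *\<^sub>R ((v' - v) /\<^sub>R dt)) = (dt / e) *\<^sub>R (F - perp v' /\<^sub>R e)"
    using assms by (simp only: scaleR_cancel_left) auto
  also have "\<dots> \<longleftrightarrow> v' - v = (dt / e) *\<^sub>R F - (dt / e^2) *\<^sub>R perp v'"
  proof -
    have "(dt / e) * (e * inverse dt) = 1" "(dt / e) * inverse e = dt / e^2"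
      using assms by (simp_all add: power2_eq_square field_simps)
    then show ?thesis by (simp only: scaleR_scaleR scaleR_diff_right scaleR_one)
  qed
  finally show "e *\<^sub>R ((v' - v) /\<^sub>R dt) = F - perp v' /\<^sub>R e \<longleftrightarrow>
      v' + (dt / e^2) *\<^sub>R perp v' = v + (dt / e) *\<^sub>R F"
    by (auto simp: algebra_simps)
qed

lemma scheme_solution_iff:
  assumes "e > 0" "dt > 0"
  shows "scheme_solution E e dt x0 v0 xs vs \<longleftrightarrow> xs 0 = x0 \<and> vs 0 = v0 \<and>
    (\<forall>n. xs (Suc n) = xs n + (dt / e) *\<^sub>R vs (Suc n) \<and>
      vs (Suc n) + (dt / e^2) *\<^sub>R perp (vs (Suc n)) = vs n + (dt / e) *\<^sub>R E (real n * dt, xs n))"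
  unfolding scheme_solution_def scheme_step_iff[OF assms] ..

lemma ex1_scheme_solution:
  assumes "e > 0" "dt > 0"
  shows "\<exists>!z. scheme_solution E e dt x0 v0 (\<lambda>n. fst (z n)) (\<lambda>n. snd (z n))"
proof -
  define S where "S n p = (let a = snd p + (dt / e) *\<^sub>R E (real n * dt, fst p);
      w = (1 / (1 + (dt / e^2)^2)) *\<^sub>R (a - (dt / e^2) *\<^sub>R perp a)
      in (fst p + (dt / e) *\<^sub>R w, w))" for n p
  have iff: "scheme_solution E e dt x0 v0 (\<lambda>n. fst (z n)) (\<lambda>n. snd (z n)) \<longleftrightarrow>
      z 0 = (x0, v0) \<and> (\<forall>n. z (Suc n) = S n (z n))" for z
    unfolding scheme_solution_iff[OF assms] resolvent_unique S_def Let_def prod_eq_iff by auto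
  show ?thesis
    unfolding iff
  proof (rule ex1I)
    show "rec_nat (x0, v0) S 0 = (x0, v0) \<and> (\<forall>n. rec_nat (x0, v0) S (Suc n) = S n (rec_nat (x0, v0) S n))"
      by simp
    fix z assume z: "z 0 = (x0, v0) \<and> (\<forall>n. z (Suc n) = S n (z n))"
    have "z n = rec_nat (x0, v0) S n" for n
      by (induction n) (use z in auto)
    then show "z = rec_nat (x0, v0) S" by auto
  qed
qed

text \<open>The source may grow as fast as the solution of the homogeneous recursion without changing the exponential rate.\<close>

lemma discrete_gronwall:
  fixes u :: "nat \<Rightarrow> real" and a G :: real
  assumes "a \<ge> 0" "\<And>k. k \<le> n \<Longrightarrow> u k \<ge> 0"
    and step: "\<And>k. k < n \<Longrightarrow> u (Suc k) \<le> (1 + a) * u k + G * exp (a * Suc k)"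
  shows "k \<le> n \<Longrightarrow> u k \<le> exp (a * k) * (u 0 + k * G)"
proof (induction k)
  case (Suc k)
  have "u (Suc k) \<le> (1 + a) * u k + G * exp (a * Suc k)" using Suc.prems step by simp
  also have "(1 + a) * u k \<le> exp a * (exp (a * k) * (u 0 + k * G))"
    using Suc assms by (intro mult_mono) auto
  also have "exp a * (exp (a * k) * (u 0 + k * G)) + G * exp (a * Suc k) = exp (a * Suc k) * (u 0 + Suc k * G)"
    by (simp add: algebra_simps exp_add)
  finally show ?case by simp
qed simp

text \<open>A sharper form for sources of twice the growth rate: the geometric sum of \<open>exp (2 a i)\<close> absorbs the factor \<open>a\<close>,
so only a factor 2 is lost.\<close>

lemma sum_gronwall:
  fixes u :: "nat \<Rightarrow> real" and a B :: real
  assumes "a \<ge> 0" "B \<ge> 0"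
    and u: "\<And>k. k \<le> n \<Longrightarrow> u k \<le> a * (\<Sum>i<k. u i) + B * exp (2 * a * k)"
  shows "k \<le> n \<Longrightarrow> u k \<le> 2 * B * exp (2 * a * k)"
proof (induction k rule: less_induct)
  case (less k)
  have geo: "(\<Sum>i<m. 2 * a * exp (2 * a * i)) \<le> exp (2 * a * m) - 1" for m :: nat
  proof (induction m)
    case (Suc m)
    have "2 * a \<le> exp (2 * a) - 1" using exp_ge_add_one_self[of "2 * a"] by linarith
    then have "2 * a * exp (2 * a * m) \<le> (exp (2 * a) - 1) * exp (2 * a * m)"
      by (rule mult_right_mono) simp
    with Suc show ?case by (simp add: algebra_simps exp_add)
  qed simp
  have "a * (\<Sum>i<k. u i) \<le> a * (\<Sum>i<k. 2 * B * exp (2 * a * i))"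
    using assms less by (intro mult_left_mono sum_mono) auto
  also have "\<dots> = B * (\<Sum>i<k. 2 * a * exp (2 * a * i))"
    by (simp add: sum_distrib_left ac_simps)
  also have "\<dots> \<le> B * (exp (2 * a * k) - 1)"
    using geo assms by (intro mult_left_mono) auto
  also have "\<dots> \<le> B * exp (2 * a * k)" using assms by (intro mult_left_mono) auto
  finally have "a * (\<Sum>i<k. u i) \<le> B * exp (2 * a * k)" .
  with u[OF less.prems] show ?case by linarith
qed

lemma norm_triangle_four:
  fixes a b c d :: "'a::real_normed_vector"
  shows "norm (a - b + c - d) \<le> norm a + norm b + norm c + norm d"
  using norm_triangle_ineq4[of "a - b + c" d] norm_triangle_ineq[of "a - b" c] norm_triangle_ineq4[of a b]
  by linarith

text \<open>Passage to the limit of infinitely fine grids.\<close>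

lemma le_of_le_add_inverse_nat:
  fixes a b c :: real
  assumes "\<And>N::nat. 1 \<le> N \<Longrightarrow> a \<le> b + c / real N"
  shows "a \<le> b"
proof (rule LIMSEQ_le_const)
  have "(\<lambda>n. b + c * (1 / real n)) \<longlonglongrightarrow> b + c * 0"
    by (intro tendsto_intros lim_1_over_n)
  then show "(\<lambda>n. b + c / real n) \<longlonglongrightarrow> b" by simp
  show "\<exists>N. \<forall>n\<ge>N. a \<le> b + c / real n" using assms by (intro exI[of _ 1]) auto
qed

text \<open>The defect in the implicit velocity equation; the scheme is the requirement that it vanish.\<close>

abbreviation step_residual :: "real \<Rightarrow> real \<Rightarrow> real^2 \<Rightarrow> real^2 \<Rightarrow> real^2 \<Rightarrow> real^2" where
  "step_residual e h w v F \<equiv> w + (h / e^2) *\<^sub>R perp w - v - (h / e) *\<^sub>R F"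

text \<open>The shift by \<open>e *\<^sub>R perp (F (k - 1))\<close> cancels the field in the recursion, leaving only the differences
\<open>F k - F (k - 1)\<close>, which cost a factor \<open>h\<close>. The tolerance \<open>\<tau>\<close> is 0 for the scheme and quadratic in \<open>h\<close> for a sampled
exact trajectory.\<close>

lemma perturbed_velocity_bound:
  fixes v F :: "nat \<Rightarrow> real^2"
  assumes pos: "h > 0" "e > 0" "K \<ge> 0" "L \<ge> 0" "M \<ge> 0" "\<tau> \<ge> 0"
    and step: "\<And>k. k < n \<Longrightarrow> norm (step_residual e h (v (Suc k)) (v k) (F k)) \<le> \<tau>"
    and F: "\<And>k. k < n \<Longrightarrow> norm (F (Suc k) - F k) \<le> h * (L + K * norm (v (Suc k)) / e) + \<tau>"
    and FM: "\<And>k. k \<le> n \<Longrightarrow> norm (F k) \<le> M"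
    and "k \<le> n"
  shows "norm (v k) \<le> exp (K * h * k) * (norm (v 0) + 2 * e * M + k * (h * e * (L + K * M) + (1 + e) * \<tau>))"
proof -
  \<comment> \<open>with natural subtraction \<open>F (0 - 1) = F 0\<close>, so the first step has no field increment\<close>
  define w where "w k = v k + e *\<^sub>R perp (F (k - 1))" for k
  define g where "g = h * e * (L + K * M) + (1 + e) * \<tau>"
  have g0: "g \<ge> 0" using pos by (simp add: g_def)
  have vw: "norm (v k) \<le> norm (w k) + e * M" if "k \<le> n" for k
  proof -
    have "v k = w k - e *\<^sub>R perp (F (k - 1))" by (simp add: w_def)
    then have "norm (v k) \<le> norm (w k) + norm (e *\<^sub>R perp (F (k - 1)))"
      using norm_triangle_ineq4[of "w k" "e *\<^sub>R perp (F (k - 1))"] by simp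
    also have "norm (e *\<^sub>R perp (F (k - 1))) \<le> e * M"
      using FM[of "k - 1"] that pos by (simp add: mult_left_mono)
    finally show ?thesis by simp
  qed
  have "norm (w (Suc k)) \<le> (1 + K * h) * norm (w k) + g * exp (K * h * Suc k)" if "k < n" for k
  proof -
    define r where "r = step_residual e h (v (Suc k)) (v k) (F k)"
    have "h / e^2 * e = h / e" using pos by (simp add: power2_eq_square)
    then have "w (Suc k) + (h / e^2) *\<^sub>R perp (w (Suc k)) = w k + e *\<^sub>R perp (F k - F (k - 1)) + r"
      by (simp add: w_def r_def perp_simps algebra_simps)
    then have "norm (w (Suc k)) \<le> norm (w k + e *\<^sub>R perp (F k - F (k - 1)) + r)"
      using norm_le_norm_add_perp[of "w (Suc k)" "h / e^2"] by simp
    also have "\<dots> \<le> norm (w k) + norm (e *\<^sub>R perp (F k - F (k - 1))) + norm r"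
      by (intro norm_triangle_mono norm_triangle_ineq order_refl)
    also have "norm (e *\<^sub>R perp (F k - F (k - 1))) = e * norm (F k - F (k - 1))" using pos by simp
    also have "norm r \<le> \<tau>" unfolding r_def using step that by simp
    also have "norm (F k - F (k - 1)) \<le> h * (L + K * norm (v k) / e) + \<tau>"
      using F[of "k - 1"] that pos by (cases k) auto
    finally have "norm (w (Suc k)) \<le> norm (w k) + e * (h * (L + K * norm (v k) / e) + \<tau>) + \<tau>"
      using pos by (simp add: mult_left_mono)
    also have "\<dots> = norm (w k) + h * e * L + K * h * norm (v k) + (1 + e) * \<tau>"
      using pos by (simp add: field_simps)
    also have "K * h * norm (v k) \<le> K * h * (norm (w k) + e * M)"
      using vw[of k] that pos by (intro mult_left_mono) auto
    finally have "norm (w (Suc k)) \<le> (1 + K * h) * norm (w k) + g"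
      by (simp add: g_def algebra_simps)
    also have "g \<le> g * exp (K * h * Suc k)" using pos g0 by (simp add: mult_le_cancel_left1)
    finally show ?thesis by simp
  qed
  then have "norm (w k) \<le> exp (K * h * k) * (norm (w 0) + k * g)"
    using pos \<open>k \<le> n\<close> by (intro discrete_gronwall[where n = n and u = "\<lambda>k. norm (w k)"]) auto
  moreover have "norm (w 0) \<le> norm (v 0) + e * M"
    unfolding w_def using FM[of 0] pos by (intro norm_triangle_le add_mono) (auto simp: mult_left_mono)
  ultimately have "norm (w k) \<le> exp (K * h * k) * (norm (v 0) + e * M + k * g)"
    by (elim order_trans) (intro mult_left_mono, auto)
  moreover have "e * M \<le> exp (K * h * k) * (e * M)"
    using pos mult_right_mono[of 1 "exp (K * h * k)" "e * M"] by simp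
  ultimately show ?thesis
    using vw[OF \<open>k \<le> n\<close>] by (simp add: g_def algebra_simps)
qed

text \<open>Summation by parts moves the differences from \<open>v\<close>, which oscillates, to the maps \<open>A k\<close>, which vary slowly.\<close>

lemma summation_by_parts_bound:
  fixes A :: "nat \<Rightarrow> 'a::real_normed_vector \<Rightarrow> 'b::real_normed_vector"
  assumes lin: "\<And>k. linear (A k)" and bnd: "\<And>k x. k \<le> n \<Longrightarrow> norm (A k x) \<le> a * norm x"
    and lip: "\<And>k x. k < n \<Longrightarrow> norm (A (Suc k) x - A k x) \<le> l * norm x"
    and V: "\<And>k. k \<le> n \<Longrightarrow> norm (v k) \<le> V" and pos: "a \<ge> 0" "l \<ge> 0"
  shows "norm (\<Sum>k<n. A (Suc k) (v (Suc k) - v k)) \<le> 2 * a * V + n * l * V"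
proof -
  have "(\<Sum>k<m. A (Suc k) (v (Suc k) - v k)) = A m (v m) - A 0 (v 0) - (\<Sum>k<m. A (Suc k) (v k) - A k (v k))" for m
    by (induction m) (simp_all add: linear_diff[OF lin] algebra_simps)
  then have "norm (\<Sum>k<n. A (Suc k) (v (Suc k) - v k))
      = norm (A n (v n) - A 0 (v 0) - (\<Sum>k<n. A (Suc k) (v k) - A k (v k)))" by simp
  also have "\<dots> \<le> norm (A n (v n) - A 0 (v 0)) + norm (\<Sum>k<n. A (Suc k) (v k) - A k (v k))"
    by (rule norm_triangle_ineq4)
  also have "norm (A n (v n) - A 0 (v 0)) \<le> norm (A n (v n)) + norm (A 0 (v 0))"
    by (rule norm_triangle_ineq4)
  also have "norm (A n (v n)) \<le> a * V" using bnd[of n "v n"] mult_left_mono[OF V[of n] pos(1)] by simp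
  also have "norm (A 0 (v 0)) \<le> a * V" using bnd[of 0 "v 0"] mult_left_mono[OF V[of 0] pos(1)] by simp
  also have "norm (\<Sum>k<n. A (Suc k) (v k) - A k (v k)) \<le> (\<Sum>k<n. l * V)"
  proof (rule sum_norm_le)
    fix k assume "k \<in> {..<n}"
    then show "norm (A (Suc k) (v k) - A k (v k)) \<le> l * V"
      using lip[of k "v k"] mult_left_mono[OF V[of k] pos(2)] by simp
  qed
  finally show ?thesis by (simp add: algebra_simps)
qed

section \<open>A priori bounds and local consistency\<close>

text \<open>What the \<open>Winf 1\<close> hypothesis amounts to pointwise. The constant \<open>K\<close> is kept apart from \<open>L\<close> because
only the Lipschitz constant in space may enter the exponential rates. The parameter \<open>e\<close> of the
locales that follow stands for \<open>\<epsilon>\<close>, and \<open>dt\<close> for \<open>\<Delta>t\<close>.\<close>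

locale lipschitz_field =
  fixes E :: efield and M L K :: real
  assumes bounds_nonneg: "M \<ge> 0" "L \<ge> 0" "K \<ge> 0"
    and field_le: "t \<ge> 0 \<Longrightarrow> norm (E (t, x)) \<le> M"
    and field_lipschitz_t: "t \<ge> 0 \<Longrightarrow> s \<ge> 0 \<Longrightarrow> norm (E (t, x) - E (s, x)) \<le> L * \<bar>t - s\<bar>"
    and field_lipschitz_x: "t \<ge> 0 \<Longrightarrow> norm (E (t, x) - E (t, y)) \<le> K * norm (x - y)"
begin

lemma field_lipschitz:
  assumes "t \<ge> 0" "s \<ge> 0"
  shows "norm (E (t, x) - E (s, y)) \<le> L * \<bar>t - s\<bar> + K * norm (x - y)"
proof -
  have "norm (E (t, x) - E (s, y)) \<le> norm (E (t, x) - E (s, x)) + norm (E (s, x) - E (s, y))"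
    using norm_triangle_ineq[of "E (t, x) - E (s, x)" "E (s, x) - E (s, y)"] by simp
  then show ?thesis
    using field_lipschitz_t[OF assms, of x] field_lipschitz_x[OF assms(2), of x y] by linarith
qed

definition vel_const :: real where
  "vel_const = 1 + 2 * M + L + K * M"

lemma vel_const_ge: "1 \<le> vel_const" "0 \<le> vel_const"
  using bounds_nonneg by (simp_all add: vel_const_def)

lemma velocity_bound_simplify:
  assumes "t \<ge> 0" "e > 0" "a \<ge> 0"
  shows "a + 2 * e * M + t * e * (L + K * M) \<le> vel_const * (1 + t) * (a + e)"
proof -
  have "vel_const * (1 + t) * (a + e) - (a + 2 * e * M + t * e * (L + K * M))
     = a * (2 * M + L + K * M) + e * (1 + L + K * M) + t * (vel_const * a + e * (1 + 2 * M))"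
    by (simp add: vel_const_def algebra_simps)
  moreover have "0 \<le> \<dots>"
    using assms bounds_nonneg vel_const_ge by (intro add_nonneg_nonneg mult_nonneg_nonneg) auto
  ultimately show ?thesis by linarith
qed

lemma scheme_velocity_bound:
  assumes "dt > 0" "e > 0" "scheme_solution E e dt x0 v0 xs vs"
  shows "norm (vs n) \<le> vel_const * (1 + n * dt) * (norm v0 + e) * exp (K * (n * dt))"
proof -
  have eqs: "xs (Suc k) = xs k + (dt / e) *\<^sub>R vs (Suc k)"
    "vs (Suc k) + (dt / e^2) *\<^sub>R perp (vs (Suc k)) = vs k + (dt / e) *\<^sub>R E (real k * dt, xs k)" for k
    using assms(3) unfolding scheme_solution_iff[OF assms(2,1)] by auto
  have "vs 0 = v0" using assms(3) by (simp add: scheme_solution_def)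
  define F where "F k = E (real k * dt, xs k)" for k
  have "norm (vs n) \<le> exp (K * dt * n) * (norm (vs 0) + 2 * e * M + n * (dt * e * (L + K * M) + (1 + e) * 0))"
  proof (rule perturbed_velocity_bound[where n = n and F = F])
    fix k
    show "norm (step_residual e dt (vs (Suc k)) (vs k) (F k)) \<le> 0"
      using eqs(2)[of k] by (simp add: F_def)
    show "norm (F k) \<le> M" unfolding F_def using assms by (intro field_le) simp
    have "norm (F (Suc k) - F k) \<le> L * \<bar>real (Suc k) * dt - real k * dt\<bar> + K * norm (xs (Suc k) - xs k)"
      unfolding F_def using assms by (intro field_lipschitz) auto
    also have "real (Suc k) * dt - real k * dt = dt" by (simp add: algebra_simps)
    also have "norm (xs (Suc k) - xs k) = dt / e * norm (vs (Suc k))" using eqs(1)[of k] assms by simp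
    finally show "norm (F (Suc k) - F k) \<le> dt * (L + K * norm (vs (Suc k)) / e) + 0"
      using assms by (simp add: algebra_simps)
  qed (use assms bounds_nonneg in auto)
  also have "\<dots> = exp (K * (n * dt)) * (norm v0 + 2 * e * M + (n * dt) * e * (L + K * M))"
    using \<open>vs 0 = v0\<close> by (simp add: algebra_simps)
  also have "\<dots> \<le> exp (K * (n * dt)) * (vel_const * (1 + n * dt) * (norm v0 + e))"
    using assms by (intro mult_left_mono velocity_bound_simplify) auto
  finally show ?thesis by (simp add: mult.commute)
qed

end

lemma increment_bound:
  fixes f :: "real \<Rightarrow> 'b::real_normed_vector"
  assumes "0 \<le> s" "0 \<le> h" "\<And>r. r \<in> {s..s + h} \<Longrightarrow> (f has_vector_derivative f' r) (at r within {0..})"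
    and "\<And>r. r \<in> {s..s + h} \<Longrightarrow> norm (f' r - c) \<le> B"
  shows "norm (f (s + h) - f s - h *\<^sub>R c) \<le> h * B"
proof -
  have "norm ((f (s + h) - (s + h) *\<^sub>R c) - (f s - s *\<^sub>R c)) \<le> B * norm ((s + h) - s)"
  proof (rule vector_derivative_norm_bound[where S = "{s..s + h}"])
    fix r assume r: "r \<in> {s..s + h}"
    have "(f has_vector_derivative f' r) (at r within {s..s + h})"
      using assms(1) by (intro has_vector_derivative_within_subset[OF assms(3)[OF r]]) auto
    then show "((\<lambda>r. f r - r *\<^sub>R c) has_vector_derivative f' r - c) (at r within {s..s + h})"
      by (auto intro!: derivative_eq_intros)
  qed (use assms in auto)
  then show ?thesis using assms by (simp add: algebra_simps)
qed

locale exact_flow = lipschitz_field +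
  fixes e :: real and x0 v0 :: "real^2" and x v :: "real \<Rightarrow> real^2"
  assumes eps: "e > 0" and exact: "exact_solution E e x0 v0 x v"
begin

abbreviation field_rate :: "real \<Rightarrow> real" where "field_rate V \<equiv> L + K * V / e"

abbreviation velocity_rate :: "real \<Rightarrow> real" where "velocity_rate V \<equiv> M / e + V / e^2"

definition y :: "real \<Rightarrow> real^2" where
  "y t = guiding_center e (x t) (v t)"

lemma initial: "x 0 = x0" "v 0 = v0"
  using exact by (auto simp: exact_solution_def)

lemma x_derivative: "t \<ge> 0 \<Longrightarrow> (x has_vector_derivative (1 / e) *\<^sub>R v t) (at t within {0..})"
  and v_derivative: "t \<ge> 0 \<Longrightarrow>
    (v has_vector_derivative (1 / e) *\<^sub>R E (t, x t) - (1 / e^2) *\<^sub>R perp (v t)) (at t within {0..})"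
proof -
  assume t: "t \<ge> 0"
  obtain x' v' where d: "(x has_vector_derivative x') (at t within {0..})"
    "(v has_vector_derivative v') (at t within {0..})"
    and e: "e *\<^sub>R x' = v t" "e *\<^sub>R v' = E (t, x t) - perp (v t) /\<^sub>R e"
    using exact t unfolding exact_solution_def by blast
  have "(1 / e) *\<^sub>R (e *\<^sub>R x') = (1 / e) *\<^sub>R v t" unfolding e ..
  then have "x' = (1 / e) *\<^sub>R v t" using eps by simp
  then show "(x has_vector_derivative (1 / e) *\<^sub>R v t) (at t within {0..})" using d by simp
  have "(1 / e) *\<^sub>R (e *\<^sub>R v') = (1 / e) *\<^sub>R (E (t, x t) - perp (v t) /\<^sub>R e)" unfolding e ..
  moreover have "(1 / e) * inverse e = 1 / e^2" by (simp add: power2_eq_square divide_inverse)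
  ultimately have "v' = (1 / e) *\<^sub>R E (t, x t) - (1 / e^2) *\<^sub>R perp (v t)"
    using eps by (simp only: scaleR_scaleR scaleR_diff_right) simp
  then show "(v has_vector_derivative (1 / e) *\<^sub>R E (t, x t) - (1 / e^2) *\<^sub>R perp (v t)) (at t within {0..})"
    using d by simp
qed

text \<open>The singular terms of \<open>x'\<close> and \<open>e perp v'\<close> cancel.\<close>

lemma y_derivative:
  assumes "t \<ge> 0"
  shows "(y has_vector_derivative - perp (E (t, x t))) (at t within {0..})"
proof -
  have p: "((\<lambda>t. perp (v t)) has_vector_derivative perp ((1 / e) *\<^sub>R E (t, x t) - (1 / e^2) *\<^sub>R perp (v t))) (at t within {0..})"
    using bounded_linear.has_vector_derivative[OF bounded_linear_perp v_derivative[OF assms]] .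
  have "((\<lambda>t. x t - e *\<^sub>R perp (v t)) has_vector_derivative
      (1 / e) *\<^sub>R v t - e *\<^sub>R perp ((1 / e) *\<^sub>R E (t, x t) - (1 / e^2) *\<^sub>R perp (v t))) (at t within {0..})"
    using x_derivative[OF assms] has_vector_derivative_scaleR[OF DERIV_const p, of e]
    by (intro has_vector_derivative_diff) auto
  moreover have "(1 / e) *\<^sub>R v t - e *\<^sub>R perp ((1 / e) *\<^sub>R E (t, x t) - (1 / e^2) *\<^sub>R perp (v t)) = - perp (E (t, x t))"
    using eps by (simp add: perp_simps scaleR_diff_right scaleR_add_right power2_eq_square)
  ultimately show ?thesis
    by (simp add: y_def[abs_def] guiding_center_def)
qed

lemma v_continuous: "continuous_on {0..} v"
  using v_derivative by (auto intro!: has_vector_derivative_continuous simp: continuous_on_eq_continuous_within)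

lemma v_bounded_on: "\<exists>V\<ge>0. \<forall>t\<in>{0..T}. norm (v t) \<le> V"
proof -
  have "compact (v ` {0..T})"
    by (intro compact_continuous_image continuous_on_subset[OF v_continuous]) auto
  then obtain V where "\<forall>t\<in>{0..T}. norm (v t) \<le> V"
    by (auto dest!: compact_imp_bounded simp: bounded_iff)
  then show ?thesis by (intro exI[of _ "max 0 V"]) auto
qed

context
  fixes s h V :: real
  assumes s: "s \<ge> 0" and h: "h \<ge> 0" and V: "\<And>r. r \<in> {s..s + h} \<Longrightarrow> norm (v r) \<le> V"
begin

lemma V_nonneg: "V \<ge> 0"
  using order_trans[OF norm_ge_zero V[of s]] h by simp

lemma x_step:
  assumes "r \<in> {s..s + h}" shows "norm (x r - x s) \<le> h * (V / e)"
proof -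
  have "norm (x (s + (r - s)) - x s - (r - s) *\<^sub>R 0) \<le> (r - s) * (V / e)"
    using assms s eps V by (intro increment_bound[where f' = "\<lambda>r. (1 / e) *\<^sub>R v r"])
      (auto intro!: x_derivative simp: divide_right_mono)
  also have "\<dots> \<le> h * (V / e)" using assms V_nonneg eps by (intro mult_right_mono) auto
  finally show ?thesis by simp
qed

lemma E_step:
  assumes "r \<in> {s..s + h}" shows "norm (E (r, x r) - E (s, x s)) \<le> h * field_rate V"
proof -
  have "norm (E (r, x r) - E (s, x s)) \<le> L * \<bar>r - s\<bar> + K * norm (x r - x s)"
    using assms s by (intro field_lipschitz) auto
  also have "\<dots> \<le> L * h + K * (h * (V / e))"
    using assms x_step[OF assms] bounds_nonneg by (intro add_mono mult_left_mono) auto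
  finally show ?thesis by (simp add: algebra_simps)
qed

lemma v_step:
  assumes "r \<in> {s..s + h}" shows "norm (v r - v (s + h)) \<le> h * velocity_rate V"
proof -
  have "norm (v (r + (s + h - r)) - v r - (s + h - r) *\<^sub>R 0) \<le> (s + h - r) * velocity_rate V"
  proof (rule increment_bound)
    fix q assume q: "q \<in> {r..r + (s + h - r)}"
    then show "(v has_vector_derivative (1 / e) *\<^sub>R E (q, x q) - (1 / e^2) *\<^sub>R perp (v q)) (at q within {0..})"
      using s assms by (intro v_derivative) auto
    have "norm ((1 / e) *\<^sub>R E (q, x q) - (1 / e^2) *\<^sub>R perp (v q)) \<le>
        norm ((1 / e) *\<^sub>R E (q, x q)) + norm ((1 / e^2) *\<^sub>R perp (v q))"
      by (rule norm_triangle_ineq4)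
    also have "\<dots> \<le> M / e + V / e^2"
      using eps s assms q field_le[of q "x q"] V[of q] by (intro add_mono) (auto simp: divide_right_mono)
    finally show "norm ((1 / e) *\<^sub>R E (q, x q) - (1 / e^2) *\<^sub>R perp (v q) - 0) \<le> M / e + V / e^2"
      by simp
  qed (use s assms in auto)
  also have "\<dots> \<le> h * velocity_rate V"
    using assms V_nonneg eps bounds_nonneg by (intro mult_right_mono add_nonneg_nonneg) auto
  finally show ?thesis by (simp add: norm_minus_commute)
qed

lemma v_consistency:
  "norm (step_residual e h (v (s + h)) (v s) (E (s, x s)))
    \<le> h^2 * (field_rate V / e + velocity_rate V / e^2)"
proof -
  have "norm (v (s + h) - v s - h *\<^sub>R ((1 / e) *\<^sub>R E (s, x s) - (1 / e^2) *\<^sub>R perp (v (s + h))))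
      \<le> h * (h * (field_rate V / e + velocity_rate V / e^2))"
  proof (rule increment_bound[OF s h])
    fix r assume r: "r \<in> {s..s + h}"
    then show "(v has_vector_derivative (1 / e) *\<^sub>R E (r, x r) - (1 / e^2) *\<^sub>R perp (v r)) (at r within {0..})"
      using s by (intro v_derivative) auto
    have "(1 / e) *\<^sub>R E (r, x r) - (1 / e^2) *\<^sub>R perp (v r) - ((1 / e) *\<^sub>R E (s, x s) - (1 / e^2) *\<^sub>R perp (v (s + h)))
        = (1 / e) *\<^sub>R (E (r, x r) - E (s, x s)) - (1 / e^2) *\<^sub>R perp (v r - v (s + h))"
      by (simp add: perp_simps algebra_simps)
    also have "norm \<dots> \<le> norm ((1 / e) *\<^sub>R (E (r, x r) - E (s, x s))) + norm ((1 / e^2) *\<^sub>R perp (v r - v (s + h)))"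
      by (rule norm_triangle_ineq4)
    also have "\<dots> = norm (E (r, x r) - E (s, x s)) / e + norm (v r - v (s + h)) / e^2"
      using eps by simp
    also have "\<dots> \<le> h * field_rate V / e + h * velocity_rate V / e^2"
      using E_step[OF r] v_step[OF r] eps by (intro add_mono divide_right_mono) auto
    finally show "norm ((1 / e) *\<^sub>R E (r, x r) - (1 / e^2) *\<^sub>R perp (v r) - ((1 / e) *\<^sub>R E (s, x s) - (1 / e^2) *\<^sub>R perp (v (s + h))))
        \<le> h * (field_rate V / e + velocity_rate V / e^2)"
      by (simp add: distrib_left)
  qed
  then show ?thesis by (simp add: scaleR_diff_right algebra_simps power2_eq_square)
qed

lemma x_consistency:
  "norm (x (s + h) - x s - (h / e) *\<^sub>R v (s + h)) \<le> h^2 * (velocity_rate V / e)"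
proof -
  have "norm (x (s + h) - x s - h *\<^sub>R ((1 / e) *\<^sub>R v (s + h))) \<le> h * (h * (velocity_rate V / e))"
  proof (rule increment_bound[OF s h])
    fix r assume r: "r \<in> {s..s + h}"
    then show "(x has_vector_derivative (1 / e) *\<^sub>R v r) (at r within {0..})"
      using s by (intro x_derivative) auto
    have "norm ((1 / e) *\<^sub>R v r - (1 / e) *\<^sub>R v (s + h)) = norm (v r - v (s + h)) / e"
      using eps by (simp add: scaleR_diff_right[symmetric])
    also have "\<dots> \<le> h * velocity_rate V / e" using v_step[OF r] eps by (intro divide_right_mono) auto
    finally show "norm ((1 / e) *\<^sub>R v r - (1 / e) *\<^sub>R v (s + h)) \<le> h * (velocity_rate V / e)"
      by simp
  qed
  then show ?thesis by (simp add: power2_eq_square)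
qed

lemma E_increment:
  "norm (E (s + h, x (s + h)) - E (s, x s)) \<le> h * (L + K * norm (v (s + h)) / e) + h^2 * (K * (velocity_rate V / e))"
proof -
  have "norm (x (s + h) - x s) \<le> norm (x (s + h) - x s - (h / e) *\<^sub>R v (s + h)) + norm ((h / e) *\<^sub>R v (s + h))"
    using norm_triangle_ineq[of "x (s + h) - x s - (h / e) *\<^sub>R v (s + h)" "(h / e) *\<^sub>R v (s + h)"] by simp
  also have "\<dots> \<le> h^2 * (velocity_rate V / e) + h / e * norm (v (s + h))"
    using x_consistency h eps by simp
  finally have "K * norm (x (s + h) - x s) \<le> K * (h^2 * (velocity_rate V / e) + h / e * norm (v (s + h)))"
    using bounds_nonneg by (intro mult_left_mono)
  moreover have "norm (E (s + h, x (s + h)) - E (s, x s)) \<le> L * \<bar>s + h - s\<bar> + K * norm (x (s + h) - x s)"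
    using s h by (intro field_lipschitz) auto
  ultimately show ?thesis
    using h by (simp add: algebra_simps)
qed

lemma y_consistency:
  assumes "\<And>r. r \<in> {s..s + h} \<Longrightarrow> norm (E (r, x r) - F) \<le> B"
  shows "norm (y (s + h) - y s + h *\<^sub>R perp F) \<le> h * B"
proof -
  have "norm (y (s + h) - y s - h *\<^sub>R (- perp F)) \<le> h * B"
  proof (rule increment_bound[OF s h])
    fix r assume r: "r \<in> {s..s + h}"
    then show "(y has_vector_derivative - perp (E (r, x r))) (at r within {0..})"
      using s by (intro y_derivative) auto
    have "- perp (E (r, x r)) - - perp F = - perp (E (r, x r) - F)" by (simp add: perp_simps)
    then have "norm (- perp (E (r, x r)) - - perp F) = norm (E (r, x r) - F)"
      by (simp only: norm_minus_cancel norm_perp)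
    then show "norm (- perp (E (r, x r)) - - perp F) \<le> B" using assms[OF r] by simp
  qed
  then show ?thesis by simp
qed

end

lemma y_lipschitz:
  assumes "0 \<le> s" "s \<le> r"
  shows "norm (y r - y s) \<le> M * (r - s)"
proof -
  obtain V where V: "\<forall>t\<in>{0..r}. norm (v t) \<le> V" using v_bounded_on by blast
  have "norm (y (s + (r - s)) - y s + (r - s) *\<^sub>R perp 0) \<le> (r - s) * M"
    by (rule y_consistency[of s "r - s" V]) (use assms field_le V in auto)
  then show ?thesis by (simp add: perp_simps mult.commute)
qed

end

section \<open>Error estimates for Lipschitz fields\<close>

context exact_flow
begin

text \<open>The exact trajectory, sampled with step \<open>h = T / N\<close>, is a perturbed scheme with \<open>\<tau> = O (h^2)\<close>. The \<open>N\<close> defects add up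
to \<open>O (1 / N)\<close>. Since \<open>E\<close> is merely Lipschitz, the shifted velocity need not be differentiable and a
differential Gronwall argument is not available.\<close>

lemma exact_velocity_bound:
  assumes "T \<ge> 0"
  shows "norm (v T) \<le> vel_const * (1 + T) * (norm v0 + e) * exp (K * T)"
proof (cases "T = 0")
  case True
  have "norm v0 \<le> 1 * (norm v0 + e)" using eps by simp
  also have "\<dots> \<le> vel_const * (norm v0 + e)"
    using vel_const_ge eps by (intro mult_right_mono) auto
  finally show ?thesis using True initial by simp
next
  case False
  then have T: "T > 0" using assms by simp
  obtain V where V: "V \<ge> 0" "\<forall>t\<in>{0..T}. norm (v t) \<le> V" using v_bounded_on by blast
  define C where "C = (field_rate V / e + velocity_rate V / e^2) + K * (velocity_rate V / e)"
  have parts: "0 \<le> field_rate V / e + velocity_rate V / e^2" "0 \<le> K * (velocity_rate V / e)"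
    using bounds_nonneg eps V(1) by auto
  have "norm (v T) \<le> exp (K * T) * (norm v0 + 2 * e * M + T * e * (L + K * M))
      + exp (K * T) * (1 + e) * C * T^2 / real N" if N: "1 \<le> N" for N :: nat
  proof -
    define h where "h = T / N"
    have h: "h > 0" "N * h = T" using T N by (auto simp: h_def)
    have "norm (v (real N * h)) \<le> exp (K * h * N) * (norm (v (real 0 * h)) + 2 * e * M + N * (h * e * (L + K * M) + (1 + e) * (h^2 * C)))"
    proof (rule perturbed_velocity_bound[where n = N and v = "\<lambda>k. v (real k * h)" and F = "\<lambda>k. E (real k * h, x (real k * h))"])
      show "h^2 * C \<ge> 0" using parts by (simp add: C_def)
      fix k assume k: "k < N"
      have "real (Suc k) * h \<le> N * h" using k h by (intro mult_right_mono) auto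
      then have le: "real k * h + h \<le> T" using h by (simp add: algebra_simps)
      have Vk: "norm (v r) \<le> V" if "r \<in> {real k * h..real k * h + h}" for r
        using V(2) le that h order_trans[of 0 "real k * h" r] by auto
      have Suc: "real (Suc k) * h = real k * h + h" by (simp add: algebra_simps)
      have s: "real k * h \<ge> 0" using h by simp
      have "norm (step_residual e h (v (real (Suc k) * h)) (v (real k * h)) (E (real k * h, x (real k * h))))
        \<le> h^2 * (field_rate V / e + velocity_rate V / e^2)"
        unfolding Suc by (rule v_consistency) (use s h Vk in auto)
      also have "\<dots> \<le> h^2 * C" using parts by (intro mult_left_mono) (auto simp: C_def)
      finally show "norm (step_residual e h (v (real (Suc k) * h)) (v (real k * h)) (E (real k * h, x (real k * h)))) \<le> h^2 * C" .
      have "norm (E (real (Suc k) * h, x (real (Suc k) * h)) - E (real k * h, x (real k * h)))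
        \<le> h * (L + K * norm (v (real (Suc k) * h)) / e) + h^2 * (K * (velocity_rate V / e))"
        unfolding Suc by (rule E_increment) (use s h Vk in auto)
      also have "h^2 * (K * (velocity_rate V / e)) \<le> h^2 * C" using parts by (intro mult_left_mono) (auto simp: C_def)
      finally show "norm (E (real (Suc k) * h, x (real (Suc k) * h)) - E (real k * h, x (real k * h)))
        \<le> h * (L + K * norm (v (real (Suc k) * h)) / e) + h^2 * C" by simp
    next
      show "norm (E (real k * h, x (real k * h))) \<le> M" for k
        using h by (intro field_le) simp
    qed (use h eps bounds_nonneg in auto)
    also have "\<dots> = exp (K * (N * h)) * (norm v0 + 2 * e * M + (N * h) * e * (L + K * M)) + exp (K * (N * h)) * (1 + e) * C * ((N * h) * h)"
      using initial by (simp add: algebra_simps power2_eq_square)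
    also have "(N * h) * h = T^2 / N" unfolding h(2) by (simp add: h_def power2_eq_square)
    finally show ?thesis unfolding h(2) by simp
  qed
  then have "norm (v T) \<le> exp (K * T) * (norm v0 + 2 * e * M + T * e * (L + K * M))"
    by (rule le_of_le_add_inverse_nat)
  also have "\<dots> \<le> exp (K * T) * (vel_const * (1 + T) * (norm v0 + e))"
    using assms eps by (intro mult_left_mono velocity_bound_simplify) auto
  finally show ?thesis by (simp add: mult.commute)
qed

end

locale scheme_and_flow = exact_flow +
  fixes dt :: real and xs vs :: "nat \<Rightarrow> real^2"
  assumes step_pos: "dt > 0" and scheme: "scheme_solution E e dt x0 v0 xs vs"
begin

definition t :: "nat \<Rightarrow> real" where "t k = real k * dt"

definition Y :: "nat \<Rightarrow> real^2" where "Y k = guiding_center e (xs k) (vs k)"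

text \<open>With the factor \<open>exp (K r)\<close>, a bound for both velocities at every time \<open>r\<close> up to \<open>t n\<close>. It is frozen at the final
time so that only the exponential varies in the Gronwall arguments.\<close>

definition W :: "nat \<Rightarrow> real" where "W n = vel_const * (1 + t n) * (norm v0 + e)"

lemma t_simps: "t 0 = 0" "t (Suc k) = t k + dt" "t k \<ge> 0"
  using step_pos by (simp_all add: t_def algebra_simps)

lemma t_mono: "k \<le> n \<Longrightarrow> t k \<le> t n"
  using step_pos by (simp add: t_def mult_right_mono)

lemma W_nonneg: "W n \<ge> 0"
  using vel_const_ge t_simps(3)[of n] eps by (simp add: W_def)

lemma W_mono: assumes "r \<ge> 0" "r \<le> t n" shows "vel_const * (1 + r) * (norm v0 + e) \<le> W n"
  unfolding W_def using assms vel_const_ge eps by (intro mult_right_mono mult_left_mono) auto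

lemma v_le: assumes "r \<ge> 0" "r \<le> t n" shows "norm (v r) \<le> W n * exp (K * r)"
  by (rule order_trans[OF exact_velocity_bound[OF assms(1)] mult_right_mono[OF W_mono[OF assms]]]) simp

lemma vs_le: assumes "k \<le> n" shows "norm (vs k) \<le> W n * exp (K * t k)"
  by (rule order_trans[OF scheme_velocity_bound[OF step_pos eps scheme, of k, folded t_def]
      mult_right_mono[OF W_mono[OF t_simps(3) t_mono[OF assms]]]]) simp

lemma scheme_eqs:
  "xs 0 = x0" "vs 0 = v0"
  "xs (Suc k) = xs k + (dt / e) *\<^sub>R vs (Suc k)"
  "vs (Suc k) + (dt / e^2) *\<^sub>R perp (vs (Suc k)) = vs k + (dt / e) *\<^sub>R E (t k, xs k)"
  using scheme unfolding scheme_solution_iff[OF eps step_pos] by (auto simp: t_def)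

text \<open>On the guiding centre the implicit scheme is the explicit Euler method, exactly.\<close>

lemma Y_step: "Y (Suc k) = Y k - dt *\<^sub>R perp (E (t k, xs k))"
proof -
  have "vs (Suc k) = vs k + (dt / e) *\<^sub>R E (t k, xs k) - (dt / e^2) *\<^sub>R perp (vs (Suc k))"
    using scheme_eqs(4)[of k] by (simp add: algebra_simps)
  then have "perp (vs (Suc k)) = perp (vs k) + (dt / e) *\<^sub>R perp (E (t k, xs k)) + (dt / e^2) *\<^sub>R vs (Suc k)"
    by (metis (no_types, lifting) diff_minus_eq_add perp_perp perp_simps(1) perp_simps(2) perp_simps(3) scaleR_minus_right)
  then have "e *\<^sub>R perp (vs (Suc k)) = e *\<^sub>R perp (vs k) + (e * (dt / e)) *\<^sub>R perp (E (t k, xs k)) + (e * (dt / e^2)) *\<^sub>R vs (Suc k)"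
    by (simp only: scaleR_add_right scaleR_scaleR)
  moreover have "e * (dt / e) = dt" "e * (dt / e^2) = dt / e" using eps by (simp_all add: power2_eq_square)
  ultimately show ?thesis
    using scheme_eqs(3)[of k] by (simp add: Y_def guiding_center_def)
qed

lemma initial_error: "Y 0 = y (t 0)" "vs 0 = v (t 0)"
  by (simp_all add: Y_def y_def t_simps scheme_eqs initial)

lemma x_error_le: "norm (xs k - x (t k)) \<le> norm (Y k - y (t k)) + e * norm (vs k - v (t k))"
proof -
  have "xs k - x (t k) = (Y k - y (t k)) + e *\<^sub>R perp (vs k - v (t k))"
    by (simp add: Y_def y_def guiding_center_def perp_simps algebra_simps)
  also have "norm \<dots> \<le> norm (Y k - y (t k)) + norm (e *\<^sub>R perp (vs k - v (t k)))"
    by (rule norm_triangle_ineq)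
  finally show ?thesis using eps by simp
qed

lemma exp_K_le: "r \<ge> 0 \<Longrightarrow> exp (K * r) \<le> exp (2 * K * r)"
  using bounds_nonneg by (simp add: mult_right_mono)

lemma W_exp_le: "W n * exp (K * t k) \<le> W n * exp (2 * K * dt * k)"
proof (rule mult_left_mono[OF _ W_nonneg])
  show "exp (K * t k) \<le> exp (2 * K * dt * k)"
    using exp_K_le[OF t_simps(3), of k] by (simp add: t_def ac_simps)
qed

lemma v_le_step:
  assumes "k < n" "r \<in> {t k..t k + dt}"
  shows "norm (v r) \<le> W n * exp (K * t (Suc k))"
proof -
  have r: "r \<ge> 0" "r \<le> t (Suc k)" using assms t_simps(2,3)[of k] by auto
  then have "norm (v r) \<le> W n * exp (K * r)"
    using t_mono[of "Suc k" n] assms by (intro v_le) auto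
  also have "\<dots> \<le> W n * exp (K * t (Suc k))"
    using r W_nonneg bounds_nonneg by (intro mult_left_mono) (auto intro: mult_left_mono)
  finally show ?thesis .
qed

lemma Y_error_step:
  assumes "\<And>r. r \<in> {t k..t k + dt} \<Longrightarrow> norm (E (r, x r) - E (t k, xs k)) \<le> B"
  shows "norm (Y (Suc k) - y (t (Suc k))) \<le> norm (Y k - y (t k)) + dt * B"
proof -
  obtain V where V: "\<forall>r\<in>{0..t k + dt}. norm (v r) \<le> V" using v_bounded_on by blast
  have "norm (y (t k + dt) - y (t k) + dt *\<^sub>R perp (E (t k, xs k))) \<le> dt * B"
    by (rule y_consistency[of "t k" dt V]) (use t_simps(3)[of k] step_pos V assms in auto)
  moreover have "Y (Suc k) - y (t (Suc k)) = (Y k - y (t k)) - (y (t k + dt) - y (t k) + dt *\<^sub>R perp (E (t k, xs k)))"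
    unfolding Y_step t_simps(2) by simp
  ultimately show ?thesis
    using norm_triangle_ineq4[of "Y k - y (t k)" "y (t k + dt) - y (t k) + dt *\<^sub>R perp (E (t k, xs k))"] by simp
qed

text \<open>The weight \<open>e\<close> in front of the velocity error makes the two errors comparable through
\<open>x = y + e perp v\<close>. The sources are bounded by \<open>exp (K t)\<close> and the recursion grows like
\<open>exp (2 K t)\<close>, so \<open>discrete_gronwall\<close> applies with the larger rate.\<close>

lemma stiff_error_bound:
  "norm (Y n - y (t n)) + e * norm (vs n - v (t n)) \<le>
    exp (2 * K * t n) * t n * dt * (2 * L + 2 * K * W n / e + M / e^2 + W n / e ^ 3)"
proof -
  define S where "S k = norm (Y k - y (t k)) + e * norm (vs k - v (t k))" for k
  define G where "G = dt^2 * (2 * L + 2 * K * W n / e + M / e^2 + W n / e ^ 3)"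
  have "S n \<le> exp (2 * K * dt * n) * (S 0 + n * G)"
  proof (rule discrete_gronwall[where n = n])
    show "0 \<le> 2 * K * dt" "\<And>k. 0 \<le> S k" using bounds_nonneg step_pos eps by (auto simp: S_def)
    fix k assume k: "k < n"
    define V where "V = W n * exp (K * t (Suc k))"
    have V: "norm (v r) \<le> V" if "r \<in> {t k..t k + dt}" for r
      unfolding V_def using v_le_step[OF k that] .
    note s = t_simps(3)[of k] order.strict_implies_order[OF step_pos]
    have X: "norm (E (t k, x (t k)) - E (t k, xs k)) \<le> K * S k"
    proof -
      have "norm (E (t k, x (t k)) - E (t k, xs k)) \<le> K * norm (x (t k) - xs k)"
        by (rule field_lipschitz_x[OF s(1)])
      also have "\<dots> \<le> K * S k"
        using x_error_le[of k] bounds_nonneg by (intro mult_left_mono) (auto simp: S_def norm_minus_commute)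
      finally show ?thesis .
    qed
    have Y: "norm (Y (Suc k) - y (t (Suc k))) \<le> norm (Y k - y (t k)) + dt * (dt * field_rate V + K * S k)"
    proof (rule Y_error_step)
      fix r assume "r \<in> {t k..t k + dt}"
      then have "norm (E (r, x r) - E (t k, x (t k))) \<le> dt * field_rate V"
        using E_step[OF s V, where r = r] by simp
      then show "norm (E (r, x r) - E (t k, xs k)) \<le> dt * field_rate V + K * S k"
        using X norm_triangle_ineq[of "E (r, x r) - E (t k, x (t k))" "E (t k, x (t k)) - E (t k, xs k)"] by simp
    qed
    define \<tau> where "\<tau> = step_residual e dt (v (t k + dt)) (v (t k)) (E (t k, x (t k)))"
    have \<tau>: "norm \<tau> \<le> dt^2 * (field_rate V / e + velocity_rate V / e^2)"
      unfolding \<tau>_def by (rule v_consistency[OF s V])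
    let ?f = "\<lambda>k. vs k - v (t k)"
    have "?f (Suc k) + (dt / e^2) *\<^sub>R perp (?f (Suc k))
        = ?f k - (dt / e) *\<^sub>R (E (t k, x (t k)) - E (t k, xs k)) - \<tau>"
    proof -
      have "?f (Suc k) + (dt / e^2) *\<^sub>R perp (?f (Suc k)) =
          (vs (Suc k) + (dt / e^2) *\<^sub>R perp (vs (Suc k))) - (v (t k + dt) + (dt / e^2) *\<^sub>R perp (v (t k + dt)))"
        by (simp add: t_simps(2) perp_simps scaleR_diff_right)
      also have "v (t k + dt) + (dt / e^2) *\<^sub>R perp (v (t k + dt)) = \<tau> + v (t k) + (dt / e) *\<^sub>R E (t k, x (t k))"
        by (simp add: \<tau>_def)
      finally show ?thesis unfolding scheme_eqs(4) by (simp add: scaleR_diff_right)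
    qed
    then have "norm (?f (Suc k)) \<le> norm (?f k - (dt / e) *\<^sub>R (E (t k, x (t k)) - E (t k, xs k)) - \<tau>)"
      using norm_le_norm_add_perp[of "?f (Suc k)" "dt / e^2"] by simp
    also have "\<dots> \<le> norm (?f k) + norm ((dt / e) *\<^sub>R (E (t k, x (t k)) - E (t k, xs k))) + norm \<tau>"
      by (rule order_trans[OF norm_triangle_ineq4 add_right_mono[OF norm_triangle_ineq4]])
    also have "norm ((dt / e) *\<^sub>R (E (t k, x (t k)) - E (t k, xs k))) \<le> (dt / e) * (K * S k)"
      using X step_pos eps by (simp add: mult_left_mono divide_right_mono)
    finally have "e * norm (?f (Suc k)) \<le> e * (norm (?f k) + (dt / e) * (K * S k) + dt^2 * (field_rate V / e + velocity_rate V / e^2))"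
      using \<tau> eps by (intro mult_left_mono) auto
    also have "\<dots> = e * norm (?f k) + dt * K * S k + dt^2 * (L + K * V / e + M / e^2 + V / e ^ 3)"
    proof -
      have c: "e * ((dt / e) * z) = dt * z" "e * (z / e) = z" "e * (velocity_rate V / e^2) = M / e^2 + V / e ^ 3" for z
        using eps by (simp_all add: add_divide_distrib distrib_left power2_eq_square power3_eq_cube)
      have "e * (norm (?f k) + (dt / e) * (K * S k) + dt^2 * (field_rate V / e + velocity_rate V / e^2))
          = e * norm (?f k) + e * ((dt / e) * (K * S k))
            + dt^2 * (e * (field_rate V / e) + e * (velocity_rate V / e^2))"
        by (simp only: distrib_left mult.left_commute mult.assoc)
      then show ?thesis unfolding c by (simp add: mult.assoc add.assoc)
    qed
    finally have fb: "e * norm (?f (Suc k)) \<le> e * norm (?f k) + dt * K * S k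
        + dt^2 * (L + K * V / e + M / e^2 + V / e ^ 3)" .
    have "S (Suc k) \<le> (1 + 2 * K * dt) * S k + dt^2 * (2 * L + 2 * K * V / e + M / e^2 + V / e ^ 3)"
    proof -
      define P Q where "P = L + K * V / e" and "Q = M / e^2 + V / e ^ 3"
      have b: "2 * L + 2 * K * V / e + M / e^2 + V / e ^ 3 = 2 * P + Q"
        "L + K * V / e + M / e^2 + V / e ^ 3 = P + Q"
        by (simp_all add: P_def Q_def)
      from Y[folded P_def] fb[unfolded b(2)] have "S (Suc k) \<le> norm (Y k - y (t k)) + dt * (dt * P + K * S k)
          + (e * norm (?f k) + dt * K * S k + dt^2 * (P + Q))"
        unfolding S_def[of "Suc k"] by (rule add_mono)
      also have "\<dots> = S k + 2 * K * dt * S k + dt^2 * (2 * P + Q)"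
        unfolding S_def[of k] by (simp add: algebra_simps power2_eq_square)
      finally show ?thesis unfolding b by (simp add: algebra_simps)
    qed
    also have "dt^2 * (2 * L + 2 * K * V / e + M / e^2 + V / e ^ 3) \<le> G * exp (2 * K * dt * Suc k)"
    proof -
      let ?e = "exp (2 * K * dt * Suc k)"
      have e1: "1 \<le> ?e" using bounds_nonneg step_pos by simp
      have VW: "V \<le> W n * ?e" unfolding V_def by (rule W_exp_le)
      have a: "z \<le> z * ?e" if "z \<ge> 0" for z using mult_left_mono[OF e1 that] by simp
      have "2 * L + 2 * K * V / e + M / e^2 + V / e ^ 3
          \<le> (2 * L) * ?e + 2 * K * (W n * ?e) / e + (M / e^2) * ?e + (W n * ?e) / e ^ 3"
        using VW eps bounds_nonneg
        by (intro add_mono a divide_right_mono mult_left_mono) auto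
      also have "\<dots> = (2 * L + 2 * K * W n / e + M / e^2 + W n / e ^ 3) * ?e"
        by (simp add: algebra_simps)
      finally show ?thesis
        unfolding G_def by (simp add: mult_left_mono mult.assoc)
    qed
    finally show "S (Suc k) \<le> (1 + 2 * K * dt) * S k + G * exp (2 * K * dt * Suc k)" by simp
  qed simp
  also have "S 0 = 0" by (simp add: S_def initial_error)
  finally show ?thesis
    by (simp add: S_def G_def t_def power2_eq_square ac_simps)
qed

text \<open>The increment of \<open>x\<close> over a step is of order \<open>dt / e\<close>, but that of \<open>y\<close> is of order \<open>dt\<close>. Comparing through \<open>y\<close>
trades the singular factor for the distance \<open>e norm v\<close> between position and guiding centre.\<close>

lemma drift_error_bound:
  "norm (Y n - y (t n)) \<le> exp (2 * K * t n) * t n * ((L + K * M) * dt + 2 * K * e * W n)"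
proof -
  define u where "u k = norm (Y k - y (t k))" for k
  define G where "G = dt * ((L + K * M) * dt + 2 * K * e * W n)"
  have "u n \<le> exp (2 * K * dt * n) * (u 0 + n * G)"
  proof (rule discrete_gronwall[where n = n])
    show "0 \<le> 2 * K * dt" "\<And>k. 0 \<le> u k" using bounds_nonneg step_pos by (auto simp: u_def)
    fix k assume k: "k < n"
    define V where "V = W n * exp (K * t (Suc k))"
    have "exp (K * t k) \<le> exp (K * t (Suc k))"
      using bounds_nonneg t_mono[of k "Suc k"] by (simp add: mult_left_mono)
    then have vsV: "norm (vs k) \<le> V"
      using vs_le[of k n] k mult_left_mono[OF _ W_nonneg[of n]] unfolding V_def by (meson less_imp_le order_trans)
    have "u (Suc k) \<le> u k + dt * (L * dt + K * (M * dt + u k + 2 * e * V))"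
      unfolding u_def
    proof (rule Y_error_step)
      fix r assume r: "r \<in> {t k..t k + dt}"
      have s: "0 \<le> t k" "t k \<le> r" using r t_simps(3)[of k] by auto
      have "x r - xs k = (y r - y (t k)) - (Y k - y (t k)) + e *\<^sub>R perp (v r) - e *\<^sub>R perp (vs k)"
        by (simp add: Y_def y_def guiding_center_def)
      also have "norm \<dots> \<le> norm (y r - y (t k)) + norm (Y k - y (t k)) + norm (e *\<^sub>R perp (v r)) + norm (e *\<^sub>R perp (vs k))"
        by (rule norm_triangle_four)
      also have "\<dots> = norm (y r - y (t k)) + norm (Y k - y (t k)) + e * norm (v r) + e * norm (vs k)"
        using eps by simp
      also have "\<dots> \<le> M * dt + norm (Y k - y (t k)) + e * V + e * V"
      proof (intro add_mono order_refl mult_left_mono vsV)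
        show "norm (y r - y (t k)) \<le> M * dt"
          by (rule order_trans[OF y_lipschitz[OF s]]) (use r bounds_nonneg in \<open>auto intro!: mult_left_mono\<close>)
        show "norm (v r) \<le> V" unfolding V_def by (rule v_le_step[OF k r])
      qed (use eps in auto)
      finally have X: "norm (x r - xs k) \<le> M * dt + norm (Y k - y (t k)) + 2 * e * V"
        by (simp add: algebra_simps)
      have "norm (E (r, x r) - E (t k, xs k)) \<le> L * \<bar>r - t k\<bar> + K * norm (x r - xs k)"
        using s by (intro field_lipschitz) auto
      also have "\<dots> \<le> L * dt + K * (M * dt + norm (Y k - y (t k)) + 2 * e * V)"
        using X r bounds_nonneg by (intro add_mono mult_left_mono) auto
      finally show "norm (E (r, x r) - E (t k, xs k)) \<le> L * dt + K * (M * dt + norm (Y k - y (t k)) + 2 * e * V)" .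
    qed
    also have "\<dots> = (1 + K * dt) * u k + dt * ((L + K * M) * dt + 2 * K * e * V)"
      by (simp add: algebra_simps)
    also have "\<dots> \<le> (1 + 2 * K * dt) * u k + G * exp (2 * K * dt * Suc k)"
    proof (rule add_mono)
      show "(1 + K * dt) * u k \<le> (1 + 2 * K * dt) * u k"
        using bounds_nonneg step_pos by (intro mult_right_mono) (auto simp: u_def)
      let ?e = "exp (2 * K * dt * Suc k)"
      have e1: "1 \<le> ?e" using bounds_nonneg step_pos by simp
      have VW: "V \<le> W n * ?e" unfolding V_def by (rule W_exp_le)
      have "(L + K * M) * dt \<le> ((L + K * M) * dt) * ?e"
        using mult_left_mono[OF e1, of "(L + K * M) * dt"] bounds_nonneg step_pos by simp
      moreover have "2 * K * e * V \<le> 2 * K * e * (W n * ?e)"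
        using VW bounds_nonneg eps by (intro mult_left_mono) auto
      ultimately have "(L + K * M) * dt + 2 * K * e * V \<le> ((L + K * M) * dt + 2 * K * e * W n) * ?e"
        by (simp add: distrib_right mult.assoc)
      then show "dt * ((L + K * M) * dt + 2 * K * e * V) \<le> G * ?e"
        unfolding G_def using step_pos by (simp add: mult_left_mono mult.assoc)
    qed
    finally show "u (Suc k) \<le> (1 + 2 * K * dt) * u k + G * exp (2 * K * dt * Suc k)" .
  qed simp
  also have "u 0 = 0" by (simp add: u_def initial_error)
  finally show ?thesis by (simp add: u_def G_def t_def ac_simps)
qed

end

section \<open>Cancellation of the fast rotation for smooth fields\<close>

locale smooth_field = lipschitz_field +
  fixes A :: "real \<times> (real^2) \<Rightarrow> real^2 \<Rightarrow> real^2" and a :: real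
  assumes a_nonneg: "a \<ge> 0"
    and A_linear: "linear (A z)"
    and A_le: "s \<ge> 0 \<Longrightarrow> norm (A (s, p) h) \<le> a * norm h"
    and A_lipschitz: "s \<ge> 0 \<Longrightarrow> r \<ge> 0 \<Longrightarrow> norm (A (s, p) h - A (r, q) h) \<le> a * (\<bar>s - r\<bar> + norm (p - q)) * norm h"
    and A_taylor: "s \<ge> 0 \<Longrightarrow> norm (E (s, p + h) - E (s, p) - A (s, p) h) \<le> a * (norm h)^2"
begin

text \<open>Linearising in \<open>e perp v\<close> leaves a term linear in \<open>perp v\<close>. From the velocity step,
\<open>h perp v_(k+1) = h e F_k - e^2 (v_(k+1) - v_k)\<close> up to the residual; the first part is of order \<open>e\<close>, and
the second is a difference, to be summed by parts.\<close>

lemma oscillating_sum_bound: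
  fixes v F Y :: "nat \<Rightarrow> real^2"
  assumes pos: "h > 0" "e > 0" "\<tau> \<ge> 0"
    and Y: "\<And>k. k < n \<Longrightarrow> norm (Y (Suc k) - Y k) \<le> h * M"
    and V: "\<And>k. k \<le> n \<Longrightarrow> norm (v k) \<le> V"
    and step: "\<And>k. k < n \<Longrightarrow> norm (step_residual e h (v (Suc k)) (v k) (F k)) \<le> \<tau>"
    and F: "\<And>k. k \<le> n \<Longrightarrow> norm (F k) \<le> M"
  shows "norm (\<Sum>k<n. h *\<^sub>R (E (real k * h, Y k + e *\<^sub>R perp (v k)) - E (real k * h, Y k)))
    \<le> a * (n * h * e^2 * V^2 + h * e * V + n * h * e^2 * M + 2 * e ^ 3 * V + n * h * (1 + M) * e ^ 3 * V + n * e ^ 3 * \<tau>)"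
proof -
  have V0: "V \<ge> 0" using order_trans[OF norm_ge_zero V[of 0]] by simp
  define B where "B k = A (real k * h, Y k)" for k
  have Blin: "linear (B k)" for k unfolding B_def by (rule A_linear)
  have Ble: "norm (B k z) \<le> a * norm z" for k z unfolding B_def using pos by (intro A_le) simp
  have Blip: "norm (B (Suc k) z - B k z) \<le> a * (h * (1 + M)) * norm z" if "k < n" for k z
  proof -
    have "norm (B (Suc k) z - B k z) \<le> a * (\<bar>real (Suc k) * h - real k * h\<bar> + norm (Y (Suc k) - Y k)) * norm z"
      unfolding B_def using pos by (intro A_lipschitz) auto
    also have "real (Suc k) * h - real k * h = h" by (simp add: algebra_simps)
    also have "a * (\<bar>h\<bar> + norm (Y (Suc k) - Y k)) * norm z \<le> a * (h * (1 + M)) * norm z"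
      using Y[OF that] pos a_nonneg by (intro mult_right_mono mult_left_mono) (auto simp: algebra_simps)
    finally show ?thesis .
  qed
  define R where "R k = E (real k * h, Y k + e *\<^sub>R perp (v k)) - E (real k * h, Y k) - B k (e *\<^sub>R perp (v k))" for k
  define Q where "Q k = B k ((h * e) *\<^sub>R perp (v k))" for k
  \<comment> \<open>\<open>R\<close> collects the second-order Taylor remainders and \<open>Q\<close> the linear part\<close>
  have split: "(\<Sum>k<n. h *\<^sub>R (E (real k * h, Y k + e *\<^sub>R perp (v k)) - E (real k * h, Y k)))
      = (\<Sum>k<n. h *\<^sub>R R k) + (\<Sum>k<n. Q k)"
    unfolding sum.distrib[symmetric]
    by (intro sum.cong refl) (simp add: R_def Q_def scaleR_diff_right linear_scale[OF Blin] algebra_simps)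
  have "norm (\<Sum>k<n. h *\<^sub>R R k) \<le> (\<Sum>k<n. h * (a * (e^2 * V^2)))"
  proof (rule sum_norm_le)
    fix k assume k: "k \<in> {..<n}"
    have "norm (R k) \<le> a * (norm (e *\<^sub>R perp (v k)))^2"
      unfolding R_def B_def using pos by (intro A_taylor) simp
    also have "\<dots> = a * (e^2 * (norm (v k))^2)" using pos by (simp add: power_mult_distrib)
    also have "\<dots> \<le> a * (e^2 * V^2)"
      using V[of k] k a_nonneg by (intro mult_left_mono power_mono) auto
    finally show "norm (h *\<^sub>R R k) \<le> h * (a * (e^2 * V^2))" using pos by (simp add: mult_left_mono)
  qed
  then have RR: "norm (\<Sum>k<n. h *\<^sub>R R k) \<le> a * (n * h * e^2 * V^2)" by (simp add: ac_simps)
  have QQ: "norm (\<Sum>k<n. Q k) \<le> a * (h * e * V + n * h * e^2 * M + 2 * e ^ 3 * V + n * h * (1 + M) * e ^ 3 * V + n * e ^ 3 * \<tau>)"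
  proof (cases n)
    case 0
    then show ?thesis using pos V0 a_nonneg bounds_nonneg by simp
  next
    case (Suc m)
    define r where "r k = step_residual e h (v (Suc k)) (v k) (F k)" for k
    have Qeq: "Q (Suc k) = (e^2 * h) *\<^sub>R B (Suc k) (F k) + e ^ 3 *\<^sub>R B (Suc k) (r k) - e ^ 3 *\<^sub>R B (Suc k) (v (Suc k) - v k)" for k
    proof -
      have "e ^ 3 * (h / e^2) = h * e" "e ^ 3 * (h / e) = e^2 * h"
        using pos by (simp_all add: power2_eq_square power3_eq_cube)
      then have "(h * e) *\<^sub>R perp (v (Suc k)) = (e^2 * h) *\<^sub>R F k + e ^ 3 *\<^sub>R r k - e ^ 3 *\<^sub>R (v (Suc k) - v k)"
        by (simp add: r_def scaleR_add_right scaleR_diff_right)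
      then show ?thesis unfolding Q_def
        by (simp only: linear_add[OF Blin] linear_diff[OF Blin] linear_scale[OF Blin])
    qed
    have "(\<Sum>k<n. Q k) = Q 0 + (\<Sum>k<m. Q (Suc k))" unfolding Suc by (rule sum.lessThan_Suc_shift)
    also have "(\<Sum>k<m. Q (Suc k)) = (\<Sum>k<m. (e^2 * h) *\<^sub>R B (Suc k) (F k)) + (\<Sum>k<m. e ^ 3 *\<^sub>R B (Suc k) (r k))
        - e ^ 3 *\<^sub>R (\<Sum>k<m. B (Suc k) (v (Suc k) - v k))"
      by (simp only: Qeq sum.distrib sum_subtractf scaleR_sum_right)
    finally have dec: "(\<Sum>k<n. Q k) = Q 0 + ((\<Sum>k<m. (e^2 * h) *\<^sub>R B (Suc k) (F k)) + (\<Sum>k<m. e ^ 3 *\<^sub>R B (Suc k) (r k))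
        - e ^ 3 *\<^sub>R (\<Sum>k<m. B (Suc k) (v (Suc k) - v k)))" .
    have b0: "norm (Q 0) \<le> a * (h * e * V)"
    proof -
      have "norm (Q 0) \<le> a * norm ((h * e) *\<^sub>R perp (v 0))" unfolding Q_def by (rule Ble)
      also have "\<dots> \<le> a * (h * e * V)" using V[of 0] pos a_nonneg by (intro mult_left_mono) auto
      finally show ?thesis .
    qed
    have b1: "norm (\<Sum>k<m. (e^2 * h) *\<^sub>R B (Suc k) (F k)) \<le> (\<Sum>k<m. (e^2 * h) * (a * M))"
    proof (rule sum_norm_le)
      fix k assume "k \<in> {..<m}"
      then have "norm (B (Suc k) (F k)) \<le> a * M"
        using F[of k] Suc a_nonneg by (intro order_trans[OF Ble] mult_left_mono) auto
      then show "norm ((e^2 * h) *\<^sub>R B (Suc k) (F k)) \<le> (e^2 * h) * (a * M)"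
        using pos by (simp add: mult_left_mono)
    qed
    have b2: "norm (\<Sum>k<m. e ^ 3 *\<^sub>R B (Suc k) (r k)) \<le> (\<Sum>k<m. e ^ 3 * (a * \<tau>))"
    proof (rule sum_norm_le)
      fix k assume "k \<in> {..<m}"
      then have "norm (B (Suc k) (r k)) \<le> a * \<tau>"
        using step[of k] Suc a_nonneg by (intro order_trans[OF Ble] mult_left_mono) (auto simp: r_def)
      then show "norm (e ^ 3 *\<^sub>R B (Suc k) (r k)) \<le> e ^ 3 * (a * \<tau>)"
        using pos by (simp add: mult_left_mono)
    qed
    have "norm (\<Sum>k<m. B (Suc k) (v (Suc k) - v k)) \<le> 2 * a * V + m * (a * (h * (1 + M))) * V"
      using Blin Ble Blip V Suc pos a_nonneg bounds_nonneg by (intro summation_by_parts_bound) auto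
    then have b3: "norm (e ^ 3 *\<^sub>R (\<Sum>k<m. B (Suc k) (v (Suc k) - v k))) \<le> e ^ 3 * (2 * a * V + m * (a * (h * (1 + M))) * V)"
      using pos by (simp add: mult_left_mono)
    have "norm (\<Sum>k<n. Q k) \<le> norm (Q 0) + norm (\<Sum>k<m. (e^2 * h) *\<^sub>R B (Suc k) (F k)) + norm (\<Sum>k<m. e ^ 3 *\<^sub>R B (Suc k) (r k))
        + norm (e ^ 3 *\<^sub>R (\<Sum>k<m. B (Suc k) (v (Suc k) - v k)))"
      unfolding dec by (smt (verit) norm_triangle_ineq norm_triangle_ineq4)
    also have "\<dots> \<le> a * (h * e * V) + real m * ((e^2 * h) * (a * M)) + real m * (e ^ 3 * (a * \<tau>))
        + e ^ 3 * (2 * a * V + m * (a * (h * (1 + M))) * V)"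
      using b0 b1 b2 b3 by (intro add_mono) simp_all
    also have "\<dots> \<le> a * (h * e * V) + real n * ((e^2 * h) * (a * M)) + real n * (e ^ 3 * (a * \<tau>))
        + e ^ 3 * (2 * a * V + n * (a * (h * (1 + M))) * V)"
      using Suc pos a_nonneg V0 bounds_nonneg by (intro add_mono mult_left_mono mult_right_mono order_refl) auto
    finally show ?thesis by (simp add: algebra_simps)
  qed
  show ?thesis
    unfolding split using norm_triangle_ineq[of "\<Sum>k<n. h *\<^sub>R R k" "\<Sum>k<n. Q k"] RR QQ
    by (simp add: distrib_left)
qed

end

locale smooth_scheme_and_flow = scheme_and_flow + smooth_field
begin

lemma continuous_E_along_y: "continuous_on {0..} (\<lambda>r. E (r, y r))"
proof (rule lipschitz_on_continuous_on[of "L + K * M"], rule lipschitz_onI)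
  have le: "norm (E (r, y r) - E (s, y s)) \<le> (L + K * M) * (r - s)" if "0 \<le> s" "s \<le> r" for s r
  proof -
    have "norm (E (r, y r) - E (s, y s)) \<le> L * \<bar>r - s\<bar> + K * norm (y r - y s)"
      using that by (intro field_lipschitz) auto
    also have "\<dots> \<le> L * (r - s) + K * (M * (r - s))"
      using that y_lipschitz[OF that] bounds_nonneg by (intro add_mono mult_left_mono) auto
    finally show ?thesis by (simp add: algebra_simps)
  qed
  fix r s :: real assume "r \<in> {0..}" "s \<in> {0..}"
  then show "dist (E (r, y r)) (E (s, y s)) \<le> (L + K * M) * dist r s"
    using le[of r s] le[of s r] by (cases "s \<le> r") (auto simp: dist_norm norm_minus_commute abs_if)
qed (use bounds_nonneg in auto)

text \<open>The integral of the field along the guiding centre: the common reference for the remainders of the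
scheme and of the exact flow.\<close>

definition z :: "real \<Rightarrow> real^2" where
  "z r = integral {0..r} (\<lambda>r. E (r, y r))"

lemma z_derivative:
  assumes "r \<ge> 0"
  shows "(z has_vector_derivative E (r, y r)) (at r within {0..})"
proof -
  have "continuous_on {0..r + 1} (\<lambda>r. E (r, y r))"
    by (rule continuous_on_subset[OF continuous_E_along_y]) auto
  then have "(z has_vector_derivative E (r, y r)) (at r within {0..r + 1})"
    unfolding z_def[abs_def] using assms by (intro integral_has_vector_derivative) auto
  moreover have "at r within {0..r + 1} = at r within {0..}"
    using assms by (intro at_within_nhd[of r "{..<r + 1}"]) auto
  ultimately show ?thesis by simp
qed

lemma z_step:
  assumes "s \<ge> 0" "h \<ge> 0"
  shows "norm (z (s + h) - z s - h *\<^sub>R E (s, y s)) \<le> h * (h * (L + K * M))"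
proof (rule increment_bound[OF assms z_derivative])
  fix r assume r: "r \<in> {s..s + h}"
  then show "r \<ge> 0" using assms by auto
  have "norm (E (r, y r) - E (s, y s)) \<le> L * \<bar>r - s\<bar> + K * norm (y r - y s)"
    using r assms by (intro field_lipschitz) auto
  also have "\<dots> \<le> L * h + K * (M * h)"
    using r y_lipschitz[of s r] assms bounds_nonneg mult_left_mono[of "r - s" h M]
    by (intro add_mono mult_left_mono) auto
  finally show "norm (E (r, y r) - E (s, y s)) \<le> h * (L + K * M)" by (simp add: algebra_simps)
qed

text \<open>The bound of \<open>oscillating_sum_bound\<close> over a time span \<open>T\<close>, without the contributions that vanish with the
step size.\<close>

definition Osc :: "real \<Rightarrow> real \<Rightarrow> real" where
  "Osc T V = a * (T * e^2 * V^2 + T * e^2 * M + 2 * e ^ 3 * V + T * (1 + M) * e ^ 3 * V)"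

text \<open>The guiding centre would be \<open>y 0 - perp (z T)\<close> if the field were evaluated at \<open>y\<close> instead of \<open>x\<close>. The
difference is an oscillating sum on every grid, and the defects vanish as the grid is refined.\<close>

lemma exact_remainder_bound:
  assumes T: "T \<ge> 0" and V: "\<And>r. r \<in> {0..T} \<Longrightarrow> norm (v r) \<le> V"
  shows "norm (y T - y 0 + perp (z T)) \<le> Osc T V"
proof (cases "T = 0")
  case True
  have "V \<ge> 0" using order_trans[OF norm_ge_zero V[of 0]] T by simp
  then show ?thesis using True a_nonneg eps by (simp add: z_def perp_simps Osc_def)
next
  case False
  then have T: "T > 0" using T by simp
  have V0: "V \<ge> 0" using order_trans[OF norm_ge_zero V[of 0]] T by simp
  define C1 where "C1 = field_rate V / e + velocity_rate V / e^2"
  define C2 where "C2 = field_rate V + (L + K * M)"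
  have C0: "C1 \<ge> 0" "C2 \<ge> 0" using bounds_nonneg V0 eps by (auto simp: C1_def C2_def)
  define g where "g r = y r - y 0 + perp (z r)" for r
  have "norm (g T) \<le> Osc T V + (a * (T * e * V + e ^ 3 * C1 * T^2) + C2 * T^2) / real N" if N: "1 \<le> N" for N :: nat
  proof -
    define h where "h = T / N"
    have h: "h > 0" "N * h = T" using T N by (auto simp: h_def)
    define P where "P k = E (real k * h, y (real k * h) + e *\<^sub>R perp (v (real k * h))) - E (real k * h, y (real k * h))" for k
    have Peq: "P k = E (real k * h, x (real k * h)) - E (real k * h, y (real k * h))" for k
      by (simp add: P_def y_def guiding_center_def)
    have Suc: "real (Suc k) * h = real k * h + h" for k by (simp add: algebra_simps)
    have s: "real k * h \<ge> 0" for k using h by simp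
    have le: "real k * h + h \<le> T" if "k < N" for k
    proof -
      have "real (Suc k) * h \<le> N * h" using that h by (intro mult_right_mono) auto
      then show ?thesis using h by (simp add: algebra_simps)
    qed
    have Vk: "norm (v r) \<le> V" if "k < N" "r \<in> {real k * h..real k * h + h}" for k r
      using V[of r] le[OF that(1)] that order_trans[OF s[of k], of r] by auto
    have gstep: "norm (g (real (Suc k) * h) - g (real k * h) + h *\<^sub>R perp (P k)) \<le> h^2 * C2" if k: "k < N" for k
    proof -
      have 1: "norm (y (real k * h + h) - y (real k * h) + h *\<^sub>R perp (E (real k * h, x (real k * h)))) \<le> h * (h * field_rate V)"
        using s h Vk[OF k] by (intro y_consistency[where V = V] E_step) auto
      have 2: "norm (z (real k * h + h) - z (real k * h) - h *\<^sub>R E (real k * h, y (real k * h))) \<le> h * (h * (L + K * M))"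
        using s h by (intro z_step) auto
      have "g (real (Suc k) * h) - g (real k * h) + h *\<^sub>R perp (P k)
          = (y (real k * h + h) - y (real k * h) + h *\<^sub>R perp (E (real k * h, x (real k * h))))
            + perp (z (real k * h + h) - z (real k * h) - h *\<^sub>R E (real k * h, y (real k * h)))"
        unfolding Suc g_def Peq by (simp add: perp_simps algebra_simps)
      also have "norm \<dots> \<le> h * (h * field_rate V) + h * (h * (L + K * M))"
        by (rule order_trans[OF norm_triangle_ineq add_mono[OF 1]]) (simp only: norm_perp 2)
      finally show ?thesis by (simp add: C2_def algebra_simps power2_eq_square)
    qed
    have sum: "norm (g (real n * h) + perp (\<Sum>k<n. h *\<^sub>R P k)) \<le> n * (h^2 * C2)" if "n \<le> N" for n
      using that
    proof (induction n)
      case 0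
      then show ?case by (simp add: g_def z_def perp_simps)
    next
      case (Suc n)
      have "g (real (Suc n) * h) + perp (\<Sum>k<Suc n. h *\<^sub>R P k)
          = (g (real n * h) + perp (\<Sum>k<n. h *\<^sub>R P k)) + (g (real (Suc n) * h) - g (real n * h) + h *\<^sub>R perp (P n))"
        by (simp add: perp_simps)
      also have "norm \<dots> \<le> n * (h^2 * C2) + h^2 * C2"
        by (rule order_trans[OF norm_triangle_ineq add_mono]) (use Suc gstep[of n] in auto)
      finally show ?case by (simp add: algebra_simps)
    qed
    have osc: "norm (\<Sum>k<N. h *\<^sub>R P k) \<le> a * (N * h * e^2 * V^2 + h * e * V + N * h * e^2 * M + 2 * e ^ 3 * V + N * h * (1 + M) * e ^ 3 * V + N * e ^ 3 * (h^2 * C1))"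
      unfolding P_def
    proof (rule oscillating_sum_bound[where F = "\<lambda>k. E (real k * h, x (real k * h))" and Y = "\<lambda>k. y (real k * h)" and v = "\<lambda>k. v (real k * h)"])
      show "h^2 * C1 \<ge> 0" using C0 by simp
      show "norm (E (real k * h, x (real k * h))) \<le> M" for k using s by (intro field_le)
      show "norm (v (real k * h)) \<le> V" if "k \<le> N" for k
        using V[of "real k * h"] s[of k] mult_right_mono[of "real k" N h] that h by auto
      fix k assume k: "k < N"
      show "norm (y (real (Suc k) * h) - y (real k * h)) \<le> h * M"
        using y_lipschitz[of "real k * h" "real k * h + h"] s[of k] h unfolding Suc by (simp add: mult.commute)
      show "norm (step_residual e h (v (real (Suc k) * h)) (v (real k * h)) (E (real k * h, x (real k * h)))) \<le> h^2 * C1"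
        unfolding Suc C1_def using s h Vk[OF k] by (intro v_consistency) auto
    qed (use h eps in auto)
    have "norm (g (real N * h)) \<le> norm (g (real N * h) + perp (\<Sum>k<N. h *\<^sub>R P k)) + norm (\<Sum>k<N. h *\<^sub>R P k)"
      using norm_triangle_ineq4[of "g (real N * h) + perp (\<Sum>k<N. h *\<^sub>R P k)" "perp (\<Sum>k<N. h *\<^sub>R P k)"] by simp
    also have "\<dots> \<le> N * (h^2 * C2) + a * (N * h * e^2 * V^2 + h * e * V + N * h * e^2 * M + 2 * e ^ 3 * V + N * h * (1 + M) * e ^ 3 * V + N * e ^ 3 * (h^2 * C1))"
      using sum[of N] osc by (intro add_mono) auto
    also have "\<dots> = Osc (N * h) V + a * (h * e * V + e ^ 3 * C1 * ((N * h) * h)) + C2 * ((N * h) * h)"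
      by (simp add: Osc_def algebra_simps power2_eq_square)
    also have "\<dots> = Osc T V + (a * (T * e * V + e ^ 3 * C1 * T^2) + C2 * T^2) / real N"
      unfolding h(2) by (simp add: h_def add_divide_distrib algebra_simps power2_eq_square)
    finally show ?thesis unfolding h(2) .
  qed
  then show ?thesis unfolding g_def by (rule le_of_le_add_inverse_nat)
qed

text \<open>The counterpart on the time grid of the scheme itself. The extra term comes from the first summand, for which
no earlier velocity step is available.\<close>

lemma scheme_remainder_bound:
  assumes V: "\<And>k. k \<le> n \<Longrightarrow> norm (vs k) \<le> V"
  shows "norm (Y n - Y 0 + perp (\<Sum>k<n. dt *\<^sub>R E (t k, Y k))) \<le> Osc (t n) V + a * dt * e * V"
proof -
  have "Y n - Y 0 + perp (\<Sum>k<n. dt *\<^sub>R E (t k, Y k)) = - perp (\<Sum>k<n. dt *\<^sub>R (E (t k, xs k) - E (t k, Y k)))"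
    by (induction n) (simp_all add: Y_step perp_simps algebra_simps)
  then have "norm (Y n - Y 0 + perp (\<Sum>k<n. dt *\<^sub>R E (t k, Y k))) = norm (\<Sum>k<n. dt *\<^sub>R (E (t k, xs k) - E (t k, Y k)))"
    by simp
  also have "(\<Sum>k<n. dt *\<^sub>R (E (t k, xs k) - E (t k, Y k)))
      = (\<Sum>k<n. dt *\<^sub>R (E (real k * dt, Y k + e *\<^sub>R perp (vs k)) - E (real k * dt, Y k)))"
    by (simp add: t_def Y_def guiding_center_def)
  also have "norm \<dots> \<le> a * (n * dt * e^2 * V^2 + dt * e * V + n * dt * e^2 * M + 2 * e ^ 3 * V + n * dt * (1 + M) * e ^ 3 * V + n * e ^ 3 * 0)"
  proof (rule oscillating_sum_bound[where F = "\<lambda>k. E (t k, xs k)"])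
    show "norm (E (t k, xs k)) \<le> M" for k by (rule field_le[OF t_simps(3)])
    then show "norm (Y (Suc k) - Y k) \<le> dt * M" for k
      using step_pos by (simp add: Y_step mult_left_mono)
    show "norm (step_residual e dt (vs (Suc k)) (vs k) (E (t k, xs k))) \<le> 0" for k
      using scheme_eqs(4)[of k] by simp
  qed (use step_pos eps V in auto)
  also have "\<dots> = Osc (t n) V + a * dt * e * V" by (simp add: Osc_def t_def algebra_simps)
  finally show ?thesis .
qed

text \<open>Squaring the velocity bound gives exactly the rate \<open>2 K\<close>.\<close>

lemma Osc_exp_le:
  assumes "0 \<le> s" "s \<le> T" "0 \<le> w" "0 \<le> T"
  shows "Osc s (w * exp (K * s)) \<le> Osc T w * exp (2 * K * s)"
proof -
  let ?e = "exp (2 * K * s)"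
  have e1: "1 \<le> ?e" using assms bounds_nonneg by simp
  have e2: "exp (K * s) \<le> ?e" by (rule exp_K_le[OF assms(1)])
  have sq: "(w * exp (K * s))^2 = w^2 * ?e"
    by (simp add: power_mult_distrib exp_double[symmetric])
  have wle: "w * exp (K * s) \<le> w * ?e" using e2 assms by (intro mult_left_mono) auto
  have "Osc s (w * exp (K * s)) \<le> a * (T * e^2 * (w^2 * ?e) + T * e^2 * (M * ?e) + 2 * e ^ 3 * (w * ?e) + T * (1 + M) * e ^ 3 * (w * ?e))"
    unfolding Osc_def sq
    using assms bounds_nonneg a_nonneg eps wle mult_left_mono[OF e1 bounds_nonneg(1)]
    by (intro mult_left_mono add_mono mult_mono mult_right_mono) auto
  also have "\<dots> = Osc T w * ?e" by (simp add: Osc_def algebra_simps)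
  finally show ?thesis .
qed

text \<open>After both remainders have been split off, the error is driven by
\<open>E (t k, Y k) - E (t k, y (t k))\<close> alone. Summation by parts needs the whole sum, hence the
summed form of Gronwall's inequality.\<close>

lemma guiding_center_error_bound:
  "norm (Y n - y (t n)) \<le>
    2 * (t n * (L + K * M) * dt + 2 * Osc (t n) (W n) + a * dt * e * W n) * exp (2 * K * t n)"
proof -
  define u where "u k = norm (Y k - y (t k))" for k
  define B where "B = t n * (L + K * M) * dt + 2 * Osc (t n) (W n) + a * dt * e * W n"
  have B0: "B \<ge> 0"
    using t_simps(3)[of n] W_nonneg[of n] bounds_nonneg a_nonneg step_pos eps
    by (auto simp: B_def Osc_def intro!: add_nonneg_nonneg mult_nonneg_nonneg)
  have "u n \<le> 2 * B * exp (2 * (K * dt) * n)"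
  proof (rule sum_gronwall[where n = n])
    show "0 \<le> K * dt" using bounds_nonneg step_pos by simp
    show "0 \<le> B" by (rule B0)
    fix k assume k: "k \<le> n"
    let ?e = "exp (2 * K * t k)"
    let ?V = "W n * exp (K * t k)"
    have exp_le: "exp (K * r) \<le> exp (K * t k)" if "r \<le> t k" for r
      using that bounds_nonneg by (simp add: mult_left_mono)
    have R1: "norm (Y k - Y 0 + perp (\<Sum>i<k. dt *\<^sub>R E (t i, Y i))) \<le> Osc (t k) ?V + a * dt * e * ?V"
    proof (rule scheme_remainder_bound)
      fix i assume i: "i \<le> k"
      show "norm (vs i) \<le> ?V"
        using vs_le[of i n] i k mult_left_mono[OF exp_le[OF t_mono[OF i]] W_nonneg[of n]] by simp
    qed
    have R2: "norm (y (t k) - y 0 + perp (z (t k))) \<le> Osc (t k) ?V"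
    proof (rule exact_remainder_bound[OF t_simps(3)])
      fix r assume r: "r \<in> {0..t k}"
      then show "norm (v r) \<le> ?V"
        using v_le[of r n] t_mono[OF k] mult_left_mono[OF exp_le[of r] W_nonneg[of n]] by simp
    qed
    have D: "norm ((\<Sum>i<j. dt *\<^sub>R E (t i, Y i)) - z (t j)) \<le> (\<Sum>i<j. dt * (K * u i) + dt * (dt * (L + K * M)))" for j
    proof (induction j)
      case 0
      then show ?case by (simp add: z_def t_simps)
    next
      case (Suc j)
      have eq: "(\<Sum>i<Suc j. dt *\<^sub>R E (t i, Y i)) - z (t (Suc j))
          = ((\<Sum>i<j. dt *\<^sub>R E (t i, Y i)) - z (t j)) + (dt *\<^sub>R (E (t j, Y j) - E (t j, y (t j)))
            - (z (t j + dt) - z (t j) - dt *\<^sub>R E (t j, y (t j))))"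
        by (simp add: t_simps algebra_simps)
      have "norm ((\<Sum>i<Suc j. dt *\<^sub>R E (t i, Y i)) - z (t (Suc j))) \<le> norm ((\<Sum>i<j. dt *\<^sub>R E (t i, Y i)) - z (t j)) + (norm (dt *\<^sub>R (E (t j, Y j) - E (t j, y (t j))))
            + norm (z (t j + dt) - z (t j) - dt *\<^sub>R E (t j, y (t j))))"
        unfolding eq by (rule order_trans[OF norm_triangle_ineq add_left_mono[OF norm_triangle_ineq4]])
      also have "\<dots> \<le> (\<Sum>i<j. dt * (K * u i) + dt * (dt * (L + K * M))) + (dt * (K * u j) + dt * (dt * (L + K * M)))"
      proof (intro add_mono Suc)
        show "norm (dt *\<^sub>R (E (t j, Y j) - E (t j, y (t j)))) \<le> dt * (K * u j)"
          using field_lipschitz_x[OF t_simps(3), of j "Y j" "y (t j)"] step_pos by (simp add: u_def mult_left_mono)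
        show "norm (z (t j + dt) - z (t j) - dt *\<^sub>R E (t j, y (t j))) \<le> dt * (dt * (L + K * M))"
          using t_simps(3)[of j] step_pos by (intro z_step) auto
      qed
      finally show ?case by simp
    qed
    have eq: "Y k - y (t k) = (Y k - Y 0 + perp (\<Sum>i<k. dt *\<^sub>R E (t i, Y i))) - (y (t k) - y 0 + perp (z (t k)))
        + 0 - perp ((\<Sum>i<k. dt *\<^sub>R E (t i, Y i)) - z (t k))"
      using initial_error(1) by (simp add: perp_simps t_simps)
    have "norm (Y k - y (t k)) \<le> norm (Y k - Y 0 + perp (\<Sum>i<k. dt *\<^sub>R E (t i, Y i))) + norm (y (t k) - y 0 + perp (z (t k)))
        + norm (0 :: real^2) + norm (perp ((\<Sum>i<k. dt *\<^sub>R E (t i, Y i)) - z (t k)))"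
      unfolding eq by (rule norm_triangle_four)
    then have "u k \<le> (Osc (t k) ?V + a * dt * e * ?V) + Osc (t k) ?V + (\<Sum>i<k. dt * (K * u i) + dt * (dt * (L + K * M)))"
      using R1 R2 D[of k] by (simp add: u_def)
    also have "(\<Sum>i<k. dt * (K * u i) + dt * (dt * (L + K * M))) = K * dt * (\<Sum>i<k. u i) + t k * (L + K * M) * dt"
      by (simp add: sum.distrib sum_distrib_left t_def ac_simps)
    also have "(Osc (t k) ?V + a * dt * e * ?V) + Osc (t k) ?V + (K * dt * (\<Sum>i<k. u i) + t k * (L + K * M) * dt)
        \<le> K * dt * (\<Sum>i<k. u i) + B * ?e"
    proof -
      have o: "Osc (t k) ?V \<le> Osc (t n) (W n) * ?e"
        by (rule Osc_exp_le[OF t_simps(3) t_mono[OF k] W_nonneg t_simps(3)])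
      have "exp (K * t k) \<le> ?e" by (rule exp_K_le[OF t_simps(3)])
      then have w: "a * dt * e * ?V \<le> a * dt * e * (W n * ?e)"
        using a_nonneg step_pos eps W_nonneg by (intro mult_left_mono) auto
      have "1 \<le> ?e" using bounds_nonneg t_simps(3) by simp
      then have l: "t k * (L + K * M) * dt \<le> t n * (L + K * M) * dt * ?e"
        using mult_mono[of "t k * (L + K * M) * dt" "t n * (L + K * M) * dt" 1 ?e] t_mono[OF k] t_simps(3) bounds_nonneg step_pos
        by (simp add: mult_right_mono)
      show ?thesis using o w l by (simp add: B_def distrib_right mult.assoc)
    qed
    finally show "u k \<le> K * dt * (\<Sum>i<k. u i) + B * exp (2 * (K * dt) * k)"
      by (simp add: t_def ac_simps)
  qed simp
  then show ?thesis by (simp add: u_def B_def t_def ac_simps)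
qed

end

section \<open>Explicit constants and the convergence theorem\<close>

lemma mult_mono3:
  fixes x y z :: real
  assumes "x \<le> p" "y \<le> q" "z \<le> d" "0 \<le> x" "0 \<le> y" "0 \<le> z"
  shows "x * y * z \<le> p * q * d"
  using assms by (intro mult_mono mult_nonneg_nonneg) auto

lemma le_add_mult_min:
  fixes X c c' F P Q :: real
  assumes "X \<le> c * (F * P)" "X \<le> c' * (F * Q)" and nonneg: "c \<ge> 0" "c' \<ge> 0" "F \<ge> 0" "P \<ge> 0" "Q \<ge> 0"
  shows "X \<le> (c + c') * (F * min P Q)"
proof -
  have "c * (F * P) \<le> (c + c') * (F * P)" "c' * (F * Q) \<le> (c + c') * (F * Q)"
    using nonneg by (intro mult_right_mono mult_nonneg_nonneg; simp)+
  then show ?thesis using assms(1,2) by (cases "P \<le> Q") (simp_all add: min_def)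
qed

lemma quadratic_bounds:
  fixes t :: real
  assumes "t \<ge> 0"
  shows "t \<le> 2 * (1 + t^2)" "1 + t \<le> 2 * (1 + t^2)" "t * (1 + t) \<le> 2 * (1 + t^2)"
proof -
  define s where "s = t^2"
  have "0 \<le> (t - 1)^2" by simp
  then have "2 * t \<le> 1 + s" by (simp add: s_def power2_eq_square algebra_simps)
  moreover have "t * (1 + t) = t + s" by (simp add: s_def power2_eq_square distrib_left)
  moreover have "0 \<le> s" by (simp add: s_def)
  ultimately have "t \<le> 2 * (1 + s)" "1 + t \<le> 2 * (1 + s)" "t * (1 + t) \<le> 2 * (1 + s)"
    using assms by simp_all
  then show "t \<le> 2 * (1 + t^2)" "1 + t \<le> 2 * (1 + t^2)" "t * (1 + t) \<le> 2 * (1 + t^2)"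
    by (simp_all only: s_def)
qed

lemma stiff_bound_polynomial:
  fixes t e d b c L K M :: real
  assumes nonneg: "t \<ge> 0" "d \<ge> 0" "b \<ge> 0" "c \<ge> 0" "L \<ge> 0" "K \<ge> 0" "M \<ge> 0" and eps: "e > 0"
    and W: "W = c * (1 + t) * (b + e)"
  shows "t * d * (2 * L + 2 * K * W / e + M / e^2 + W / e ^ 3)
    \<le> 2 * (2 * L + 2 * K * c + M + c) * (1 + t^2) * (1 + b + e) * (d / e ^ 3 * (1 + e^2))"
proof -
  define q where "q = (1 + t) * (1 + b + e) * (1 + e^2)"
  have q0: "q \<ge> 0" using assms by (simp add: q_def)
  have f1: "e ^ 3 \<le> q"
    using mult_mono3[of 1 "1 + t" e "1 + b + e" "e^2" "1 + e^2"] assms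
    by (simp add: q_def power2_eq_square power3_eq_cube)
  have f2: "W * e^2 \<le> c * q"
    using mult_left_mono[OF mult_mono3[of "1 + t" "1 + t" "b + e" "1 + b + e" "e^2" "1 + e^2"] nonneg(4)] assms
    by (simp add: q_def mult.assoc)
  have f3: "e \<le> q"
    using mult_mono3[of 1 "1 + t" e "1 + b + e" 1 "1 + e^2"] assms by (simp add: q_def)
  have f4: "W \<le> c * q"
    using mult_left_mono[OF mult_mono3[of "1 + t" "1 + t" "b + e" "1 + b + e" 1 "1 + e^2"] nonneg(4)] assms
    by (simp add: q_def mult.assoc)
  have "2 * L * e ^ 3 + 2 * K * (W * e^2) + M * e + W \<le> 2 * L * q + 2 * K * (c * q) + M * q + c * q"
    using f1 f2 f3 f4 nonneg by (intro add_mono mult_left_mono) auto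
  also have "\<dots> = (2 * L + 2 * K * c + M + c) * q" by (simp add: algebra_simps)
  finally have num: "2 * L * e ^ 3 + 2 * K * (W * e^2) + M * e + W \<le> (2 * L + 2 * K * c + M + c) * q" .
  have "2 * L + 2 * K * W / e + M / e^2 + W / e ^ 3 = (2 * L * e ^ 3 + 2 * K * (W * e^2) + M * e + W) / e ^ 3"
    using eps by (simp add: add_divide_distrib power2_eq_square power3_eq_cube)
  also have "\<dots> \<le> (2 * L + 2 * K * c + M + c) * q / e ^ 3"
    using num eps by (intro divide_right_mono) auto
  finally have "t * d * (2 * L + 2 * K * W / e + M / e^2 + W / e ^ 3) \<le> t * d * ((2 * L + 2 * K * c + M + c) * q / e ^ 3)"
    using nonneg by (intro mult_left_mono) auto
  also have "\<dots> = (t * (1 + t)) * ((2 * L + 2 * K * c + M + c) * (1 + b + e) * (d / e ^ 3 * (1 + e^2)))"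
    by (simp add: q_def ac_simps)
  also have "\<dots> \<le> 2 * (1 + t^2) * ((2 * L + 2 * K * c + M + c) * (1 + b + e) * (d / e ^ 3 * (1 + e^2)))"
    using assms by (intro mult_right_mono quadratic_bounds(3)) auto
  also have "\<dots> = 2 * (2 * L + 2 * K * c + M + c) * (1 + t^2) * (1 + b + e) * (d / e ^ 3 * (1 + e^2))"
    by (simp only: ac_simps)
  finally show ?thesis .
qed

lemma drift_bound_polynomial:
  fixes t e d b c L K M :: real
  assumes nonneg: "t \<ge> 0" "d \<ge> 0" "b \<ge> 0" "c \<ge> 0" "L \<ge> 0" "K \<ge> 0" "M \<ge> 0" and eps: "e > 0"
    and W: "W = c * (1 + t) * (b + e)"
  shows "t * ((L + K * M) * d + 2 * K * e * W) + 2 * e * W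
    \<le> (2 * (L + K * M) + 4 * K * c + 4 * c) * (1 + t^2) * (1 + b + e) * (d + e)"
proof -
  define X where "X = (1 + t^2) * (1 + b + e) * (d + e)"
  have t1: "t \<le> 2 * (1 + t^2)" "1 + t \<le> 2 * (1 + t^2)" "t * (1 + t) \<le> 2 * (1 + t^2)"
    by (rule quadratic_bounds[OF nonneg(1)])+
  have f1: "t * d \<le> 2 * X"
    using mult_mono3[OF t1(1), of 1 "1 + b + e" d "d + e"] assms by (simp add: X_def mult.assoc del: distrib_left_numeral)
  have f2: "t * (1 + t) * (b + e) * e \<le> 2 * X"
    using mult_mono3[OF t1(3), of "b + e" "1 + b + e" e "d + e"] assms by (simp add: X_def mult.assoc del: distrib_left_numeral)
  have f3: "(1 + t) * (b + e) * e \<le> 2 * X"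
    using mult_mono3[OF t1(2), of "b + e" "1 + b + e" e "d + e"] assms by (simp add: X_def mult.assoc del: distrib_left_numeral)
  have "t * ((L + K * M) * d + 2 * K * e * W) + 2 * e * W
      = (L + K * M) * (t * d) + (2 * K * c) * (t * (1 + t) * (b + e) * e) + (2 * c) * ((1 + t) * (b + e) * e)"
    by (simp add: W algebra_simps)
  also have "\<dots> \<le> (L + K * M) * (2 * X) + (2 * K * c) * (2 * X) + (2 * c) * (2 * X)"
    using f1 f2 f3 nonneg by (intro add_mono mult_left_mono) auto
  also have "\<dots> = (2 * (L + K * M) + 4 * K * c + 4 * c) * X" by (simp add: algebra_simps)
  finally show ?thesis by (simp add: X_def mult.assoc)
qed

lemma power4_bounds:
  fixes t :: real assumes "t \<ge> 0"
  shows "1 \<le> 1 + t ^ 4" "t \<le> 1 + t ^ 4" "t^2 \<le> 1 + t ^ 4" "t ^ 3 \<le> 1 + t ^ 4"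
proof -
  show "1 \<le> 1 + t ^ 4" using assms by simp
  have "t ^ k \<le> 1 + t ^ 4" if "k \<le> 4" for k
  proof (cases "t \<le> 1")
    case True
    then have "t ^ k \<le> 1" using assms by (simp add: power_le_one)
    then show ?thesis using assms by (simp add: add_increasing2)
  next
    case False
    then have "t ^ k \<le> t ^ 4" using that by (intro power_increasing) auto
    then show ?thesis by simp
  qed
  from this[of 1] this[of 2] this[of 3] show "t \<le> 1 + t ^ 4" "t^2 \<le> 1 + t ^ 4" "t ^ 3 \<le> 1 + t ^ 4"
    by simp_all
qed

lemma smooth_bound_polynomial:
  fixes t e d b c l M a :: real
  assumes nonneg: "t \<ge> 0" "d \<ge> 0" "b \<ge> 0" "c \<ge> 0" "l \<ge> 0" "M \<ge> 0" "a \<ge> 0" and eps: "e > 0"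
    and W: "W = c * (1 + t) * (b + e)"
  shows "t * l * d + 2 * (a * (t * e^2 * W^2 + t * e^2 * M + 2 * e ^ 3 * W + t * (1 + M) * e ^ 3 * W)) + a * d * e * W
    \<le> (l + 2 * a * (8 * c^2 + M + 8 * c + (1 + M) * (4 * c)) + 4 * a * c) * (1 + t ^ 4) * (1 + b^2 + e^2) * (d + e^2)"
proof -
  define X where "X = (1 + t ^ 4) * (1 + b^2 + e^2) * (d + e^2)"
  note p = power4_bounds[OF nonneg(1)]
  have Q: "1 \<le> 1 + b^2 + e^2" by simp
  have q1: "(b + e)^2 \<le> 2 * (1 + b^2 + e^2)"
    using zero_le_power2[of "b - e"] by (simp add: power2_eq_square algebra_simps)
  have q2: "(b + e) * e \<le> 2 * (1 + b^2 + e^2)"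
  proof -
    have "(b + e) * e \<le> (b + e)^2"
      using nonneg eps by (simp add: power2_eq_square mult_left_mono)
    with q1 show ?thesis by linarith
  qed
  define s where "s = t ^ 4"
  have "t * (1 + t)^2 = t + 2 * t^2 + t ^ 3" "t * (1 + t) = t + t^2"
    by (simp_all add: power2_eq_square power3_eq_cube algebra_simps)
  moreover have "0 \<le> s" by (simp add: s_def)
  ultimately have "t * (1 + t)^2 \<le> 4 * (1 + s)" "1 + t \<le> 2 * (1 + s)" "t * (1 + t) \<le> 2 * (1 + s)"
    using p(2,3,4)[folded s_def] by simp_all
  then have t2: "t * (1 + t)^2 \<le> 4 * (1 + t ^ 4)" "1 + t \<le> 2 * (1 + t ^ 4)" "t * (1 + t) \<le> 2 * (1 + t ^ 4)"
    by (simp_all only: s_def)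
  have num: "4 * A * (2 * B) * C = 8 * (A * B * C)" "2 * A * (2 * B) * C = 4 * (A * B * C)" for A B C :: real
    by simp_all
  have f1: "t * d \<le> X"
    using mult_mono3[OF p(2) Q, of d "d + e^2"] nonneg by (simp add: X_def)
  have f2: "t * e^2 * W^2 \<le> 8 * c^2 * X"
  proof -
    have "t * (1 + t)^2 * (b + e)^2 * e^2 \<le> 4 * (1 + t ^ 4) * (2 * (1 + b^2 + e^2)) * (d + e^2)"
      using nonneg by (intro mult_mono3 t2 q1) auto
    from mult_left_mono[OF this[unfolded num, folded X_def], of "c^2"]
    have "c^2 * (t * (1 + t)^2 * (b + e)^2 * e^2) \<le> c^2 * (8 * X)"
      by simp
    then show ?thesis by (simp add: W power_mult_distrib ac_simps)
  qed
  have f3: "t * e^2 * M \<le> M * X"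
    using mult_left_mono[OF mult_mono3[OF p(2) Q, of "e^2" "d + e^2"] nonneg(6)] nonneg by (simp add: X_def ac_simps)
  have f4: "e ^ 3 * W \<le> 4 * c * X"
  proof -
    have "(1 + t) * ((b + e) * e) * e^2 \<le> 2 * (1 + t ^ 4) * (2 * (1 + b^2 + e^2)) * (d + e^2)"
      using nonneg eps by (intro mult_mono3 t2 q2) auto
    from mult_left_mono[OF this[unfolded num, folded X_def] nonneg(4)]
    have "c * ((1 + t) * ((b + e) * e) * e^2) \<le> c * (4 * X)"
      by (simp only:)
    then show ?thesis by (simp add: W power2_eq_square power3_eq_cube ac_simps)
  qed
  have f5: "t * (e ^ 3 * W) \<le> 4 * c * X"
  proof -
    have "(t * (1 + t)) * ((b + e) * e) * e^2 \<le> 2 * (1 + t ^ 4) * (2 * (1 + b^2 + e^2)) * (d + e^2)"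
      using nonneg eps by (intro mult_mono3 t2 q2) auto
    from mult_left_mono[OF this[unfolded num, folded X_def] nonneg(4)]
    have "c * ((t * (1 + t)) * ((b + e) * e) * e^2) \<le> c * (4 * X)"
      by (simp only:)
    then show ?thesis by (simp add: W power2_eq_square power3_eq_cube ac_simps)
  qed
  have f6: "d * e * W \<le> 4 * c * X"
  proof -
    have "(1 + t) * ((b + e) * e) * d \<le> 2 * (1 + t ^ 4) * (2 * (1 + b^2 + e^2)) * (d + e^2)"
      using nonneg eps by (intro mult_mono3 t2 q2) auto
    from mult_left_mono[OF this[unfolded num, folded X_def] nonneg(4)]
    have "c * ((1 + t) * ((b + e) * e) * d) \<le> c * (4 * X)"
      by (simp only:)
    then show ?thesis by (simp add: W ac_simps)
  qed
  have "t * l * d + 2 * (a * (t * e^2 * W^2 + t * e^2 * M + 2 * e ^ 3 * W + t * (1 + M) * e ^ 3 * W)) + a * d * e * W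
      = l * (t * d) + 2 * (a * (t * e^2 * W^2 + t * e^2 * M + 2 * (e ^ 3 * W) + (1 + M) * (t * (e ^ 3 * W)))) + a * (d * e * W)"
    by (simp add: algebra_simps)
  also have "\<dots> \<le> l * X + 2 * (a * (8 * c^2 * X + M * X + 2 * (4 * c * X) + (1 + M) * (4 * c * X))) + a * (4 * c * X)"
    using f1 f2 f3 f4 f5 f6 nonneg by (intro add_mono mult_left_mono) auto
  also have "\<dots> = (l + 2 * a * (8 * c^2 + M + 8 * c + (1 + M) * (4 * c)) + 4 * a * c) * X"
    by (simp add: algebra_simps)
  finally show ?thesis by (simp add: X_def mult.assoc)
qed

text \<open>Passes from the weights of the position estimate to those of the guiding centre estimate.\<close>

lemma stiff_factor_compare:
  fixes t e b :: real
  assumes "t \<ge> 0" "b \<ge> 0" "e > 0"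
  shows "(1 + t^2) * ((1 + b + e) * (1 + e^2)) \<le> 6 * ((1 + t ^ 4) * ((1 + b^2 + e^2) * (1 + e)))"
proof -
  define s where "s = t ^ 4"
  have "0 \<le> s" by (simp add: s_def)
  then have "1 + t^2 \<le> 2 * (1 + s)" using power4_bounds(3)[OF assms(1), folded s_def] by simp
  then have T: "1 + t^2 \<le> 2 * (1 + t ^ 4)" by (simp only: s_def)
  define p q where "p = b^2" and "q = e^2"
  have pq: "0 \<le> p" "0 \<le> q" by (simp_all add: p_def q_def)
  have "0 \<le> (b - e)^2" "0 \<le> (b - 1)^2" by simp_all
  then have "2 * (b * e) \<le> p + q" "2 * b \<le> p + 1"
    by (simp_all add: p_def q_def power2_eq_square algebra_simps)
  then have sq: "b * e \<le> 1 + p + q" "b \<le> 1 + p + q" using pq by linarith+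
  define m n r where "m = (b * e) * e" and "n = q * e" and "r = p * e"
  have "m \<le> (1 + p + q) * e"
    using sq(1) assms unfolding m_def by (intro mult_right_mono) auto
  also have "\<dots> = e + r + n" by (simp add: n_def r_def algebra_simps)
  finally have m: "m \<le> e + r + n" .
  have nr: "0 \<le> n" "0 \<le> r" using pq assms by (simp_all add: n_def r_def)
  have "(1 + b + e) * (1 + q) = 1 + b + e + q + m + n"
    by (simp add: m_def n_def q_def power2_eq_square algebra_simps)
  also have "\<dots> \<le> 3 * (1 + p + q) + 3 * (e + r + n)"
    using m nr sq(2) pq assms by (simp add: algebra_simps)
  also have "\<dots> = 3 * ((1 + p + q) * (1 + e))" by (simp add: n_def r_def algebra_simps)
  finally have "(1 + b + e) * (1 + q) \<le> 3 * ((1 + p + q) * (1 + e))" .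
  then have R: "(1 + b + e) * (1 + e^2) \<le> 3 * ((1 + b^2 + e^2) * (1 + e))"
    by (simp only: p_def q_def)
  have "(1 + t^2) * ((1 + b + e) * (1 + e^2)) \<le> 2 * (1 + t ^ 4) * (3 * ((1 + b^2 + e^2) * (1 + e)))"
    using assms by (intro mult_mono T R) auto
  also have "\<dots> = 6 * ((1 + t ^ 4) * ((1 + b^2 + e^2) * (1 + e)))"
    by (simp del: distrib_left_numeral)
  finally show ?thesis .
qed

context scheme_and_flow
begin

definition stiff_const :: real where
  "stiff_const = 2 * (2 * L + 2 * K * vel_const + M + vel_const)"

lemma stiff_const_nonneg: "stiff_const \<ge> 0"
  using bounds_nonneg vel_const_ge by (simp add: stiff_const_def)

lemma stiff_error_le:
  "norm (Y n - y (t n)) + e * norm (vs n - v (t n)) \<le>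
    stiff_const * (1 + (t n)^2) * (1 + norm v0 + e) * (dt / e ^ 3 * (1 + e^2)) * exp (2 * K * t n)"
proof -
  have "t n * dt * (2 * L + 2 * K * W n / e + M / e^2 + W n / e ^ 3)
    \<le> stiff_const * (1 + (t n)^2) * (1 + norm v0 + e) * (dt / e ^ 3 * (1 + e^2))"
    unfolding stiff_const_def
    by (rule stiff_bound_polynomial[OF _ _ _ _ _ _ _ eps W_def])
       (use t_simps(3) step_pos vel_const_ge bounds_nonneg in auto)
  from mult_left_mono[OF this, of "exp (2 * K * t n)"] stiff_error_bound[of n]
  show ?thesis by (simp add: ac_simps)
qed

lemma position_error_le:
  "norm (xs n - x (t n)) \<le> (stiff_const + (2 * (L + K * M) + 4 * K * vel_const + 4 * vel_const)) *
    (1 + (t n)^2) * exp (2 * K * t n) * (1 + norm v0 + e) * min (dt / e ^ 3 * (1 + e^2)) (dt + e)"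
proof -
  define c2 where "c2 = 2 * (L + K * M) + 4 * K * vel_const + 4 * vel_const"
  have c2: "c2 \<ge> 0" using bounds_nonneg vel_const_ge by (simp add: c2_def)
  let ?F = "(1 + (t n)^2) * exp (2 * K * t n) * (1 + norm v0 + e)"
  have F0: "?F \<ge> 0" using eps by simp
  have A: "norm (xs n - x (t n)) \<le> stiff_const * (?F * (dt / e ^ 3 * (1 + e^2)))"
    using x_error_le[of n] stiff_error_le[of n] by (simp add: ac_simps)
  have B: "norm (xs n - x (t n)) \<le> c2 * (?F * (dt + e))"
  proof -
    have "norm (vs n - v (t n)) \<le> norm (vs n) + norm (v (t n))" by (rule norm_triangle_ineq4)
    also have "\<dots> \<le> 2 * (W n * exp (K * t n))"
      using vs_le[of n n] v_le[of "t n" n] t_simps(3)[of n] by simp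
    also have "\<dots> \<le> 2 * (W n * exp (2 * K * t n))"
      using exp_K_le[OF t_simps(3)[of n]] W_nonneg[of n] by (simp add: mult_left_mono)
    finally have "e * norm (vs n - v (t n)) \<le> e * (2 * (W n * exp (2 * K * t n)))"
      using eps by (intro mult_left_mono) auto
    then have "norm (xs n - x (t n)) \<le> exp (2 * K * t n) * t n * ((L + K * M) * dt + 2 * K * e * W n) + e * (2 * (W n * exp (2 * K * t n)))"
      using x_error_le[of n] drift_error_bound[of n] by linarith
    also have "\<dots> = exp (2 * K * t n) * (t n * ((L + K * M) * dt + 2 * K * e * W n) + 2 * e * W n)"
      by (simp add: algebra_simps)
    also have "\<dots> \<le> exp (2 * K * t n) * (c2 * (1 + (t n)^2) * (1 + norm v0 + e) * (dt + e))"
      unfolding c2_def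
      by (intro mult_left_mono drift_bound_polynomial[OF _ _ _ _ _ _ _ eps W_def])
         (use t_simps(3) step_pos vel_const_ge bounds_nonneg in auto)
    finally show ?thesis by (simp add: ac_simps)
  qed
  have "norm (xs n - x (t n)) \<le> (stiff_const + c2) * (?F * min (dt / e ^ 3 * (1 + e^2)) (dt + e))"
    using A B by (rule le_add_mult_min) (use stiff_const_nonneg c2 F0 step_pos eps in auto)
  then show ?thesis by (simp add: c2_def mult.assoc)
qed

end

context smooth_scheme_and_flow
begin

definition smooth_const :: real where
  "smooth_const = 2 * (L + K * M + 2 * a * (8 * vel_const^2 + M + 8 * vel_const + (1 + M) * (4 * vel_const)) + 4 * a * vel_const)"

lemma guiding_center_error_le:
  "norm (Y n - y (t n)) \<le> (6 * stiff_const + smooth_const) * (1 + t n ^ 4) * exp (2 * K * t n) *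
    (1 + (norm v0)^2 + e^2) * min (dt / e ^ 3 * (1 + e)) (dt + e^2)"
proof -
  let ?F = "(1 + t n ^ 4) * exp (2 * K * t n) * (1 + (norm v0)^2 + e^2)"
  have F0: "?F \<ge> 0" using t_simps(3)[of n] by simp
  have s0: "smooth_const \<ge> 0" using bounds_nonneg a_nonneg vel_const_ge by (simp add: smooth_const_def)
  have A: "norm (Y n - y (t n)) \<le> 6 * stiff_const * (?F * (dt / e ^ 3 * (1 + e)))"
  proof -
    have "0 \<le> e * norm (vs n - v (t n))" using eps by simp
    then have "norm (Y n - y (t n)) \<le> norm (Y n - y (t n)) + e * norm (vs n - v (t n))" by linarith
    also have "\<dots> \<le> stiff_const * (1 + (t n)^2) * (1 + norm v0 + e) * (dt / e ^ 3 * (1 + e^2)) * exp (2 * K * t n)"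
      by (rule stiff_error_le)
    also have "\<dots> = (stiff_const * (dt / e ^ 3) * exp (2 * K * t n)) * ((1 + (t n)^2) * ((1 + norm v0 + e) * (1 + e^2)))"
      by (simp only: ac_simps)
    also have "\<dots> \<le> (stiff_const * (dt / e ^ 3) * exp (2 * K * t n)) * (6 * ((1 + t n ^ 4) * ((1 + (norm v0)^2 + e^2) * (1 + e))))"
      using stiff_const_nonneg step_pos eps t_simps(3)[of n]
      by (intro mult_left_mono stiff_factor_compare mult_nonneg_nonneg) auto
    also have "\<dots> = 6 * stiff_const * (?F * (dt / e ^ 3 * (1 + e)))"
      by (simp only: ac_simps)
    finally show ?thesis .
  qed
  have B: "norm (Y n - y (t n)) \<le> smooth_const * (?F * (dt + e^2))"
  proof -
    have "t n * (L + K * M) * dt + 2 * Osc (t n) (W n) + a * dt * e * W n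
        \<le> (L + K * M + 2 * a * (8 * vel_const^2 + M + 8 * vel_const + (1 + M) * (4 * vel_const)) + 4 * a * vel_const)
          * (1 + t n ^ 4) * (1 + (norm v0)^2 + e^2) * (dt + e^2)"
      unfolding Osc_def
      by (rule smooth_bound_polynomial[OF _ _ _ _ _ _ _ eps W_def])
         (use t_simps(3) step_pos vel_const_ge bounds_nonneg a_nonneg in auto)
    from mult_left_mono[OF this, of 2] have "2 * (t n * (L + K * M) * dt + 2 * Osc (t n) (W n) + a * dt * e * W n)
        \<le> smooth_const * (1 + t n ^ 4) * (1 + (norm v0)^2 + e^2) * (dt + e^2)"
      by (simp add: smooth_const_def mult.assoc del: distrib_left_numeral)
    then have "2 * (t n * (L + K * M) * dt + 2 * Osc (t n) (W n) + a * dt * e * W n) * exp (2 * K * t n)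
        \<le> smooth_const * (1 + t n ^ 4) * (1 + (norm v0)^2 + e^2) * (dt + e^2) * exp (2 * K * t n)"
      by (rule mult_right_mono) simp
    with guiding_center_error_bound[of n] have "norm (Y n - y (t n))
        \<le> smooth_const * (1 + t n ^ 4) * (1 + (norm v0)^2 + e^2) * (dt + e^2) * exp (2 * K * t n)"
      by (rule order_trans)
    then show ?thesis by (simp only: ac_simps)
  qed
  have "norm (Y n - y (t n)) \<le> (6 * stiff_const + smooth_const) * (?F * min (dt / e ^ 3 * (1 + e)) (dt + e^2))"
    using A B by (rule le_add_mult_min) (use stiff_const_nonneg s0 F0 step_pos eps in auto)
  then show ?thesis by (simp add: mult.assoc)
qed

end

lemma Winf_field_lipschitz_field:
  assumes "Winf_field (Suc k) E"
  obtains M L where "lipschitz_field E M L (K_x E)"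
proof -
  obtain M where M: "M \<ge> 0" "\<And>t x. t \<ge> 0 \<Longrightarrow> norm (E (t, x)) \<le> M"
    using Winf_field_bounded[OF assms] by blast
  obtain L where L: "L-lipschitz_on ({0..} \<times> UNIV) E"
    using Winf_field_lipschitz[OF assms] by blast
  have "lipschitz_field E M L (K_x E)"
  proof
    show "M \<ge> 0" by (rule M)
    show "L \<ge> 0" using L by (rule lipschitz_on_nonneg)
    show "K_x E \<ge> 0" using assms by (intro norm_weak_derivative_le_K_x(1)) (auto simp: Winf_field_def)
    show "norm (E (t, x)) \<le> M" if "t \<ge> 0" for t x using M(2) that .
    show "norm (E (t, x) - E (s, x)) \<le> L * \<bar>t - s\<bar>" if "t \<ge> 0" "s \<ge> 0" for t s x
      using lipschitz_onD[OF L, of "(t, x)" "(s, x)"] that by (simp add: dist_norm)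
    show "norm (E (t, x) - E (t, y)) \<le> K_x E * norm (x - y)" if "t \<ge> 0" for t x y
      using Winf_field_lipschitz_x[OF assms that] .
  qed
  then show thesis by (rule that)
qed

theorem theorem3p1:
  fixes E :: efield
  shows "(\<forall>\<epsilon>>0. \<forall>\<Delta>t>0. \<forall>x0 v0.
      \<exists>!z. scheme_solution E \<epsilon> \<Delta>t x0 v0 (\<lambda>n. fst (z n)) (\<lambda>n. snd (z n))) \<and>
    (Winf_field 1 E \<longrightarrow>
      (\<exists>C. \<forall>n \<Delta>t \<epsilon> x0 v0 xs vs x v.
        \<Delta>t > 0 \<longrightarrow> \<epsilon> > 0 \<longrightarrow> scheme_solution E \<epsilon> \<Delta>t x0 v0 xs vs \<longrightarrow>
        exact_solution E \<epsilon> x0 v0 x v \<longrightarrow>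
        (let t = real n * \<Delta>t in
          norm (xs n - x t) \<le>
            C * (1 + t^2) * exp (2 * K_x E * t) * (1 + norm v0 + \<epsilon>) *
            min (\<Delta>t / \<epsilon>^3 * (1 + \<epsilon>^2)) (\<Delta>t + \<epsilon>)))) \<and>
    (Winf_field 2 E \<longrightarrow>
      (\<exists>C. \<forall>n \<Delta>t \<epsilon> x0 v0 xs vs x v.
        \<Delta>t > 0 \<longrightarrow> \<epsilon> > 0 \<longrightarrow> scheme_solution E \<epsilon> \<Delta>t x0 v0 xs vs \<longrightarrow>
        exact_solution E \<epsilon> x0 v0 x v \<longrightarrow>
        (let t = real n * \<Delta>t in
          norm (guiding_center \<epsilon> (xs n) (vs n) - guiding_center \<epsilon> (x t) (v t)) \<le>
            C * (1 + t^4) * exp (2 * K_x E * t) * (1 + (norm v0)^2 + \<epsilon>^2) *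
            min (\<Delta>t / \<epsilon>^3 * (1 + \<epsilon>)) (\<Delta>t + \<epsilon>^2))))"
  (is "_ \<and> (_ \<longrightarrow> ?lipschitz_bound) \<and> (_ \<longrightarrow> ?smooth_bound)")
proof (intro conjI impI allI)
  fix \<epsilon> \<Delta>t :: real and x0 v0 :: "real^2"
  assume "\<epsilon> > 0" "\<Delta>t > 0"
  then show "\<exists>!z. scheme_solution E \<epsilon> \<Delta>t x0 v0 (\<lambda>n. fst (z n)) (\<lambda>n. snd (z n))"
    by (rule ex1_scheme_solution)
next
  assume "Winf_field 1 E"
  then have "Winf_field (Suc 0) E" by simp
  then obtain M L where field: "lipschitz_field E M L (K_x E)"
    by (rule Winf_field_lipschitz_field)
  show ?lipschitz_bound
  proof (intro exI allI impI)
    fix n \<Delta>t \<epsilon> x0 v0 xs vs x v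
    assume h: "\<Delta>t > 0" "\<epsilon> > 0" "scheme_solution E \<epsilon> \<Delta>t x0 v0 xs vs" "exact_solution E \<epsilon> x0 v0 x v"
    interpret scheme_and_flow E M L "K_x E" \<epsilon> x0 v0 x v \<Delta>t xs vs
      using field h by (simp add: scheme_and_flow_def scheme_and_flow_axioms_def exact_flow_def exact_flow_axioms_def)
    show "let t = real n * \<Delta>t in
          norm (xs n - x t) \<le>
            (scheme_and_flow.stiff_const M L (K_x E) + (2 * (L + K_x E * M) + 4 * K_x E * lipschitz_field.vel_const M L (K_x E) + 4 * lipschitz_field.vel_const M L (K_x E)))
             * (1 + t^2) * exp (2 * K_x E * t) * (1 + norm v0 + \<epsilon>) *
            min (\<Delta>t / \<epsilon>^3 * (1 + \<epsilon>^2)) (\<Delta>t + \<epsilon>)"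
      using position_error_le[of n] by (simp add: Let_def t_def)
  qed
next
  assume W2: "Winf_field 2 E"
  then have "Winf_field (Suc 1) E" by (simp add: numeral_2_eq_2)
  then obtain M L where field: "lipschitz_field E M L (K_x E)"
    by (rule Winf_field_lipschitz_field)
  obtain A a where A: "smooth_field_axioms E A a"
    using Winf_field_2_taylor[OF W2] unfolding smooth_field_axioms_def by metis
  show ?smooth_bound
  proof (intro exI allI impI)
    fix n \<Delta>t \<epsilon> x0 v0 xs vs x v
    assume h: "\<Delta>t > 0" "\<epsilon> > 0" "scheme_solution E \<epsilon> \<Delta>t x0 v0 xs vs" "exact_solution E \<epsilon> x0 v0 x v"
    interpret smooth_scheme_and_flow E M L "K_x E" \<epsilon> x0 v0 x v \<Delta>t xs vs A a
      using field h A by (simp add: smooth_scheme_and_flow_def smooth_field_def scheme_and_flow_def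
          scheme_and_flow_axioms_def exact_flow_def exact_flow_axioms_def)
    show "let t = real n * \<Delta>t in
          norm (guiding_center \<epsilon> (xs n) (vs n) - guiding_center \<epsilon> (x t) (v t)) \<le>
            (6 * scheme_and_flow.stiff_const M L (K_x E) + smooth_scheme_and_flow.smooth_const M L (K_x E) a)
             * (1 + t^4) * exp (2 * K_x E * t) * (1 + (norm v0)^2 + \<epsilon>^2) *
            min (\<Delta>t / \<epsilon>^3 * (1 + \<epsilon>)) (\<Delta>t + \<epsilon>^2)"
      using guiding_center_error_le[of n] by (simp add: Let_def t_def Y_def y_def)
  qed
qed

end
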